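(* Let $n\in\mathbb N$ and $\ell\in\{1,\dots,n\}$. There is a constant $C(n,\ell)$, depending only on $n$ and $\ell$, such that the following holds. Let $\Omega\subset\mathbb R^n$ be a bounded domain that is star shaped with respect to a ball $B\subset\Omega$, and set $R=\operatorname{diam}(\Omega)$, $\rho=\operatorname{diam}(B)$. Then the Bogovskiĭ-type operator $\mathtt B_\ell$ satisfies, for every $u\in L^2(\Omega,\Lambda^\ell)$, $$|\mathtt B_\ell u|_{H^1(\Omega,\Lambda^{\ell-1})}\le C(n,\ell)\,\frac R\rho\,\kappa\,\|u\|_{L^2(\Omega,\Lambda^\ell)},$$ where 1. if $\ell<n/2+1$, then $\kappa=1$; 2. if $\ell\ge n/2+1$, then $\kappa=1+\left(\log\frac{|\Omega|}{|B|}\right)^{\frac{n}{2(\ell-1)}}\left(\frac{|\Omega|}{|B|}\right)^{\frac{2(\ell-1)-n}{2(\ell-1)}}$.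
   Context: A bounded domain $\Omega$ is star shaped with respect to a ball $B\subset\Omega$ if for every $y\in\Omega$ the convex hull of $B\cup\{y\}$ is contained in $\Omega$. $|E|$ denotes Lebesgue measure. The function $\theta$: for every multi-index $\alpha$ a constant $c(n,\alpha)$ depending only on $n$ and $\alpha$ is fixed once and for all (large enough that a function as follows exists for every ball), and $\theta\in C_0^\infty(B)$ satisfies $\int\theta\,dx=1$, $\|\partial^\alpha\theta\|_{L^1}\le c(n,\alpha)\operatorname{diam}(B)^{-|\alpha|}$ and $\|\partial^\alpha\theta\|_{L^\infty}\le c(n,\alpha)\operatorname{diam}(B)^{-n-|\alpha|}$. Forms: $\Lambda^\ell$ is the space of alternating $\ell$-linear forms on $\mathbb R^n$; an $\ell$-form $u$ on $\Omega$ is written $u=\sum_I u_I\,dx_I$ over increasing $\ell$-tuples $I=(i_1<\dots<i_\ell)$; $\|u\|_{L^2(\Omega,\Lambda^\ell)}^2=\sum_I\|u_I\|_{L^2(\Omega)}^2$ and $|u|_{H^1(\Omega,\Lambda^\ell)}^2=\sum_I|u_I|_{H^1(\Omega)}^2$, where $|\cdot|_{H^1}$ is the seminorm ($L^2$ norm of the gradient). For $z\in\mathbb R^n$, the contraction is $z\lrcorner u=\sum_I u_I\sum_{m=1}^\ell(-1)^{m-1}z_{i_m}\,dx_{\hat I_m}$, where $\hat I_m$ is $I$ with $i_m$ removed. Operator: with $G_\ell(x,y)=\int_1^\infty(t-1)^{n-\ell}t^{\ell-1}\theta(y+t(x-y))\,dt$, $$\mathtt B_\ell u(x)=\int G_\ell(x,y)\,(x-y)\lrcorner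 u(y)\,dy,$$ where $u$ is extended by zero outside $\Omega$. *)

theory Defs
  imports "HOL-Analysis.Analysis"
begin

text \<open>
  Throughout, \<open>\<real>\<^sup>n\<close> is \<open>real ^ 'n\<close> with \<open>n = CARD('n)\<close>. The class \<open>linorder\<close> on the index type is
  needed for the increasing tuples that index the basic forms \<open>dx\<^sub>I\<close>.
\<close>

section \<open>Partial derivatives, test functions\<close>

definition partial :: "'n::finite \<Rightarrow> ((real, 'n) vec \<Rightarrow> real) \<Rightarrow> (real, 'n) vec \<Rightarrow> real" where
  "partial i f x = frechet_derivative f (at x) (axis i 1)"

fun partials :: "'n::finite list \<Rightarrow> ((real, 'n) vec \<Rightarrow> real) \<Rightarrow> (real, 'n) vec \<Rightarrow> real" where
  "partials [] f = f"
| "partials (i # is) f = partial i (partials is f)"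

text \<open>\<open>C\<^sup>\<infinity>\<close>: every iterated partial derivative is (Frechet) differentiable everywhere, hence continuous.\<close>
definition smooth :: "(real ^ 'n::finite \<Rightarrow> real) \<Rightarrow> bool" where
  "smooth f \<longleftrightarrow> (\<forall>is x. partials is f differentiable (at x))"

definition multi_partial ::
    "('n::{finite,linorder} \<Rightarrow> nat) \<Rightarrow> ((real, 'n) vec \<Rightarrow> real) \<Rightarrow> (real, 'n) vec \<Rightarrow> real" where
  "multi_partial \<alpha> f =
     partials (concat (map (\<lambda>i. replicate (\<alpha> i) i) (sorted_list_of_set UNIV))) f"

definition multi_order :: "('n::finite \<Rightarrow> nat) \<Rightarrow> nat" where
  "multi_order \<alpha> = (\<Sum>i\<in>UNIV. \<alpha> i)"

text \<open>\<open>C\<^sub>0\<^sup>\<infinity>(U)\<close>, each function being extended by zero to the whole space.\<close>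
definition test_function :: "(real ^ 'n::finite) set \<Rightarrow> ((real, 'n) vec \<Rightarrow> real) \<Rightarrow> bool" where
  "test_function U \<phi> \<longleftrightarrow>
     smooth \<phi> \<and> compact (closure {x. \<phi> x \<noteq> 0}) \<and> closure {x. \<phi> x \<noteq> 0} \<subseteq> U"

section \<open>The spaces \<open>L\<^sup>2\<close> and \<open>H\<^sup>1\<close>\<close>

definition L2 :: "(real ^ 'n::finite) set \<Rightarrow> ((real, 'n) vec \<Rightarrow> real) \<Rightarrow> bool" where
  "L2 U f \<longleftrightarrow> f \<in> borel_measurable (lebesgue_on U) \<and> integrable (lebesgue_on U) (\<lambda>x. (f x)\<^sup>2)"

definition L2_norm :: "(real ^ 'n::finite) set \<Rightarrow> ((real, 'n) vec \<Rightarrow> real) \<Rightarrow> real" where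
  "L2_norm U f = sqrt (LINT x|lebesgue_on U. (f x)\<^sup>2)"

definition has_weak_partial ::
    "(real ^ 'n::finite) set \<Rightarrow> ((real, 'n) vec \<Rightarrow> real) \<Rightarrow> 'n \<Rightarrow> ((real, 'n) vec \<Rightarrow> real) \<Rightarrow> bool" where
  "has_weak_partial U f i g \<longleftrightarrow>
     (\<forall>\<phi>. test_function U \<phi> \<longrightarrow>
        (LINT x|lebesgue_on U. f x * partial i \<phi> x) = - (LINT x|lebesgue_on U. g x * \<phi> x))"

definition H1 :: "(real ^ 'n::finite) set \<Rightarrow> ((real, 'n) vec \<Rightarrow> real) \<Rightarrow> bool" where
  "H1 U f \<longleftrightarrow> L2 U f \<and> (\<forall>i. \<exists>g. L2 U g \<and> has_weak_partial U f i g)"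

text \<open>For open \<open>U\<close> and \<open>f\<close> in \<open>H\<^sup>1(U)\<close> the choice below is unique up to null sets.\<close>
definition weak_partial ::
    "(real ^ 'n::finite) set \<Rightarrow> ((real, 'n) vec \<Rightarrow> real) \<Rightarrow> 'n \<Rightarrow> (real, 'n) vec \<Rightarrow> real" where
  "weak_partial U f i = (SOME g. L2 U g \<and> has_weak_partial U f i g)"

definition H1_seminorm :: "(real ^ 'n::finite) set \<Rightarrow> ((real, 'n) vec \<Rightarrow> real) \<Rightarrow> real" where
  "H1_seminorm U f = sqrt (\<Sum>i\<in>UNIV. (L2_norm U (weak_partial U f i))\<^sup>2)"

section \<open>Alternating forms\<close>

text \<open>
  An \<open>\<ell>\<close>-linear form takes its arguments as a list of length \<open>\<ell>\<close>; its value on lists of any other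
  length is fixed to be 0, so that equality of forms is equality of functions.
\<close>
type_synonym 'n form = "(real, 'n) vec list \<Rightarrow> real"

definition alt_form :: "nat \<Rightarrow> 'n::finite form \<Rightarrow> bool" where
  "alt_form l w \<longleftrightarrow>
     (\<forall>vs i. length vs = l \<longrightarrow> i < l \<longrightarrow> linear (\<lambda>v. w (vs[i := v]))) \<and>
     (\<forall>vs i j. length vs = l \<longrightarrow> i < j \<longrightarrow> j < l \<longrightarrow> vs ! i = vs ! j \<longrightarrow> w vs = 0) \<and>
     (\<forall>vs. length vs \<noteq> l \<longrightarrow> w vs = 0)"

definition inc_tuples :: "nat \<Rightarrow> 'n::{finite,linorder} list set" where
  "inc_tuples l = {I. length I = l \<and> sorted_wrt (<) I}"

text \<open>\<open>dx\<^sub>I = dx\<^bsub>i1\<^esub> \<and> \<dots> \<and> dx\<^bsub>il\<^esub>\<close>, i.e. \<open>dx\<^sub>I(v\<^sub>1,\<dots>,v\<^sub>l) = det ((v\<^sub>b)\<^bsub>ia\<^esub>)\<close>, written out by the Leibniz formula.\<close>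
definition dx :: "'n::finite list \<Rightarrow> 'n form" where
  "dx I vs =
     (if length vs = length I
      then \<Sum>p | p permutes {..<length I}. of_int (sign p) * (\<Prod>a<length I. vs ! p a $ (I ! a))
      else 0)"

text \<open>The coefficient \<open>w\<^sub>I\<close> in \<open>w = \<Sum>\<^sub>I w\<^sub>I dx\<^sub>I\<close> is the value of \<open>w\<close> on the basis vectors indexed by \<open>I\<close>.\<close>
definition form_coeff :: "'n::finite form \<Rightarrow> 'n list \<Rightarrow> real" where
  "form_coeff w I = w (map (\<lambda>i. axis i 1) I)"

definition drop_nth :: "nat \<Rightarrow> 'a list \<Rightarrow> 'a list" where
  "drop_nth m xs = take m xs @ drop (Suc m) xs"

text \<open>Positions are counted from 0, so the sign is \<open>(-1)\<^sup>m\<close>.\<close>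
definition contraction :: "nat \<Rightarrow> real ^ 'n::{finite,linorder} \<Rightarrow> 'n form \<Rightarrow> 'n form" where
  "contraction l z w =
     (\<lambda>vs. \<Sum>I\<in>inc_tuples l. form_coeff w I *
             (\<Sum>m<l. (-1) ^ m * z $ (I ! m) * dx (drop_nth m I) vs))"

definition L2_form ::
    "nat \<Rightarrow> (real ^ 'n::{finite,linorder}) set \<Rightarrow> ((real, 'n) vec \<Rightarrow> 'n form) \<Rightarrow> bool" where
  "L2_form l U u \<longleftrightarrow>
     (\<forall>x\<in>U. alt_form l (u x)) \<and> (\<forall>I\<in>inc_tuples l. L2 U (\<lambda>x. form_coeff (u x) I))"

definition L2_form_norm ::
    "nat \<Rightarrow> (real ^ 'n::{finite,linorder}) set \<Rightarrow> ((real, 'n) vec \<Rightarrow> 'n form) \<Rightarrow> real" where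
  "L2_form_norm l U u = sqrt (\<Sum>I\<in>inc_tuples l. (L2_norm U (\<lambda>x. form_coeff (u x) I))\<^sup>2)"

definition H1_form ::
    "nat \<Rightarrow> (real ^ 'n::{finite,linorder}) set \<Rightarrow> ((real, 'n) vec \<Rightarrow> 'n form) \<Rightarrow> bool" where
  "H1_form l U u \<longleftrightarrow>
     (\<forall>x\<in>U. alt_form l (u x)) \<and> (\<forall>I\<in>inc_tuples l. H1 U (\<lambda>x. form_coeff (u x) I))"

definition H1_form_seminorm ::
    "nat \<Rightarrow> (real ^ 'n::{finite,linorder}) set \<Rightarrow> ((real, 'n) vec \<Rightarrow> 'n form) \<Rightarrow> real" where
  "H1_form_seminorm l U u =
     sqrt (\<Sum>I\<in>inc_tuples l. (H1_seminorm U (\<lambda>x. form_coeff (u x) I))\<^sup>2)"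

section \<open>Star shaped domains, the cut-off function and the operator\<close>

definition star_shaped_wrt :: "'a::real_vector set \<Rightarrow> 'a set \<Rightarrow> bool" where
  "star_shaped_wrt U B \<longleftrightarrow> B \<subseteq> U \<and> (\<forall>y\<in>U. convex hull (B \<union> {y}) \<subseteq> U)"

text \<open>The \<open>L\<^sup>\<infinity>\<close> bound is stated, as the essential bound it is, by \<open>AE\<close>.\<close>
definition admissible_theta ::
    "(('n::{finite,linorder} \<Rightarrow> nat) \<Rightarrow> real) \<Rightarrow> (real, 'n) vec set \<Rightarrow> ((real, 'n) vec \<Rightarrow> real) \<Rightarrow> bool" where
  "admissible_theta c B \<theta> \<longleftrightarrow>
     test_function B \<theta> \<and> (LINT x|lebesgue. \<theta> x) = 1 \<and>
     (\<forall>\<alpha>. (LINT x|lebesgue. \<bar>multi_partial \<alpha> \<theta> x\<bar>)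
             \<le> c \<alpha> * diameter B powi (- int (multi_order \<alpha>)) \<and>
          (AE x in lebesgue. \<bar>multi_partial \<alpha> \<theta> x\<bar>
             \<le> c \<alpha> * diameter B powi (- int CARD('n) - int (multi_order \<alpha>))))"

definition bogovskii_kernel ::
    "nat \<Rightarrow> (real ^ 'n::finite \<Rightarrow> real) \<Rightarrow> (real, 'n) vec \<Rightarrow> (real, 'n) vec \<Rightarrow> real" where
  "bogovskii_kernel l \<theta> x y =
     (LINT t|lebesgue_on {1..}. (t - 1) ^ (CARD('n) - l) * t ^ (l - 1) * \<theta> (y + t *\<^sub>R (x - y)))"

text \<open>
  The integral of the form-valued integrand is taken coefficientwise; \<open>u\<close> is extended by the zero
  form outside \<open>U\<close>.
\<close>
definition bogovskii ::
    "nat \<Rightarrow> ((real, 'n) vec \<Rightarrow> real) \<Rightarrow> (real ^ 'n::{finite,linorder}) set \<Rightarrow>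
     ((real, 'n) vec \<Rightarrow> 'n form) \<Rightarrow> (real, 'n) vec \<Rightarrow> 'n form" where
  "bogovskii l \<theta> U u x =
     (\<lambda>vs. \<Sum>J\<in>inc_tuples (l - 1).
        (LINT y|lebesgue. bogovskii_kernel l \<theta> x y *
           form_coeff (contraction l (x - y) (if y \<in> U then u y else (\<lambda>_. 0))) J) * dx J vs)"

definition kappa :: "nat \<Rightarrow> (real ^ 'n::finite) set \<Rightarrow> (real, 'n) vec set \<Rightarrow> real" where
  "kappa l U B =
     (let n = real CARD('n); k = 2 * (real l - 1); q = measure lebesgue U / measure lebesgue B
      in if real l < n / 2 + 1 then 1
         else 1 + ln q powr (n / k) * q powr ((k - n) / k))"

end

(*
  With the moments phi(z) = (z - a)_i theta(z) and g(y) = (y - a)_i u(y), the identity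
  t (x - y) = (y + t (x - y) - a) - (y - a) writes each coefficient of B_l u as a combination of averages
  F(x) = int int w(t) phi(y + t (x - y)) g(y) dy dt over t >= 1; differentiating in x multiplies w by t
  and replaces phi by a partial derivative psi.  The range of t is split at 2.

  For t >= 2 the weight decays only like 1/t against the L^2 norms of the slices, and one needs
  cancellation: the Fourier transform of a slice is t^(-n) psi^(xi/t) g^((1 - 1/t) xi), and
  |psi^(zeta)| <= A |zeta| / (1 + rho^2 |zeta|^2), so that Cauchy-Schwarz in t and the dilation
  xi -> (1 - 1/t) xi bound this part by (A / rho) |g|.  The same estimate gives convergence in L^2 of the
  truncations t <= T, hence the weak derivative.

  For 1 <= t < 2 a Schur test suffices: the slice integral over y is at most
  (A / rho) min((t - 1)^(-n), |Omega| / |B|), and integrating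
  (t - 1)^(n - l) min((t - 1)^(-n/2), (|Omega| / |B|)^(1/2)) produces kappa.
*)
theory Submission
  imports Defs "HOL-Probability.Probability"
begin

section \<open>Gaussians and the Fourier transform\<close>


text \<open>The factor R/rho has its origin in the moments. With a the centre of B, (z - a)_i is at
  most rho on the support of theta and makes up for one derivative of size 1/rho, whereas (y - a)_i
  is only bounded by R on \<Omega>.

  The cancellation is that psi, being a derivative, has integral zero, so psi^ vanishes at 0. With
  zeta = xi/t the resulting kernel, integrated against dt/t, gives the same value pi A / (2 rho) at
  every nonzero frequency. The range is cut at 2 because the dilation by 1 - 1/t degenerates as t
  tends to 1; for t >= 2 undoing it costs at most 2^n.

  Plancherel enters as two inequalities, each proved for the functions on its side: the upper one
  for g, the lower one for the truncated averages, which are continuous and bounded.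

  The H^1 seminorm refers to some chosen weak derivative, so uniqueness almost everywhere belongs to
  the proof. The mollifiers for it are admissible theta on small balls around 0, whose L^1 norms are
  bounded by one constant.\<close>

lemma nn_integral_lborel_affine:
  fixes f :: "'a::euclidean_space \<Rightarrow> ennreal"
  assumes "f \<in> borel_measurable borel" "t \<noteq> 0"
  shows "(\<integral>\<^sup>+x. f x \<partial>lborel) = ennreal (\<bar>t\<bar> ^ DIM('a)) * (\<integral>\<^sup>+x. f (b + t *\<^sub>R x) \<partial>lborel)"
  using assms
  by (subst lborel_affine[of t b])
     (simp_all add: nn_integral_density nn_integral_distr nn_integral_cmult)

lemma integrable_lborel_affine:
  fixes f :: "'a::euclidean_space \<Rightarrow> 'b::{banach, second_countable_topology}"
  assumes "integrable lborel f" "t \<noteq> 0"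
  shows "integrable lborel (\<lambda>x. f (b + t *\<^sub>R x))"
proof -
  have m [measurable]: "f \<in> borel_measurable borel" using assms(1) by auto
  have "(\<integral>\<^sup>+x. ennreal (norm (f x)) \<partial>lborel) < \<infinity>"
    using assms(1) by (simp add: integrable_iff_bounded)
  moreover have "(\<integral>\<^sup>+x. ennreal (norm (f x)) \<partial>lborel) =
      ennreal (\<bar>t\<bar> ^ DIM('a)) * (\<integral>\<^sup>+x. ennreal (norm (f (b + t *\<^sub>R x))) \<partial>lborel)"
    using assms(2) by (intro nn_integral_lborel_affine) simp_all
  moreover have "\<bar>t\<bar> ^ DIM('a) > 0" using assms(2) by simp
  ultimately show ?thesis
    by (auto simp: integrable_iff_bounded ennreal_mult_less_top)
qed

lemma integral_lborel_affine:
  fixes f :: "'a::euclidean_space \<Rightarrow> 'b::{banach, second_countable_topology}"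
  assumes "f \<in> borel_measurable borel" "t \<noteq> 0"
  shows "(LINT x|lborel. f x) = (\<bar>t\<bar> ^ DIM('a)) *\<^sub>R (LINT x|lborel. f (b + t *\<^sub>R x))"
  using assms
  by (subst lborel_affine[of t b])
     (simp_all add: integral_density integral_distr)

text \<open>Unnormalised; this is the origin of the factors (2 pi)^n in the Plancherel
  inequalities.\<close>

definition fourier :: "('a::euclidean_space \<Rightarrow> real) \<Rightarrow> 'a \<Rightarrow> complex" where
  "fourier f \<xi> = (LINT x|lborel. f x *\<^sub>R cis (- (\<xi> \<bullet> x)))"

lemma continuous_on_cis [continuous_intros]:
  "continuous_on S f \<Longrightarrow> continuous_on S (\<lambda>x. cis (f x))"
  unfolding cis_conv_exp by (intro continuous_intros)

lemma borel_measurable_cis [measurable]: "cis \<in> borel_measurable borel"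
  by (intro borel_measurable_continuous_onI continuous_intros)

lemma integrable_scaleR_cis:
  assumes "integrable M f" "g \<in> borel_measurable M"
  shows "integrable M (\<lambda>x. (f x :: real) *\<^sub>R cis (g x))"
  by (rule Bochner_Integration.integrable_bound[OF assms(1)]) (use assms in auto)

text \<open>Up to the normalising constant this is the characteristic function of the standard
  normal law.\<close>

lemma integral_gaussian_cis_real:
  "(LINT s|lborel. exp (- s\<^sup>2 / 2) *\<^sub>R cis (a * s)) = complex_of_real (sqrt (2 * pi) * exp (- a\<^sup>2 / 2))"
  and integrable_gaussian_cis_real:
  "integrable lborel (\<lambda>s. exp (- s\<^sup>2 / 2) *\<^sub>R cis (a * s))"
proof -
  have i: "integrable lborel (\<lambda>s. std_normal_density s *\<^sub>R cis (a * s))"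
    by (intro integrable_scaleR_cis) auto
  have eq: "exp (- s\<^sup>2 / 2) *\<^sub>R cis (a * s) = sqrt (2 * pi) *\<^sub>R (std_normal_density s *\<^sub>R cis (a * s))" for s
    by (simp add: std_normal_density_def)
  show "integrable lborel (\<lambda>s. exp (- s\<^sup>2 / 2) *\<^sub>R cis (a * s))"
    unfolding eq by (rule integrable_scaleR_right[OF i])
  have "(LINT s|lborel. std_normal_density s *\<^sub>R cis (a * s)) = char std_normal_distribution a"
    unfolding char_def
    by (subst integral_density) (auto simp: cis_conv_exp)
  then show "(LINT s|lborel. exp (- s\<^sup>2 / 2) *\<^sub>R cis (a * s)) = complex_of_real (sqrt (2 * pi) * exp (- a\<^sup>2 / 2))"
    unfolding eq by (simp add: char_std_normal_distribution scaleR_conv_of_real)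
qed

lemma prod_cis: "finite A \<Longrightarrow> (\<Prod>i\<in>A. cis (f i)) = cis (\<Sum>i\<in>A. f i)"
  by (induction rule: finite_induct) (auto simp: cis_mult)

lemma gaussian_prod_Basis:
  fixes x :: "'a::euclidean_space"
  shows "exp (- (norm x)\<^sup>2 / 2) *\<^sub>R cis (b \<bullet> x) =
    (\<Prod>i\<in>Basis. exp (- (x \<bullet> i)\<^sup>2 / 2) *\<^sub>R cis ((b \<bullet> i) * (x \<bullet> i)))"
proof -
  have "(norm x)\<^sup>2 = (\<Sum>i\<in>Basis. (x \<bullet> i)\<^sup>2)"
    by (subst power2_norm_eq_inner, subst euclidean_inner) (simp add: power2_eq_square)
  then have "exp (- (norm x)\<^sup>2 / 2) = (\<Prod>i\<in>Basis. exp (- (x \<bullet> i)\<^sup>2 / 2))"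
    by (simp add: exp_sum[symmetric] sum_negf sum_divide_distrib)
  moreover have "cis (b \<bullet> x) = (\<Prod>i\<in>Basis. cis ((b \<bullet> i) * (x \<bullet> i)))"
    by (subst euclidean_inner) (simp add: prod_cis)
  ultimately show ?thesis
    by (simp add: scaleR_conv_of_real prod.distrib)
qed

text \<open>By \<open>gaussian_prod_Basis\<close> the integrand is a product over the coordinates,
  so on the finite product measure both claims reduce to the real line.\<close>

lemma
  fixes b :: "'a::euclidean_space"
  shows integral_gaussian_cis: "(LINT x|lborel. exp (- (norm x)\<^sup>2 / 2) *\<^sub>R cis (b \<bullet> x)) =
      complex_of_real (sqrt (2 * pi) ^ DIM('a) * exp (- (norm b)\<^sup>2 / 2))"
    and integrable_gaussian: "integrable lborel (\<lambda>x::'a. exp (- (norm x)\<^sup>2 / 2))"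
proof -
  interpret product_sigma_finite "\<lambda>_::'a. lborel::real measure" ..
  have [measurable]: "(\<lambda>f. \<Sum>b\<in>Basis. f b *\<^sub>R b) \<in> Pi\<^sub>M Basis (\<lambda>b::'a. lborel) \<rightarrow>\<^sub>M (borel :: 'a measure)"
    by measurable
  have inn: "(\<Sum>b\<in>Basis. f b *\<^sub>R b) \<bullet> i = f i" if "i \<in> Basis" for f and i :: 'a
    using that by (simp add: inner_sum_left inner_Basis if_distrib sum.If_cases cong: if_cong)
  have P: "integrable (Pi\<^sub>M Basis (\<lambda>_::'a. lborel))
      (\<lambda>f. \<Prod>i\<in>Basis. exp (- (f i)\<^sup>2 / 2) *\<^sub>R cis ((b \<bullet> i) * f i))" for b :: 'a
    by (rule product_integrable_prod) (simp_all only: finite_Basis integrable_gaussian_cis_real)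
  have c: "(\<Prod>i\<in>Basis. exp (- ((\<Sum>j\<in>Basis. f j *\<^sub>R j) \<bullet> i)\<^sup>2 / 2) *\<^sub>R cis ((b \<bullet> i) * ((\<Sum>j\<in>Basis. f j *\<^sub>R j) \<bullet> i))) =
      (\<Prod>i\<in>Basis. exp (- (f i)\<^sup>2 / 2) *\<^sub>R cis ((b \<bullet> i) * f i))" for f and b :: 'a
    by (rule prod.cong) (simp_all only: inn)
  have I: "integrable lborel (\<lambda>x::'a. exp (- (norm x)\<^sup>2 / 2) *\<^sub>R cis (b \<bullet> x))" for b :: 'a
    unfolding gaussian_prod_Basis lborel_eq[where 'a='a]
    by (subst integrable_distr_eq) (simp_all only: c P, measurable)
  have "integrable lborel (\<lambda>x::'a. norm (exp (- (norm x)\<^sup>2 / 2) *\<^sub>R cis (0 \<bullet> x)))"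
    by (rule integrable_norm[OF I])
  then show "integrable lborel (\<lambda>x::'a. exp (- (norm x)\<^sup>2 / 2))" by simp
  have "(LINT x|lborel. exp (- (norm x)\<^sup>2 / 2) *\<^sub>R cis (b \<bullet> x)) =
      (\<integral>f. (\<Prod>i\<in>Basis. exp (- (f i)\<^sup>2 / 2) *\<^sub>R cis ((b \<bullet> i) * f i)) \<partial>Pi\<^sub>M Basis (\<lambda>_::'a. lborel))"
    unfolding gaussian_prod_Basis lborel_eq[where 'a='a]
    by (subst integral_distr) (simp_all only: c, measurable)
  also have "\<dots> = (\<Prod>i\<in>Basis. LINT s|lborel. exp (- s\<^sup>2 / 2) *\<^sub>R cis ((b \<bullet> i) * s))"
    by (rule product_integral_prod) (simp_all only: finite_Basis integrable_gaussian_cis_real)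
  also have "\<dots> = (\<Prod>i\<in>Basis. complex_of_real (sqrt (2 * pi) * exp (- (b \<bullet> i)\<^sup>2 / 2)))"
    by (simp only: integral_gaussian_cis_real)
  also have "\<dots> = complex_of_real (sqrt (2 * pi) ^ DIM('a) * (\<Prod>i\<in>Basis. exp (- (b \<bullet> i)\<^sup>2 / 2)))"
    by (simp add: prod.distrib)
  also have "(\<Prod>i\<in>Basis. exp (- (b \<bullet> i)\<^sup>2 / 2)) = exp (- (norm b)\<^sup>2 / 2)"
    using gaussian_prod_Basis[of b 0]
    by (simp add: scaleR_conv_of_real flip: of_real_prod)
  finally show "(LINT x|lborel. exp (- (norm x)\<^sup>2 / 2) *\<^sub>R cis (b \<bullet> x)) =
      complex_of_real (sqrt (2 * pi) ^ DIM('a) * exp (- (norm b)\<^sup>2 / 2))" .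
qed

text \<open>The Fourier transform of exp (- e^2 |xi|^2 / 2). It is (2 pi)^n times the centred normal
  density of variance e^2 in each coordinate, hence an approximate identity up to that
  factor.\<close>

definition gauss_kernel :: "real \<Rightarrow> 'a::euclidean_space \<Rightarrow> real" where
  "gauss_kernel e z = (sqrt (2 * pi) / e) ^ DIM('a) * exp (- (norm z)\<^sup>2 / (2 * e\<^sup>2))"

lemma gauss_kernel_nonneg: "e > 0 \<Longrightarrow> gauss_kernel e z \<ge> 0"
  by (simp add: gauss_kernel_def)

lemma borel_measurable_gauss_kernel [measurable]: "gauss_kernel e \<in> borel_measurable borel"
  unfolding gauss_kernel_def by measurable

lemma gauss_kernel_scale: "e > 0 \<Longrightarrow> gauss_kernel e (e *\<^sub>R z :: 'a::euclidean_space) = gauss_kernel 1 z / e ^ DIM('a)"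
  by (simp add: gauss_kernel_def power_mult_distrib power_divide)

lemma integrable_gauss_kernel1: "integrable lborel (gauss_kernel 1 :: 'a::euclidean_space \<Rightarrow> real)"
  unfolding gauss_kernel_def using integrable_gaussian[where 'a='a] by simp

lemma integral_gauss_kernel1:
  "(LINT x|lborel. gauss_kernel 1 (x::'a::euclidean_space)) = (2 * pi) ^ DIM('a)"
proof -
  have "complex_of_real (LINT x|lborel. exp (- (norm (x::'a))\<^sup>2 / 2)) = complex_of_real (sqrt (2 * pi) ^ DIM('a))"
    using integral_gaussian_cis[of "0::'a"]
    by (simp add: scaleR_conv_of_real)
  then have "(LINT x|lborel. exp (- (norm (x::'a))\<^sup>2 / 2)) = sqrt (2 * pi) ^ DIM('a)"
    using of_real_eq_iff by blast
  moreover have "sqrt (2 * pi) ^ DIM('a) * sqrt (2 * pi) ^ DIM('a) = (2 * pi) ^ DIM('a)"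
    by (subst power_mult_distrib[symmetric]) simp
  ultimately show ?thesis
    by (simp add: gauss_kernel_def)
qed

lemma integrable_gaussian_scaled:
  "e > 0 \<Longrightarrow> integrable lborel (\<lambda>x::'a::euclidean_space. exp (- e\<^sup>2 * (norm x)\<^sup>2 / 2))"
  using integrable_lborel_affine[OF integrable_gaussian[where 'a='a], of e 0]
  by (simp add: power_mult_distrib)

lemma integral_gaussian_cis_scaled:
  fixes b :: "'a::euclidean_space"
  assumes "e > 0"
  shows "(LINT x|lborel. exp (- e\<^sup>2 * (norm x)\<^sup>2 / 2) *\<^sub>R cis (b \<bullet> x)) = gauss_kernel e b"
proof -
  have "(LINT x|lborel. exp (- e\<^sup>2 * (norm x)\<^sup>2 / 2) *\<^sub>R cis (b \<bullet> x)) =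
      (1 / e) ^ DIM('a) *\<^sub>R (LINT x|lborel. exp (- (norm x)\<^sup>2 / 2) *\<^sub>R cis ((b /\<^sub>R e) \<bullet> x))"
  proof -
    have "- (norm ((1 / e) *\<^sub>R x))\<^sup>2 * e\<^sup>2 = - (norm x)\<^sup>2" for x :: 'a
      using assms by (simp add: power_divide)
    then have *: "- e\<^sup>2 * (norm (0 + (1 / e) *\<^sub>R x))\<^sup>2 / 2 = - (norm x)\<^sup>2 / 2" for x :: 'a
      by (metis add_0 mult.commute mult_minus_left)
    have **: "b \<bullet> (0 + (1 / e) *\<^sub>R x) = (b /\<^sub>R e) \<bullet> x" for x :: 'a
      by (simp add: divide_inverse)
    have ***: "\<bar>1 / e\<bar> = 1 / e" using assms by simp
    show ?thesis
      using integral_lborel_affine[of "\<lambda>x::'a. exp (- e\<^sup>2 * (norm x)\<^sup>2 / 2) *\<^sub>R cis (b \<bullet> x)" "1 / e" 0] assms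
      unfolding * ** *** by simp
  qed
  also have "\<dots> = gauss_kernel e b"
  proof -
    have "- (norm (b /\<^sub>R e))\<^sup>2 / 2 = - (norm b)\<^sup>2 / (2 * e\<^sup>2)"
    proof -
      have "norm (b /\<^sub>R e) = norm b / e" using assms by (simp add: divide_inverse)
      then show ?thesis using assms by (simp only: power_divide) (simp add: field_simps)
    qed
    then show ?thesis
      unfolding integral_gaussian_cis gauss_kernel_def
      by (simp only: scaleR_conv_of_real) (simp add: power_divide)
  qed
  finally show ?thesis .
qed

lemma nn_integral_gauss_kernel:
  assumes "e > 0"
  shows "(\<integral>\<^sup>+x. ennreal (gauss_kernel e (x::'a::euclidean_space)) \<partial>lborel) = ennreal ((2 * pi) ^ DIM('a))"
proof -
  have "(\<integral>\<^sup>+x. ennreal (gauss_kernel e (x::'a)) \<partial>lborel) =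
      ennreal (e ^ DIM('a)) * (\<integral>\<^sup>+x. ennreal (gauss_kernel 1 (x::'a) / e ^ DIM('a)) \<partial>lborel)"
    using assms by (subst nn_integral_lborel_affine[where t=e and b=0]) (simp_all add: gauss_kernel_scale)
  also have "\<dots> = (\<integral>\<^sup>+x. ennreal (gauss_kernel 1 (x::'a)) \<partial>lborel)"
    using assms by (subst nn_integral_cmult[symmetric]) (simp_all flip: ennreal_mult')
  also have "\<dots> = ennreal ((2 * pi) ^ DIM('a))"
    using integral_gauss_kernel1[where 'a='a] integrable_gauss_kernel1[where 'a='a]
    by (subst nn_integral_eq_integral) (simp_all add: gauss_kernel_nonneg)
  finally show ?thesis .
qed



section \<open>Fubini and Tonelli for Lebesgue measure on a product space\<close>

lemma borel_measurable_fst_borel [measurable]: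
  "(fst :: 'a::second_countable_topology \<times> 'b::second_countable_topology \<Rightarrow> 'a) \<in> borel_measurable borel"
  by (intro borel_measurable_continuous_onI continuous_intros)

lemma borel_measurable_snd_borel [measurable]:
  "(snd :: 'a::second_countable_topology \<times> 'b::second_countable_topology \<Rightarrow> 'b) \<in> borel_measurable borel"
  by (intro borel_measurable_continuous_onI continuous_intros)

lemma
  fixes f :: "'a::euclidean_space \<times> 'b::euclidean_space \<Rightarrow> ennreal"
  assumes "f \<in> borel_measurable borel"
  shows nn_integral_lborel_fst: "(\<integral>\<^sup>+p. f p \<partial>lborel) = (\<integral>\<^sup>+x. (\<integral>\<^sup>+y. f (x, y) \<partial>lborel) \<partial>lborel)"
    and nn_integral_lborel_snd: "(\<integral>\<^sup>+p. f p \<partial>lborel) = (\<integral>\<^sup>+y. (\<integral>\<^sup>+x. f (x, y) \<partial>lborel) \<partial>lborel)"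
proof -
  have m: "f \<in> borel_measurable (lborel \<Otimes>\<^sub>M lborel)"
    using assms by (simp add: lborel_prod)
  show "(\<integral>\<^sup>+p. f p \<partial>lborel) = (\<integral>\<^sup>+x. (\<integral>\<^sup>+y. f (x, y) \<partial>lborel) \<partial>lborel)"
    using lborel.nn_integral_fst[OF m] by (simp add: lborel_prod)
  show "(\<integral>\<^sup>+p. f p \<partial>lborel) = (\<integral>\<^sup>+y. (\<integral>\<^sup>+x. f (x, y) \<partial>lborel) \<partial>lborel)"
    using lborel_pair.nn_integral_snd[OF m] by (simp add: lborel_prod)
qed

lemma
  fixes f :: "'a::euclidean_space \<times> 'b::euclidean_space \<Rightarrow> ennreal"
  assumes [measurable]: "f \<in> borel_measurable borel"
  shows borel_measurable_nn_integral_lborel_fst: "(\<lambda>x. \<integral>\<^sup>+y. f (x, y) \<partial>lborel) \<in> borel_measurable borel"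
    and borel_measurable_nn_integral_lborel_snd: "(\<lambda>y. \<integral>\<^sup>+x. f (x, y) \<partial>lborel) \<in> borel_measurable borel"
  by measurable

lemma
  fixes f :: "'a::euclidean_space \<times> 'b::euclidean_space \<Rightarrow> 'c::{banach, second_countable_topology}"
  assumes "integrable lborel f"
  shows AE_integrable_lborel_fst: "AE x in lborel. integrable lborel (\<lambda>y. f (x, y))"
    and AE_integrable_lborel_snd: "AE y in lborel. integrable lborel (\<lambda>x. f (x, y))"
    and integrable_lborel_fst: "integrable lborel (\<lambda>x. LINT y|lborel. f (x, y))"
    and integrable_lborel_snd: "integrable lborel (\<lambda>y. LINT x|lborel. f (x, y))"
    and integral_lborel_fst: "(LINT p|lborel. f p) = (LINT x|lborel. LINT y|lborel. f (x, y))"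
    and integral_lborel_snd: "(LINT p|lborel. f p) = (LINT y|lborel. LINT x|lborel. f (x, y))"
proof -
  have i: "integrable (lborel \<Otimes>\<^sub>M lborel) (\<lambda>(x, y). f (x, y))"
    using assms by (simp add: lborel_prod)
  show "AE x in lborel. integrable lborel (\<lambda>y. f (x, y))" by (rule lborel_pair.AE_integrable_fst[OF i])
  show "AE y in lborel. integrable lborel (\<lambda>x. f (x, y))" by (rule lborel_pair.AE_integrable_snd[OF i])
  show "integrable lborel (\<lambda>x. LINT y|lborel. f (x, y))" by (rule lborel_pair.integrable_fst[OF i])
  show "integrable lborel (\<lambda>y. LINT x|lborel. f (x, y))" by (rule lborel_pair.integrable_snd[OF i])
  show "(LINT p|lborel. f p) = (LINT x|lborel. LINT y|lborel. f (x, y))"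
    using lborel_pair.integral_fst[OF i] by (simp add: lborel_prod)
  show "(LINT p|lborel. f p) = (LINT y|lborel. LINT x|lborel. f (x, y))"
    using lborel_pair.integral_snd[OF i] by (simp add: lborel_prod)
qed

lemma integrable_lborel_mult_prod:
  fixes f :: "'a::euclidean_space \<Rightarrow> real" and g :: "'b::euclidean_space \<Rightarrow> real"
  assumes "integrable lborel f" "integrable lborel g"
  shows "integrable lborel (\<lambda>p. f (fst p) * g (snd p))"
proof -
  have [measurable]: "f \<in> borel_measurable borel" "g \<in> borel_measurable borel"
    using assms by auto
  have "(\<integral>\<^sup>+p. ennreal (norm (f (fst p) * g (snd p))) \<partial>lborel) =
      (\<integral>\<^sup>+x. (\<integral>\<^sup>+y. ennreal (norm (f x)) * ennreal (norm (g y)) \<partial>lborel) \<partial>lborel)"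
    by (subst nn_integral_lborel_fst) (simp_all add: abs_mult ennreal_mult')
  also have "\<dots> = (\<integral>\<^sup>+x. ennreal (norm (f x)) \<partial>lborel) * (\<integral>\<^sup>+y. ennreal (norm (g y)) \<partial>lborel)"
    by (simp add: nn_integral_cmult nn_integral_multc)
  also have "\<dots> < \<infinity>"
    using assms by (simp add: integrable_iff_bounded ennreal_mult_less_top)
  finally show ?thesis
    by (intro integrableI_bounded) auto
qed

section \<open>Plancherel's identity as two inequalities\<close>

lemma borel_measurable_fourier [measurable]: 
  assumes [measurable]: "f \<in> borel_measurable borel"
  shows "fourier f \<in> borel_measurable borel"
  unfolding fourier_def by measurable

lemma norm_fourier_le: 
  fixes f :: "'a::euclidean_space \<Rightarrow> real"
  shows "cmod (fourier f \<xi>) \<le> (LINT x|lborel. \<bar>f x\<bar>)"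
  unfolding fourier_def using integral_norm_bound[of lborel "\<lambda>x. f x *\<^sub>R cis (- (\<xi> \<bullet> x))"] by simp

abbreviation sq_norm :: "('a::euclidean_space \<Rightarrow> real) \<Rightarrow> real" where
  "sq_norm f \<equiv> (LINT x|lborel. (f x)\<^sup>2)"

abbreviation sq_integrable :: "('a::euclidean_space \<Rightarrow> real) \<Rightarrow> bool" where
  "sq_integrable f \<equiv> integrable lborel (\<lambda>x. (f x)\<^sup>2)"

text \<open>Damping by a Gaussian makes the frequency integral of \<open>|fourier f|\<^sup>2\<close> absolutely convergent, so
  that Fubini applies; the Gaussian is removed in the limit.\<close>
lemma
  fixes f :: "'a::euclidean_space \<Rightarrow> real"
  assumes f: "integrable lborel f" and e: "e > 0"
  shows integrable_damped_fourier:
      "integrable lborel (\<lambda>\<xi>. exp (- e\<^sup>2 * (norm \<xi>)\<^sup>2 / 2) * (cmod (fourier f \<xi>))\<^sup>2)"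
    and integrable_gauss_kernel_quadratic:
      "integrable lborel (\<lambda>p. f (fst p) * f (snd p) * gauss_kernel e (fst p - snd p))"
    and integral_damped_fourier:
      "(LINT \<xi>|lborel. exp (- e\<^sup>2 * (norm \<xi>)\<^sup>2 / 2) * (cmod (fourier f \<xi>))\<^sup>2) =
       (LINT p|lborel. f (fst p) * f (snd p) * gauss_kernel e (fst p - snd p))"
proof -
  have [measurable]: "f \<in> borel_measurable borel" using f by auto
  let ?G = "\<lambda>\<xi>::'a. exp (- e\<^sup>2 * (norm \<xi>)\<^sup>2 / 2)"
  have ff: "integrable lborel (\<lambda>p. f (fst p) * f (snd p))"
    by (intro integrable_lborel_mult_prod f)
  \<comment> \<open>One absolutely integrable function of (xi, x, y), integrated in two orders: over
    (x, y) first it yields the damped spectrum (\<open>F\<close>), over xi first the Gaussian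
    quadratic form (\<open>S\<close>).\<close>
  let ?h = "\<lambda>q::'a \<times> 'a \<times> 'a. (?G (fst q) * (f (fst (snd q)) * f (snd (snd q)))) *\<^sub>R cis (fst q \<bullet> (snd (snd q) - fst (snd q)))"
  have h: "integrable lborel ?h"
    by (intro integrable_scaleR_cis integrable_lborel_mult_prod[OF integrable_gaussian_scaled[OF e] ff]) simp
  have ifc: "integrable lborel (\<lambda>x. f x *\<^sub>R cis (- (\<xi> \<bullet> x)))" for \<xi>
    by (intro integrable_scaleR_cis f) simp
  have sq: "complex_of_real ((cmod (fourier f \<xi>))\<^sup>2) = (LINT p|lborel. (f (fst p) * f (snd p)) *\<^sub>R cis (\<xi> \<bullet> (snd p - fst p)))" for \<xi>
  proof -
    have i: "integrable lborel (\<lambda>p. (f (fst p) * f (snd p)) *\<^sub>R cis (\<xi> \<bullet> (snd p - fst p)))"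
      by (intro integrable_scaleR_cis ff) simp
    have "cnj (fourier f \<xi>) = (LINT x|lborel. f x *\<^sub>R cis (\<xi> \<bullet> x))"
      using Bochner_Integration.integral_cnj[of lborel "\<lambda>x. f x *\<^sub>R cis (- (\<xi> \<bullet> x))"] by (simp add: fourier_def cis_cnj)
    moreover have "complex_of_real ((cmod (fourier f \<xi>))\<^sup>2) = fourier f \<xi> * cnj (fourier f \<xi>)"
      by (simp only: complex_norm_square)
    ultimately have "complex_of_real ((cmod (fourier f \<xi>))\<^sup>2) =
        (LINT x|lborel. f x *\<^sub>R cis (- (\<xi> \<bullet> x)) * (LINT y|lborel. f y *\<^sub>R cis (\<xi> \<bullet> y)))"
      by (simp only: fourier_def integral_mult_left_zero)
    also have "\<dots> = (LINT x|lborel. LINT y|lborel. f x *\<^sub>R cis (- (\<xi> \<bullet> x)) * (f y *\<^sub>R cis (\<xi> \<bullet> y)))"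
      by (simp only: integral_mult_right_zero)
    also have "\<dots> = (LINT x|lborel. LINT y|lborel. (f x * f y) *\<^sub>R cis (\<xi> \<bullet> (y - x)))"
      by (simp add: cis_mult inner_diff_right mult.commute)
    also have "\<dots> = (LINT p|lborel. (f (fst p) * f (snd p)) *\<^sub>R cis (\<xi> \<bullet> (snd p - fst p)))"
      by (subst integral_lborel_fst[OF i]) simp
    finally show ?thesis .
  qed
  have F: "(LINT p|lborel. ?h (\<xi>, p)) = complex_of_real (?G \<xi> * (cmod (fourier f \<xi>))\<^sup>2)" for \<xi>
  proof -
    have "(LINT p|lborel. ?h (\<xi>, p)) = (LINT p|lborel. ?G \<xi> *\<^sub>R ((f (fst p) * f (snd p)) *\<^sub>R cis (\<xi> \<bullet> (snd p - fst p))))"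
      by simp
    also have "\<dots> = ?G \<xi> *\<^sub>R complex_of_real ((cmod (fourier f \<xi>))\<^sup>2)"
      by (simp only: integral_scaleR_right sq)
    finally show ?thesis by (simp add: scaleR_conv_of_real)
  qed
  have S: "(LINT \<xi>|lborel. ?h (\<xi>, p)) = complex_of_real (f (fst p) * f (snd p) * gauss_kernel e (fst p - snd p))" for p
  proof -
    have "(LINT \<xi>|lborel. ?h (\<xi>, p)) = (LINT \<xi>|lborel. (f (fst p) * f (snd p)) *\<^sub>R (?G \<xi> *\<^sub>R cis ((snd p - fst p) \<bullet> \<xi>)))"
      by (simp add: inner_commute mult.commute)
    also have "\<dots> = (f (fst p) * f (snd p)) *\<^sub>R complex_of_real (gauss_kernel e (snd p - fst p))"
      by (simp only: integral_scaleR_right integral_gaussian_cis_scaled[OF e])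
    also have "gauss_kernel e (snd p - fst p) = gauss_kernel e (fst p - snd p)"
      by (simp add: gauss_kernel_def norm_minus_commute)
    finally show ?thesis by (simp add: scaleR_conv_of_real)
  qed
  show "integrable lborel (\<lambda>\<xi>. ?G \<xi> * (cmod (fourier f \<xi>))\<^sup>2)"
    using integrable_lborel_fst[OF h] unfolding F complex_of_real_integrable_eq .
  show "integrable lborel (\<lambda>p. f (fst p) * f (snd p) * gauss_kernel e (fst p - snd p))"
    using integrable_lborel_snd[OF h] unfolding S complex_of_real_integrable_eq .
  show "(LINT \<xi>|lborel. ?G \<xi> * (cmod (fourier f \<xi>))\<^sup>2) =
       (LINT p|lborel. f (fst p) * f (snd p) * gauss_kernel e (fst p - snd p))"
    using integral_lborel_fst[OF h] integral_lborel_snd[OF h]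
    unfolding F S integral_complex_of_real by simp
qed

lemma nn_integral_gauss_kernel_diff:
  assumes "e > 0"
  shows "(\<integral>\<^sup>+y. ennreal (gauss_kernel e (x - y :: 'a::euclidean_space)) \<partial>lborel) = ennreal ((2 * pi) ^ DIM('a))"
  using nn_integral_lborel_affine[of "\<lambda>y. ennreal (gauss_kernel e (y::'a))" "-1" x] assms
  by (simp add: nn_integral_gauss_kernel)

text \<open>A symmetric Schur bound: f(x) f(y) <= (f(x)^2 + f(y)^2) / 2, and the kernel has mass (2
  pi)^n in either variable.\<close>

lemma gauss_kernel_quadratic_le:
  fixes f :: "'a::euclidean_space \<Rightarrow> real"
  assumes f: "integrable lborel f" "sq_integrable f" and e: "e > 0"
  shows "(LINT p|lborel. f (fst p) * f (snd p) * gauss_kernel e (fst p - snd p)) \<le> (2 * pi) ^ DIM('a) * (sq_norm f)"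
proof -
  have [measurable]: "f \<in> borel_measurable borel" using f by auto
  let ?k = "\<lambda>p::'a \<times> 'a. gauss_kernel e (fst p - snd p)"
  have k0: "gauss_kernel e z \<ge> 0" for z :: 'a using e by (rule gauss_kernel_nonneg)
  have A: "(\<integral>\<^sup>+p. ennreal ((f (fst p))\<^sup>2 * ?k p) \<partial>lborel) = ennreal ((2 * pi) ^ DIM('a) * (sq_norm f))"
    by (subst nn_integral_lborel_fst)
       (simp_all add: ennreal_mult k0 nn_integral_cmult nn_integral_gauss_kernel_diff[OF e] nn_integral_multc
         nn_integral_eq_integral[OF f(2)] mult.commute)
  have k_sym: "gauss_kernel e (x - y) = gauss_kernel e (y - x)" for x y :: 'a
    by (simp add: gauss_kernel_def norm_minus_commute)
  have B: "(\<integral>\<^sup>+p. ennreal ((f (snd p))\<^sup>2 * ?k p) \<partial>lborel) = ennreal ((2 * pi) ^ DIM('a) * (sq_norm f))"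
    by (subst nn_integral_lborel_snd)
       (simp_all add: ennreal_mult k0 nn_integral_cmult k_sym[of _ x for x] nn_integral_gauss_kernel_diff[OF e] nn_integral_multc
         nn_integral_eq_integral[OF f(2)] mult.commute)
  have iA: "integrable lborel (\<lambda>p. (f (fst p))\<^sup>2 * ?k p)"
    by (rule integrableI_nonneg) (simp_all add: A k0)
  have iB: "integrable lborel (\<lambda>p. (f (snd p))\<^sup>2 * ?k p)"
    by (rule integrableI_nonneg) (simp_all add: B k0)
  have vA: "(LINT p|lborel. (f (fst p))\<^sup>2 * ?k p) = (2 * pi) ^ DIM('a) * (sq_norm f)"
    by (simp add: integral_eq_nn_integral A k0)
  have vB: "(LINT p|lborel. (f (snd p))\<^sup>2 * ?k p) = (2 * pi) ^ DIM('a) * (sq_norm f)"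
    by (simp add: integral_eq_nn_integral B k0)
  have "(LINT p|lborel. f (fst p) * f (snd p) * ?k p) \<le>
      (LINT p|lborel. ((f (fst p))\<^sup>2 * ?k p + (f (snd p))\<^sup>2 * ?k p) / 2)"
  proof (rule integral_mono)
    show "integrable lborel (\<lambda>p. f (fst p) * f (snd p) * ?k p)"
      by (rule integrable_gauss_kernel_quadratic[OF f(1) e])
    show "integrable lborel (\<lambda>p. ((f (fst p))\<^sup>2 * ?k p + (f (snd p))\<^sup>2 * ?k p) / 2)"
      using iA iB by auto
    fix p
    have "f (fst p) * f (snd p) \<le> ((f (fst p))\<^sup>2 + (f (snd p))\<^sup>2) / 2"
      using sum_squares_bound[of "f (fst p)" "f (snd p)"] by simp
    then show "f (fst p) * f (snd p) * ?k p \<le> ((f (fst p))\<^sup>2 * ?k p + (f (snd p))\<^sup>2 * ?k p) / 2"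
      using mult_right_mono[OF _ k0[of "fst p - snd p"]] by (fastforce simp: algebra_simps)
  qed
  also have "\<dots> = (2 * pi) ^ DIM('a) * (sq_norm f)"
    using iA iB vA vB by simp
  finally show ?thesis .
qed

text \<open>The damped integrals are bounded uniformly in the damping, so Fatou's lemma removes it.
  No regularity of \<open>f\<close> enters.\<close>

lemma plancherel_upper:
  fixes f :: "'a::euclidean_space \<Rightarrow> real"
  assumes f: "integrable lborel f" "sq_integrable f"
  shows "(\<integral>\<^sup>+\<xi>. ennreal ((cmod (fourier f \<xi>))\<^sup>2) \<partial>lborel) \<le> ennreal ((2 * pi) ^ DIM('a) * (sq_norm f))"
proof -
  have [measurable]: "f \<in> borel_measurable borel" using f by auto
  define e where "e n = inverse (real (Suc n))" for n
  have e: "e n > 0" for n by (simp add: e_def)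
  have e0: "e \<longlonglongrightarrow> 0" unfolding e_def by (rule LIMSEQ_inverse_real_of_nat)
  let ?F = "\<lambda>n \<xi>. exp (- (e n)\<^sup>2 * (norm \<xi>)\<^sup>2 / 2) * (cmod (fourier f \<xi>))\<^sup>2"
  have lim: "(\<lambda>n. ?F n \<xi>) \<longlonglongrightarrow> exp (- 0\<^sup>2 * (norm \<xi>)\<^sup>2 / 2) * (cmod (fourier f \<xi>))\<^sup>2" for \<xi>
    by (intro tendsto_intros e0) simp
  have "(\<integral>\<^sup>+\<xi>. ennreal ((cmod (fourier f \<xi>))\<^sup>2) \<partial>lborel) = (\<integral>\<^sup>+\<xi>. liminf (\<lambda>n. ennreal (?F n \<xi>)) \<partial>lborel)"
    using lim by (intro nn_integral_cong) (auto intro!: lim_imp_Liminf[symmetric] tendsto_ennrealI)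
  also have "\<dots> \<le> liminf (\<lambda>n. \<integral>\<^sup>+\<xi>. ennreal (?F n \<xi>) \<partial>lborel)"
    by (rule nn_integral_liminf) simp
  also have "\<dots> \<le> liminf (\<lambda>n. ennreal ((2 * pi) ^ DIM('a) * (sq_norm f)))"
  proof (intro Liminf_mono always_eventually allI)
    fix n
    have "(\<integral>\<^sup>+\<xi>. ennreal (?F n \<xi>) \<partial>lborel) = ennreal (LINT \<xi>|lborel. ?F n \<xi>)"
      by (intro nn_integral_eq_integral integrable_damped_fourier f e) simp
    also have "\<dots> \<le> ennreal ((2 * pi) ^ DIM('a) * (sq_norm f))"
      unfolding integral_damped_fourier[OF f(1) e]
      by (intro ennreal_leI gauss_kernel_quadratic_le f e)
    finally show "(\<integral>\<^sup>+\<xi>. ennreal (?F n \<xi>) \<partial>lborel) \<le> ennreal ((2 * pi) ^ DIM('a) * (sq_norm f))" .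
  qed
  finally show ?thesis by (simp add: Liminf_const)
qed

lemma integrable_square_bounded:
  fixes f :: "'a \<Rightarrow> real"
  assumes "integrable M f" "\<And>x. \<bar>f x\<bar> \<le> K"
  shows "integrable M (\<lambda>x. (f x)\<^sup>2)"
proof (rule Bochner_Integration.integrable_bound)
  show "integrable M (\<lambda>x. K * f x)" using assms(1) by simp
  have "(f x)\<^sup>2 \<le> \<bar>K\<bar> * \<bar>f x\<bar>" for x
    using mult_right_mono[OF assms(2)[of x], of "\<bar>f x\<bar>"] assms(2)[of x]
    by (simp add: power2_eq_square flip: abs_mult)
  then show "AE x in M. norm ((f x)\<^sup>2) \<le> norm (K * f x)" by (simp add: abs_mult)
  show "(\<lambda>x. (f x)\<^sup>2) \<in> borel_measurable M" using assms(1) by measurable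
qed

text \<open>Here the quadratic form has to converge to its limit, not merely stay bounded.
  Continuity of \<open>f\<close> gives the pointwise convergence and boundedness the majorant;
  damping only decreases the frequency integral.\<close>

lemma plancherel_lower:
  fixes f :: "'a::euclidean_space \<Rightarrow> real"
  assumes f: "integrable lborel f" and cont: "continuous_on UNIV f" and K: "\<And>x. \<bar>f x\<bar> \<le> K"
  shows "ennreal ((2 * pi) ^ DIM('a) * (sq_norm f)) \<le> (\<integral>\<^sup>+\<xi>. ennreal ((cmod (fourier f \<xi>))\<^sup>2) \<partial>lborel)"
proof -
  have [measurable]: "f \<in> borel_measurable borel" using f by auto
  have f2: "sq_integrable f" by (rule integrable_square_bounded[OF f K])
  define e where "e n = inverse (real (Suc n))" for n
  have e: "e n > 0" for n by (simp add: e_def)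
  have e0: "e \<longlonglongrightarrow> 0" unfolding e_def by (rule LIMSEQ_inverse_real_of_nat)
  have g1: "integrable lborel (gauss_kernel 1 :: 'a \<Rightarrow> real)" by (rule integrable_gauss_kernel1)
  have K0: "K \<ge> 0" using K[of 0] by linarith
  have bd: "integrable lborel (\<lambda>p::'a \<times> 'a. K * \<bar>f (fst p) * gauss_kernel 1 (snd p)\<bar>)"
    by (intro integrable_mult_right integrable_abs integrable_lborel_mult_prod f g1)
  let ?I = "\<lambda>n. LINT p|lborel. f (fst p) * f (fst p - e n *\<^sub>R snd p) * gauss_kernel 1 (snd p)"
  have le: "norm (f (fst p) * f (fst p - e n *\<^sub>R snd p) * gauss_kernel 1 (snd p)) \<le> K * \<bar>f (fst p) * gauss_kernel 1 (snd p)\<bar>" for n and p :: "'a \<times> 'a"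
    using mult_right_mono[OF K[of "fst p - e n *\<^sub>R snd p"], of "\<bar>f (fst p) * gauss_kernel 1 (snd p)\<bar>"]
    by (simp add: abs_mult mult_ac)
  have int: "integrable lborel (\<lambda>p::'a \<times> 'a. f (fst p) * f (fst p - e n *\<^sub>R snd p) * gauss_kernel 1 (snd p))" for n
    by (rule Bochner_Integration.integrable_bound[OF bd])
       (measurable, rule AE_I2, rule order_trans[OF le], simp)
  \<comment> \<open>Substituting y = x - e u moves the scale from the kernel into the argument of
    \<open>f\<close>, which leaves the majorant \<open>bd\<close> independent of
    \<open>n\<close>.\<close>
  have eq: "(LINT p|lborel. f (fst p) * f (snd p) * gauss_kernel (e n) (fst p - snd p)) = ?I n" for n
  proof -
    have inner: "(LINT y|lborel. f x * f y * gauss_kernel (e n) (x - y)) = (LINT u|lborel. f x * f (x - e n *\<^sub>R u) * gauss_kernel 1 u)" for x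
    proof -
      have "(LINT y|lborel. f x * f y * gauss_kernel (e n) (x - y)) =
          e n ^ DIM('a) *\<^sub>R (LINT u|lborel. f x * f (x - e n *\<^sub>R u) * gauss_kernel (e n) (e n *\<^sub>R u))"
        using integral_lborel_affine[of "\<lambda>y. f x * f y * gauss_kernel (e n) (x - y)" "- e n" x] e[of n]
        by simp
      also have "\<dots> = (LINT u|lborel. e n ^ DIM('a) *\<^sub>R (f x * f (x - e n *\<^sub>R u) * gauss_kernel (e n) (e n *\<^sub>R u)))"
        by (rule integral_scaleR_right[symmetric])
      also have "\<dots> = (LINT u|lborel. f x * f (x - e n *\<^sub>R u) * gauss_kernel 1 u)"
      proof -
        have "e n ^ DIM('a) \<noteq> 0" using e[of n] by simp
        then show ?thesis by (simp add: gauss_kernel_scale[OF e])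
      qed
      finally show ?thesis .
    qed
    show ?thesis
      by (subst integral_lborel_fst[OF integrable_gauss_kernel_quadratic[OF f e]],
          subst integral_lborel_fst[OF int]) (simp add: inner)
  qed
  have lim: "?I \<longlonglongrightarrow> (LINT p|lborel. f (fst p) * f (fst p) * gauss_kernel 1 (snd p :: 'a))"
  proof (rule integral_dominated_convergence[OF _ _ bd])
    show "AE p in lborel. (\<lambda>n. f (fst p) * f (fst p - e n *\<^sub>R snd p) * gauss_kernel 1 (snd p)) \<longlonglongrightarrow> f (fst p) * f (fst p) * gauss_kernel 1 (snd p)"
    proof (rule AE_I2)
      fix p :: "'a \<times> 'a"
      have "(\<lambda>n. fst p - e n *\<^sub>R snd p) \<longlonglongrightarrow> fst p - 0 *\<^sub>R snd p"
        by (intro tendsto_intros e0)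
      moreover have "isCont f (fst p)" using cont by (simp add: continuous_on_eq_continuous_at)
      ultimately have "(\<lambda>n. f (fst p - e n *\<^sub>R snd p)) \<longlonglongrightarrow> f (fst p)"
        using isCont_tendsto_compose by fastforce
      then show "(\<lambda>n. f (fst p) * f (fst p - e n *\<^sub>R snd p) * gauss_kernel 1 (snd p)) \<longlonglongrightarrow> f (fst p) * f (fst p) * gauss_kernel 1 (snd p)"
        by (intro tendsto_intros)
    qed
  qed (use le in auto)
  have "(LINT p|lborel. f (fst p) * f (fst p) * gauss_kernel 1 (snd p :: 'a)) = (2 * pi) ^ DIM('a) * (sq_norm f)"
    using integral_lborel_fst[OF integrable_lborel_mult_prod[OF f2 g1]]
    by (simp add: integral_gauss_kernel1 power2_eq_square)
  with lim have lim': "?I \<longlonglongrightarrow> (2 * pi) ^ DIM('a) * (sq_norm f)" by simp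
  have "ennreal (?I n) \<le> (\<integral>\<^sup>+\<xi>. ennreal ((cmod (fourier f \<xi>))\<^sup>2) \<partial>lborel)" for n
  proof -
    have "ennreal (?I n) = (\<integral>\<^sup>+\<xi>. ennreal (exp (- (e n)\<^sup>2 * (norm \<xi>)\<^sup>2 / 2) * (cmod (fourier f \<xi>))\<^sup>2) \<partial>lborel)"
      unfolding eq[symmetric] integral_damped_fourier[OF f e, symmetric]
      by (intro nn_integral_eq_integral[symmetric] integrable_damped_fourier f e) simp
    also have "\<dots> \<le> (\<integral>\<^sup>+\<xi>. ennreal ((cmod (fourier f \<xi>))\<^sup>2) \<partial>lborel)"
      by (intro nn_integral_mono ennreal_leI mult_left_le_one_le) auto
    finally show ?thesis .
  qed
  then show ?thesis
    by (intro LIMSEQ_le_const2[OF tendsto_ennrealI[OF lim']]) auto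
qed


section \<open>Integration by parts\<close>


lemma integrable_continuous_bounded_support:
  fixes h :: "'a::euclidean_space \<Rightarrow> 'b::{banach, second_countable_topology}"
  assumes h: "continuous_on UNIV h" and supp: "\<And>x. norm x > r \<Longrightarrow> h x = 0"
  shows "integrable lborel h" and "\<exists>M. \<forall>x. norm (h x) \<le> M"
proof -
  have "compact (h ` cball 0 r)"
    by (intro compact_continuous_image continuous_on_subset[OF h]) auto
  then obtain M where M: "\<And>x. x \<in> cball 0 r \<Longrightarrow> norm (h x) \<le> M"
    using compact_imp_bounded bounded_iff by (metis image_eqI)
  have M': "norm (h x) \<le> max M 0" for x
    using M[of x] supp[of x] by (cases "norm x \<le> r") auto
  then show "\<exists>M. \<forall>x. norm (h x) \<le> M" by blast
  have "integrable lborel (\<lambda>x. indicator (cball 0 r) x *\<^sub>R h x)"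
    by (intro borel_integrable_compact continuous_on_subset[OF h]) auto
  moreover have "(\<lambda>x. indicator (cball 0 r) x *\<^sub>R h x) = h"
    using supp by (force simp: indicator_def)
  ultimately show "integrable lborel h" by simp
qed

lemma has_vector_derivative_quotient:
  fixes f :: "real \<Rightarrow> 'b::real_normed_vector"
  assumes "(f has_vector_derivative D) (at a)"
  shows "((\<lambda>s. (f s - f a) /\<^sub>R (s - a)) \<longlongrightarrow> D) (at a)"
proof -
  have "((\<lambda>s. norm ((f s - f a) - (s - a) *\<^sub>R D) / norm (s - a)) \<longlongrightarrow> 0) (at a)"
    using assms by (simp add: has_vector_derivative_def has_derivative_iff_norm)
  moreover have "\<forall>\<^sub>F s in at a. norm ((f s - f a) - (s - a) *\<^sub>R D) / norm (s - a) = norm ((f s - f a) /\<^sub>R (s - a) - D)"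
  proof (rule eventually_at_ball'[OF zero_less_one, THEN eventually_mono])
    fix s assume "s \<in> ball a 1 \<and> s \<noteq> a \<and> s \<in> UNIV"
    then have "(f s - f a) /\<^sub>R (s - a) - D = ((f s - f a) - (s - a) *\<^sub>R D) /\<^sub>R (s - a)"
      by (simp add: scaleR_diff_right)
    then show "norm ((f s - f a) - (s - a) *\<^sub>R D) / norm (s - a) = norm ((f s - f a) /\<^sub>R (s - a) - D)"
      by (simp add: divide_inverse)
  qed
  ultimately have "((\<lambda>s. norm ((f s - f a) /\<^sub>R (s - a) - D)) \<longlongrightarrow> 0) (at a)"
    by (rule Lim_transform_eventually)
  then show ?thesis by (simp add: Lim_null[of _ D] tendsto_norm_zero_iff)
qed

text \<open>By translation invariance every difference quotient of \<open>h\<close> has integral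
  zero. The quotients are bounded by the supremum of |\<open>h'\<close>| and live on one ball, so
  dominated convergence passes this on to \<open>h'\<close>.\<close>

lemma integral_directional_derivative_eq_0:
  fixes h h' :: "'a::euclidean_space \<Rightarrow> 'b::{banach, second_countable_topology}"
  assumes D: "\<And>x. ((\<lambda>s. h (x + s *\<^sub>R e)) has_vector_derivative h' x) (at 0)"
    and h: "continuous_on UNIV h" and h': "continuous_on UNIV h'"
    and supp: "\<And>x. norm x > r \<Longrightarrow> h x = 0"
  shows "(LINT x|lborel. h' x) = 0"
proof -
  have [measurable]: "h \<in> borel_measurable borel" "h' \<in> borel_measurable borel"
    using h h' by (auto intro: borel_measurable_continuous_onI)
  have supp': "h' x = 0" if "norm x > r" for x
  proof -
    have "((\<lambda>s::real. 0) has_vector_derivative h' x) (at 0)"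
    proof (rule has_vector_derivative_transform_within_open[OF D[of x]])
      show "open {s. norm (x + s *\<^sub>R e) > r}" by (intro open_Collect_less continuous_intros)
    qed (use that supp in auto)
    then show ?thesis
      using vector_derivative_unique_at has_vector_derivative_const by blast
  qed
  obtain M where M: "\<And>x. norm (h' x) \<le> M"
    using integrable_continuous_bounded_support(2)[OF h' supp'] by blast
  have Ds: "((\<lambda>s. h (x + s *\<^sub>R e)) has_vector_derivative h' (x + s *\<^sub>R e)) (at s)" for x s
  proof -
    have "((\<lambda>t. t - s) has_vector_derivative 1) (at s)"
      by (auto intro!: derivative_eq_intros)
    from vector_diff_chain_at[OF this, of "\<lambda>u. h ((x + s *\<^sub>R e) + u *\<^sub>R e)" "h' (x + s *\<^sub>R e)"]
    have "((\<lambda>u. h ((x + s *\<^sub>R e) + u *\<^sub>R e)) \<circ> (\<lambda>t. t - s) has_vector_derivative (1 *\<^sub>R h' (x + s *\<^sub>R e))) (at s)"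
      using D[of "x + s *\<^sub>R e"] by simp
    then show ?thesis by (simp add: o_def algebra_simps)
  qed
  have bound: "norm (h (x + s *\<^sub>R e) - h x) \<le> M * \<bar>s\<bar>" for x s
  proof -
    have "norm (h (x + s *\<^sub>R e) - h (x + 0 *\<^sub>R e)) \<le> M * norm (s - 0)"
    proof (rule differentiable_bound[of UNIV])
      fix t :: real
      show "((\<lambda>s. h (x + s *\<^sub>R e)) has_derivative (\<lambda>u. u *\<^sub>R h' (x + t *\<^sub>R e))) (at t)"
        using Ds by (simp add: has_vector_derivative_def)
      show "onorm (\<lambda>u. u *\<^sub>R h' (x + t *\<^sub>R e)) \<le> M"
        by (rule onorm_le) (simp add: mult.commute[of "\<bar>_\<bar>"] mult_right_mono M)
    qed auto
    then show ?thesis by (simp only: diff_zero real_norm_def scaleR_zero_left add_0_right)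
  qed
  have ih: "integrable lborel h"
    by (rule integrable_continuous_bounded_support(1)[OF h supp])
  define d where "d n = inverse (real (Suc n))" for n
  have d: "d n > 0" "d n \<le> 1" for n by (auto simp: d_def divide_simps)
  have d0: "d \<longlonglongrightarrow> 0" unfolding d_def by (rule LIMSEQ_inverse_real_of_nat)
  let ?q = "\<lambda>n x. (h (x + d n *\<^sub>R e) - h x) /\<^sub>R d n"
  have q0: "(LINT x|lborel. ?q n x) = 0" for n
  proof -
    have "integrable lborel (\<lambda>x. h (d n *\<^sub>R e + 1 *\<^sub>R x))"
      by (rule integrable_lborel_affine[OF ih]) simp
    then have "integrable lborel (\<lambda>x. h (x + d n *\<^sub>R e))" by (simp add: add.commute)
    moreover have "(LINT x|lborel. h (x + d n *\<^sub>R e)) = (LINT x|lborel. h x)"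
      using integral_lborel_affine[of h 1 "d n *\<^sub>R e"] by (simp add: add.commute)
    ultimately have "(LINT x|lborel. h (x + d n *\<^sub>R e) - h x) = 0"
      using ih by (simp only: Bochner_Integration.integral_diff diff_self)
    then show ?thesis by (simp only: integral_scaleR_right scaleR_zero_right)
  qed
  have "(\<lambda>n. LINT x|lborel. ?q n x) \<longlonglongrightarrow> (LINT x|lborel. h' x)"
  proof (rule integral_dominated_convergence)
    \<comment> \<open>The steps satisfy \<open>d n \<le> 1\<close>, so all quotients vanish outside
      the ball enlarged by \<open>norm e\<close>.\<close>
    show "integrable lborel (\<lambda>x. M * indicat_real (cball 0 (r + norm e)) x)"
      using emeasure_bounded_finite[OF bounded_cball[of 0 "r + norm e"]]
      by (intro integrable_mult_right integrable_real_indicator) (simp_all add: less_top[symmetric])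
    show "AE x in lborel. (\<lambda>n. ?q n x) \<longlonglongrightarrow> h' x"
    proof (rule AE_I2)
      fix x
      have "((\<lambda>s. (h (x + s *\<^sub>R e) - h (x + 0 *\<^sub>R e)) /\<^sub>R (s - 0)) \<longlongrightarrow> h' x) (at 0)"
        by (rule has_vector_derivative_quotient[OF D])
      moreover have "filterlim d (at 0) sequentially"
        using d0 d by (auto simp: filterlim_at intro!: always_eventually less_imp_neq[symmetric])
      ultimately show "(\<lambda>n. ?q n x) \<longlonglongrightarrow> h' x"
        using filterlim_compose by fastforce
    qed
    show "AE x in lborel. norm (?q n x) \<le> M * indicat_real (cball 0 (r + norm e)) x" for n
    proof (rule AE_I2)
      fix x
      show "norm (?q n x) \<le> M * indicat_real (cball 0 (r + norm e)) x"
      proof (cases "norm x \<le> r + norm e")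
        case True
        have "norm (?q n x) = inverse (d n) * norm (h (x + d n *\<^sub>R e) - h x)"
          using d(1)[of n] by (simp only: norm_scaleR abs_of_pos positive_imp_inverse_positive)
        also have "\<dots> \<le> inverse (d n) * (M * \<bar>d n\<bar>)"
          using d(1)[of n] by (intro mult_left_mono bound) simp
        also have "\<dots> = M" using d(1)[of n] by simp
        finally show ?thesis using True by simp
      next
        case False
        have "d n * norm e \<le> norm e" using d[of n] by (simp add: mult_left_le_one_le)
        moreover have "norm x \<le> norm (x + d n *\<^sub>R e) + norm (d n *\<^sub>R e)"
          using norm_triangle_sub[of x "x + d n *\<^sub>R e"] by simp
        ultimately have "norm (x + d n *\<^sub>R e) > r" using False d(1)[of n] by simp
        moreover have "norm x > r" using False norm_ge_zero[of e] by linarith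
        ultimately show ?thesis using False by (simp add: supp)
      qed
    qed
  qed auto
  from this[unfolded q0 LIMSEQ_const_iff] show ?thesis by (rule sym)
qed

lemma partial_has_vector_derivative:
  assumes "f differentiable (at x)"
  shows "((\<lambda>s. f (x + s *\<^sub>R axis i 1)) has_vector_derivative partial i f x) (at 0)"
proof -
  have D: "(f has_derivative frechet_derivative f (at x)) (at x)"
    using assms frechet_derivative_works by blast
  then have lin: "linear (frechet_derivative f (at x))" by (rule has_derivative_linear)
  have "((f \<circ> (\<lambda>s. x + s *\<^sub>R axis i 1)) has_derivative (frechet_derivative f (at x) \<circ> (\<lambda>s. s *\<^sub>R axis i 1))) (at (0::real))"
  proof (rule diff_chain_at)
    show "((\<lambda>s. x + s *\<^sub>R axis i 1) has_derivative (\<lambda>s. s *\<^sub>R axis i 1)) (at (0::real))"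
      by (auto intro!: derivative_eq_intros)
  qed (use D in simp)
  then show ?thesis
    by (simp add: has_vector_derivative_def o_def partial_def linear_cmul[OF lin])
qed

lemma partial_eq_0_outside:
  assumes "\<And>x. norm x > r \<Longrightarrow> f x = 0" "norm x > r"
  shows "partial i f x = 0"
proof -
  have "open {x. norm x > r}" by (intro open_Collect_less continuous_intros)
  then have "(f has_derivative (\<lambda>_. 0)) (at x)"
    by (rule has_derivative_transform_within_open[OF has_derivative_const[of 0]]) (use assms in auto)
  then show ?thesis
    unfolding partial_def by (metis frechet_derivative_at)
qed

text \<open>Derivatives are taken along one axis only and are given as data, since \<open>f\<close>
  will be a slice of phi composed with a dilation, whose derivative carries an extra factor t. Only
  \<open>g\<close> needs bounded support.\<close>

lemma integral_by_parts:
  fixes f g :: "(real, 'n::finite) vec \<Rightarrow> real"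
  assumes f: "\<And>x. ((\<lambda>s. f (x + s *\<^sub>R axis i 1)) has_vector_derivative f' x) (at 0)" "continuous_on UNIV f" "continuous_on UNIV f'"
    and g: "\<And>x. ((\<lambda>s. g (x + s *\<^sub>R axis i 1)) has_vector_derivative g' x) (at 0)" "continuous_on UNIV g" "continuous_on UNIV g'"
    and supp: "\<And>x. norm x > r \<Longrightarrow> g x = 0" "\<And>x. norm x > r \<Longrightarrow> g' x = 0"
  shows "(LINT x|lborel. f x * g' x) = - (LINT x|lborel. f' x * g x)"
proof -
  have "(LINT x|lborel. f x * g' x + f' x * g x) = 0"
  proof (rule integral_directional_derivative_eq_0[where h = "\<lambda>x. f x * g x" and r = r and e = "axis i 1"])
    show "((\<lambda>s. f (x + s *\<^sub>R axis i 1) * g (x + s *\<^sub>R axis i 1)) has_vector_derivative f x * g' x + f' x * g x) (at 0)" for x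
      using has_vector_derivative_mult[OF f(1)[of x] g(1)[of x]] by simp
  qed (auto intro!: continuous_intros f g supp)
  moreover have "integrable lborel (\<lambda>x. f x * g' x)"
    by (rule integrable_continuous_bounded_support(1)[where r=r]) (auto intro!: continuous_intros f g supp)
  moreover have "integrable lborel (\<lambda>x. f' x * g x)"
    by (rule integrable_continuous_bounded_support(1)[where r=r]) (auto intro!: continuous_intros f g supp)
  ultimately show ?thesis by simp
qed

text \<open>The second derivatives that occur are the pure ones: summed over the axes they control
  |xi|^2 times the Fourier transform.\<close>

definition C2c :: "((real, 'n::finite) vec \<Rightarrow> real) \<Rightarrow> bool" where
  "C2c f \<longleftrightarrow> (\<forall>x. f differentiable (at x)) \<and> (\<forall>k x. partial k f differentiable (at x)) \<and>
     (\<forall>k. continuous_on UNIV (partial k (partial k f))) \<and> (\<exists>r. \<forall>x. norm x > r \<longrightarrow> f x = 0)"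

lemma differentiable_imp_continuous_UNIV: "(\<And>x. f differentiable (at x)) \<Longrightarrow> continuous_on UNIV f"
  by (intro continuous_at_imp_continuous_on ballI differentiable_imp_continuous_within)

lemma fourier_partial:
  fixes f :: "(real, 'n::finite) vec \<Rightarrow> real"
  assumes f: "\<And>x. f differentiable (at x)" "continuous_on UNIV (partial j f)" and supp: "\<And>x. norm x > r \<Longrightarrow> f x = 0"
  shows "fourier (partial j f) \<xi> = \<i> * complex_of_real (\<xi> $ j) * fourier f \<xi>"
proof -
  have c: "continuous_on UNIV f" by (rule differentiable_imp_continuous_UNIV[OF f(1)])
  note supp' = partial_eq_0_outside[OF supp]
  let ?c = "\<lambda>x. cis (- (\<xi> \<bullet> x))"
  have dc: "((\<lambda>s. ?c (x + s *\<^sub>R axis j 1)) has_vector_derivative (- \<i> * complex_of_real (\<xi> $ j) * ?c x)) (at 0)" for x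
  proof -
    have "((\<lambda>z. exp (\<i> * (complex_of_real (- (\<xi> \<bullet> x)) - z * complex_of_real (\<xi> $ j)))) has_field_derivative
        (- \<i> * complex_of_real (\<xi> $ j) * exp (\<i> * complex_of_real (- (\<xi> \<bullet> x))))) (at (of_real 0))"
      by (auto intro!: derivative_eq_intros simp: mult_ac)
    from has_vector_derivative_real_field[OF this] show ?thesis by (simp add: cis_conv_exp inner_add_right inner_axis algebra_simps)
  qed
  have "(LINT x|lborel. f x *\<^sub>R (- \<i> * complex_of_real (\<xi> $ j) * ?c x) + partial j f x *\<^sub>R ?c x) = 0"
  proof (rule integral_directional_derivative_eq_0[where h = "\<lambda>x. f x *\<^sub>R ?c x" and r = r and e = "axis j 1"])
    show "((\<lambda>s. f (x + s *\<^sub>R axis j 1) *\<^sub>R ?c (x + s *\<^sub>R axis j 1)) has_vector_derivative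
        f x *\<^sub>R (- \<i> * complex_of_real (\<xi> $ j) * ?c x) + partial j f x *\<^sub>R ?c x) (at 0)" for x
      using has_vector_derivative_scaleR[OF partial_has_vector_derivative[OF f(1)[of x], unfolded has_real_derivative_iff_has_vector_derivative[symmetric]] dc[of x]]
      by simp
  qed (auto intro!: continuous_intros c f supp)
  moreover have "integrable lborel (\<lambda>x. f x *\<^sub>R ?c x)"
    by (rule integrable_continuous_bounded_support(1)[where r=r]) (auto intro!: continuous_intros c supp)
  then have "integrable lborel (\<lambda>x. (- \<i> * complex_of_real (\<xi> $ j)) * (f x *\<^sub>R ?c x))"
    by (rule integrable_mult_right)
  then have "integrable lborel (\<lambda>x. f x *\<^sub>R (- \<i> * complex_of_real (\<xi> $ j) * ?c x))"
    by (simp add: scaleR_conv_of_real mult_ac)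
  moreover have "integrable lborel (\<lambda>x. partial j f x *\<^sub>R ?c x)"
    by (rule integrable_continuous_bounded_support(1)[where r=r]) (auto intro!: continuous_intros f supp')
  moreover have "(LINT x|lborel. f x *\<^sub>R (- \<i> * complex_of_real (\<xi> $ j) * ?c x)) = (- \<i> * complex_of_real (\<xi> $ j)) * (LINT x|lborel. f x *\<^sub>R ?c x)"
    unfolding integral_mult_right_zero[symmetric] by (intro Bochner_Integration.integral_cong) (simp_all add: scaleR_conv_of_real mult_ac)
  ultimately show ?thesis by (simp add: fourier_def)
qed

lemma C2c_D:
  assumes "C2c f"
  shows "f differentiable (at x)" "partial k f differentiable (at x)"
    "continuous_on UNIV (partial k (partial k f))"
    "continuous_on UNIV f" "continuous_on UNIV (partial k f)" "\<exists>r. \<forall>x. norm x > r \<longrightarrow> f x = 0"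
  using assms by (auto simp: C2c_def intro: differentiable_imp_continuous_UNIV)

text \<open>The factor |xi| is the cancellation, a derivative having integral zero. For the
  denominator, \<open>fourier f\<close> is bounded by \<open>A\<close>, and |xi|^2
  \<open>fourier f\<close> by the sum of the n pure second derivatives, that is n A / rho^2; adding
  the two gives 1 + n.\<close>

lemma fourier_partial_le:
  fixes f :: "(real, 'n::finite) vec \<Rightarrow> real" and A \<rho> :: real
  assumes f: "C2c f" and rho: "\<rho> > 0"
    and A: "(LINT x|lborel. \<bar>f x\<bar>) \<le> A" "\<And>k. (LINT x|lborel. \<bar>partial k (partial k f) x\<bar>) \<le> A / \<rho>\<^sup>2"
  shows "cmod (fourier (partial j f) \<xi>) \<le> (1 + CARD('n)) * A * norm \<xi> / (1 + \<rho>\<^sup>2 * (norm \<xi>)\<^sup>2)"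
proof -
  note D = C2c_D[OF f]
  obtain r where r: "\<And>x. norm x > r \<Longrightarrow> f x = 0" using D(6) by blast
  have F1: "fourier (partial k f) \<xi> = \<i> * complex_of_real (\<xi> $ k) * fourier f \<xi>" for k
    by (rule fourier_partial[OF D(1) D(5) r])
  have F2: "fourier (partial k (partial k f)) \<xi> = - complex_of_real ((\<xi> $ k)\<^sup>2) * fourier f \<xi>" for k
  proof -
    have "fourier (partial k (partial k f)) \<xi> = \<i> * complex_of_real (\<xi> $ k) * fourier (partial k f) \<xi>"
      by (rule fourier_partial[OF D(2) D(3) partial_eq_0_outside[OF r]])
    also have "\<dots> = (\<i> * \<i>) * complex_of_real (\<xi> $ k * \<xi> $ k) * fourier f \<xi>"
      by (simp only: F1 of_real_mult mult_ac)
    finally show ?thesis by (simp add: power2_eq_square)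
  qed
  have n2: "(norm \<xi>)\<^sup>2 = (\<Sum>k\<in>UNIV. (\<xi> $ k)\<^sup>2)"
    unfolding power2_norm_eq_inner inner_vec_def by (simp add: power2_eq_square)
  have "(norm \<xi>)\<^sup>2 * cmod (fourier f \<xi>) = (\<Sum>k\<in>UNIV. cmod (fourier (partial k (partial k f)) \<xi>))"
    unfolding F2 n2 by (simp add: norm_mult sum_distrib_right flip: of_real_power)
  also have "\<dots> \<le> (\<Sum>k\<in>(UNIV::'n set). A / \<rho>\<^sup>2)"
    by (intro sum_mono order_trans[OF norm_fourier_le] A)
  finally have "\<rho>\<^sup>2 * ((norm \<xi>)\<^sup>2 * cmod (fourier f \<xi>)) \<le> \<rho>\<^sup>2 * (CARD('n) * (A / \<rho>\<^sup>2))"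
    by (intro mult_left_mono) auto
  moreover have "cmod (fourier f \<xi>) \<le> A"
    using norm_fourier_le A(1) by (rule order_trans)
  ultimately have *: "(1 + \<rho>\<^sup>2 * (norm \<xi>)\<^sup>2) * cmod (fourier f \<xi>) \<le> (1 + CARD('n)) * A"
    using rho by (simp add: algebra_simps)
  have pos: "1 + \<rho>\<^sup>2 * (norm \<xi>)\<^sup>2 > 0"
    by (intro add_pos_nonneg) auto
  have "cmod (fourier (partial j f) \<xi>) = \<bar>\<xi> $ j\<bar> * cmod (fourier f \<xi>)"
    by (simp add: F1 norm_mult)
  also have "\<dots> \<le> norm \<xi> * cmod (fourier f \<xi>)"
    by (intro mult_right_mono component_le_norm_cart) auto
  also have "\<dots> \<le> norm \<xi> * ((1 + CARD('n)) * A / (1 + \<rho>\<^sup>2 * (norm \<xi>)\<^sup>2))"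
    using * pos by (intro mult_left_mono) (auto simp: field_simps)
  finally show ?thesis by (simp add: mult_ac)
qed


section \<open>The averaging operator\<close>


abbreviation slice_integrand ::
    "(real \<Rightarrow> real) \<Rightarrow> ((real, 'n::finite) vec \<Rightarrow> real) \<Rightarrow> ((real, 'n) vec \<Rightarrow> real) \<Rightarrow> (real, 'n) vec \<Rightarrow> real \<times> (real, 'n) vec \<Rightarrow> real" where
  "slice_integrand v \<phi> g x p \<equiv> v (fst p) * \<phi> (snd p + fst p *\<^sub>R (x - snd p)) * g (snd p)"

text \<open>\<open>p\<close> is the pair (t, y), so that a single integral can be sliced either way.
  At points x where it does not converge absolutely the value is the default 0; hence several
  identities below hold only almost everywhere.\<close>

definition bog_op :: "(real \<Rightarrow> real) \<Rightarrow> ((real, 'n::finite) vec \<Rightarrow> real) \<Rightarrow> ((real, 'n) vec \<Rightarrow> real) \<Rightarrow> (real, 'n) vec \<Rightarrow> real" where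
  "bog_op v \<phi> g x = (LINT p|lborel. slice_integrand v \<phi> g x p)"

definition weight :: "(real \<Rightarrow> real) \<Rightarrow> bool" where
  "weight v \<longleftrightarrow> v \<in> borel_measurable borel \<and> (\<forall>t. v t \<ge> 0) \<and> (\<forall>t<1. v t = 0)"

lemma weight_D:
  assumes "weight v"
  shows "v \<in> borel_measurable borel" "v t \<ge> 0" "v t \<noteq> 0 \<Longrightarrow> t \<ge> 1"
  using assms by (auto simp: weight_def not_le[symmetric])

lemma nn_integral_slice_x:
  fixes F :: "(real, 'n::finite) vec \<Rightarrow> ennreal"
  assumes [measurable]: "F \<in> borel_measurable borel" and t: "t > 0"
  shows "(\<integral>\<^sup>+x. F (y + t *\<^sub>R (x - y)) \<partial>lborel) = ennreal (1 / t ^ CARD('n)) * (\<integral>\<^sup>+z. F z \<partial>lborel)"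
proof -
  have "(\<integral>\<^sup>+z. F z \<partial>lborel) = ennreal (t ^ CARD('n)) * (\<integral>\<^sup>+x. F (y + t *\<^sub>R (x - y)) \<partial>lborel)"
    using nn_integral_lborel_affine[of F t "y - t *\<^sub>R y"] t by (simp add: scaleR_diff_right algebra_simps)
  then show ?thesis
    using t by (simp add: mult.assoc[symmetric] ennreal_mult[symmetric])
qed

text \<open>In x the map y + t (x - y) dilates by t, in y by 1 - t. The y-slices therefore
  degenerate as t tends to 1, which is where the volume of \<Omega> has to help.\<close>

lemma nn_integral_slice_y:
  fixes F :: "(real, 'n::finite) vec \<Rightarrow> ennreal"
  assumes [measurable]: "F \<in> borel_measurable borel" and t: "t > 1"
  shows "(\<integral>\<^sup>+y. F (y + t *\<^sub>R (x - y)) \<partial>lborel) = ennreal (1 / (t - 1) ^ CARD('n)) * (\<integral>\<^sup>+z. F z \<partial>lborel)"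
proof -
  have "(\<integral>\<^sup>+z. F z \<partial>lborel) = ennreal ((t - 1) ^ CARD('n)) * (\<integral>\<^sup>+y. F (y + t *\<^sub>R (x - y)) \<partial>lborel)"
    using nn_integral_lborel_affine[of F "1 - t" "t *\<^sub>R x"] t by (simp add: algebra_simps abs_if)
  then show ?thesis
    using t by (simp add: mult.assoc[symmetric] ennreal_mult[symmetric])
qed

text \<open>Integrating over x first produces the Jacobian t^(-n) and decouples the remaining
  variables, leaving a product of three integrals. Hence the hypothesis on v(t) / t^n.\<close>

lemma bog_op_integrand_integrable:
  fixes \<phi> g :: "(real, 'n::finite) vec \<Rightarrow> real"
  assumes v: "weight v" "integrable lborel (\<lambda>t. v t / t ^ CARD('n))"
    and \<phi>: "integrable lborel \<phi>" and g: "integrable lborel g"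
  shows "integrable lborel (\<lambda>q::(real, 'n) vec \<times> real \<times> (real, 'n) vec.
    slice_integrand v \<phi> g (fst q) (snd q))"
proof (rule integrableI_bounded)
  note [measurable] = weight_D(1)[OF v(1)]
  have [measurable]: "\<phi> \<in> borel_measurable borel" "g \<in> borel_measurable borel" using \<phi> g by auto
  let ?K = "\<lambda>q::(real, 'n) vec \<times> real \<times> (real, 'n) vec.
    slice_integrand v \<phi> g (fst q) (snd q)"
  show "?K \<in> borel_measurable lborel" by measurable
  have inner: "(\<integral>\<^sup>+x. ennreal (norm (?K (x, p))) \<partial>lborel) =
      ennreal (v (fst p) / fst p ^ CARD('n)) * ennreal \<bar>g (snd p)\<bar> * (\<integral>\<^sup>+z. ennreal \<bar>\<phi> z\<bar> \<partial>lborel)" for p :: "real \<times> (real, 'n) vec"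
  proof (cases "v (fst p) = 0")
    case False
    then have t: "fst p > 0" using weight_D(3)[OF v(1)] by fastforce
    have "(\<integral>\<^sup>+x. ennreal (norm (?K (x, p))) \<partial>lborel) =
        (\<integral>\<^sup>+x. ennreal (v (fst p)) * ennreal \<bar>g (snd p)\<bar> * ennreal \<bar>\<phi> (snd p + fst p *\<^sub>R (x - snd p))\<bar> \<partial>lborel)"
      using weight_D(2)[OF v(1)] by (simp add: abs_mult ennreal_mult' mult_ac)
    also have "\<dots> = ennreal (v (fst p)) * ennreal \<bar>g (snd p)\<bar> * (ennreal (1 / fst p ^ CARD('n)) * (\<integral>\<^sup>+z. ennreal \<bar>\<phi> z\<bar> \<partial>lborel))"
      by (subst nn_integral_cmult) (simp_all add: nn_integral_slice_x[OF _ t, of "\<lambda>z. ennreal \<bar>\<phi> z\<bar>"])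
    also have "\<dots> = ennreal (v (fst p)) * ennreal (1 / fst p ^ CARD('n)) * ennreal \<bar>g (snd p)\<bar> * (\<integral>\<^sup>+z. ennreal \<bar>\<phi> z\<bar> \<partial>lborel)"
      by (simp only: mult_ac)
    also have "ennreal (v (fst p)) * ennreal (1 / fst p ^ CARD('n)) = ennreal (v (fst p) / fst p ^ CARD('n))"
      using t weight_D(2)[OF v(1)] by (subst ennreal_mult[symmetric]) auto
    finally show ?thesis .
  qed simp
  have "(\<integral>\<^sup>+q. ennreal (norm (?K q)) \<partial>lborel) =
      (\<integral>\<^sup>+p. ennreal (v (fst p) / fst p ^ CARD('n)) * ennreal \<bar>g (snd p)\<bar> \<partial>lborel) * (\<integral>\<^sup>+z. ennreal \<bar>\<phi> z\<bar> \<partial>lborel)"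
    by (subst nn_integral_lborel_snd) (simp_all only: inner, simp_all add: nn_integral_multc)
  also have "(\<integral>\<^sup>+p. ennreal (v (fst p) / fst p ^ CARD('n)) * ennreal \<bar>g (snd p)\<bar> \<partial>lborel) =
      (\<integral>\<^sup>+t. ennreal (v t / t ^ CARD('n)) \<partial>lborel) * (\<integral>\<^sup>+y. ennreal \<bar>g y\<bar> \<partial>lborel)"
    by (subst nn_integral_lborel_fst) (simp_all add: nn_integral_cmult nn_integral_multc)
  also have "\<dots> * (\<integral>\<^sup>+z. ennreal \<bar>\<phi> z\<bar> \<partial>lborel) < \<infinity>"
  proof -
    have "(\<integral>\<^sup>+t. ennreal (v t / t ^ CARD('n)) \<partial>lborel) \<le> (\<integral>\<^sup>+t. ennreal (norm (v t / t ^ CARD('n))) \<partial>lborel)"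
      by (intro nn_integral_mono ennreal_leI) (simp only: real_norm_def abs_ge_self)
    also have "\<dots> < \<infinity>" using v(2) by (simp add: integrable_iff_bounded)
    finally show ?thesis
      using \<phi> g by (simp add: integrable_iff_bounded ennreal_mult_less_top)
  qed
  finally show "(\<integral>\<^sup>+q. ennreal (norm (?K q)) \<partial>lborel) < \<infinity>" .
qed

lemma
  fixes \<phi> g :: "(real, 'n::finite) vec \<Rightarrow> real"
  assumes "weight v" "integrable lborel (\<lambda>t. v t / t ^ CARD('n))" "integrable lborel \<phi>" "integrable lborel g"
  shows integrable_bog_op: "integrable lborel (bog_op v \<phi> g)"
    and AE_integrable_bog_op: "AE x in lborel. integrable lborel (\<lambda>p. slice_integrand v \<phi> g x p)"
  using integrable_lborel_fst[OF bog_op_integrand_integrable[OF assms]]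
    AE_integrable_lborel_fst[OF bog_op_integrand_integrable[OF assms]]
  by (simp_all add: bog_op_def[abs_def])

lemma borel_measurable_bog_op [measurable]:
  assumes [measurable]: "v \<in> borel_measurable borel" "\<phi> \<in> borel_measurable borel" "g \<in> borel_measurable borel"
  shows "bog_op v \<phi> g \<in> borel_measurable borel"
  unfolding bog_op_def[abs_def] by measurable

text \<open>Fubini against a bounded function of x. \<open>f\<close> will be a character, which is
  complex valued, or a test function or one of its derivatives.\<close>

lemma
  fixes \<phi> g :: "(real, 'n::finite) vec \<Rightarrow> real" and f :: "(real, 'n) vec \<Rightarrow> 'b::{banach, second_countable_topology}"
  assumes K: "weight v" "integrable lborel (\<lambda>t. v t / t ^ CARD('n))" "integrable lborel \<phi>" "integrable lborel g"
    and f [measurable]: "f \<in> borel_measurable borel" and M: "\<And>x. norm (f x) \<le> M"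
  shows bog_op_scaleR_integrable: "integrable lborel (\<lambda>q::(real, 'n) vec \<times> real \<times> (real, 'n) vec.
      (slice_integrand v \<phi> g (fst q) (snd q)) *\<^sub>R f (fst q))"
    and integral_bog_op_scaleR: "(LINT x|lborel. bog_op v \<phi> g x *\<^sub>R f x) =
      (LINT q|lborel. (slice_integrand v \<phi> g (fst q) (snd q)) *\<^sub>R f (fst q))"
    and integral_bog_op_scaleR_swap: "(LINT x|lborel. bog_op v \<phi> g x *\<^sub>R f x) =
      (LINT p|lborel. (v (fst p) * g (snd p)) *\<^sub>R (LINT x|lborel. \<phi> (snd p + fst p *\<^sub>R (x - snd p)) *\<^sub>R f x))"
proof -
  note [measurable] = weight_D(1)[OF K(1)]
  have [measurable]: "\<phi> \<in> borel_measurable borel" "g \<in> borel_measurable borel" using K by auto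
  let ?K = "\<lambda>q::(real, 'n) vec \<times> real \<times> (real, 'n) vec.
    slice_integrand v \<phi> g (fst q) (snd q)"
  show int: "integrable lborel (\<lambda>q. ?K q *\<^sub>R f (fst q))"
  proof (rule Bochner_Integration.integrable_bound)
    show "integrable lborel (\<lambda>q. M *\<^sub>R ?K q)"
      by (intro integrable_scaleR_right bog_op_integrand_integrable K)
    have "norm (?K q *\<^sub>R f (fst q)) \<le> norm (M *\<^sub>R ?K q)" for q
    proof -
      have "norm (?K q *\<^sub>R f (fst q)) = norm (?K q) * norm (f (fst q))" by (rule norm_scaleR[folded real_norm_def])
      also have "\<dots> \<le> norm (?K q) * \<bar>M\<bar>"
        using M[of "fst q"] by (intro mult_left_mono) auto
      finally show ?thesis by (simp only: norm_scaleR mult.commute)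
    qed
    then show "AE q in lborel. norm (?K q *\<^sub>R f (fst q)) \<le> norm (M *\<^sub>R ?K q)" by (intro AE_I2)
  qed measurable
  have "(LINT x|lborel. bog_op v \<phi> g x *\<^sub>R f x) = (LINT x|lborel. LINT p|lborel. ?K (x, p) *\<^sub>R f x)"
  proof (rule integral_cong_AE)
    show "AE x in lborel. bog_op v \<phi> g x *\<^sub>R f x = (LINT p|lborel. ?K (x, p) *\<^sub>R f x)"
      using AE_integrable_bog_op[OF K] by eventually_elim (simp add: bog_op_def)
  qed measurable
  also have "\<dots> = (LINT q|lborel. ?K q *\<^sub>R f (fst q))"
    by (subst integral_lborel_fst[OF int]) simp
  finally show eq: "(LINT x|lborel. bog_op v \<phi> g x *\<^sub>R f x) = (LINT q|lborel. ?K q *\<^sub>R f (fst q))" .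
  have "(LINT q|lborel. ?K q *\<^sub>R f (fst q)) = (LINT p|lborel. LINT x|lborel. ?K (x, p) *\<^sub>R f x)"
    by (subst integral_lborel_snd[OF int]) simp
  also have "\<dots> = (LINT p|lborel. (LINT x|lborel. (v (fst p) * g (snd p)) *\<^sub>R (\<phi> (snd p + fst p *\<^sub>R (x - snd p)) *\<^sub>R f x)))"
    by (simp add: mult_ac)
  finally show "(LINT x|lborel. bog_op v \<phi> g x *\<^sub>R f x) =
      (LINT p|lborel. (v (fst p) * g (snd p)) *\<^sub>R (LINT x|lborel. \<phi> (snd p + fst p *\<^sub>R (x - snd p)) *\<^sub>R f x))"
    by (simp only: eq integral_scaleR_right)
qed

text \<open>On each slice the derivative moves from \<open>\<eta>\<close> to \<open>\<phi>\<close>,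
  and the dilation by t contributes the new factor t in the weight. Both weights must be integrable
  against t^(-n), so this is applied to truncated weights.\<close>

lemma bog_op_by_parts:
  fixes \<phi> g \<eta> :: "(real, 'n::finite) vec \<Rightarrow> real"
  assumes w: "weight w" "integrable lborel (\<lambda>t. w t / t ^ CARD('n))" "integrable lborel (\<lambda>t. t * w t / t ^ CARD('n))"
    and \<phi>: "C2c \<phi>" and g: "integrable lborel g"
    and \<eta>: "\<And>x. \<eta> differentiable (at x)" "continuous_on UNIV (partial j \<eta>)" "\<And>x. norm x > r \<Longrightarrow> \<eta> x = 0"
  shows "(LINT x|lborel. bog_op w \<phi> g x * partial j \<eta> x) = - (LINT x|lborel. bog_op (\<lambda>t. t * w t) (partial j \<phi>) g x * \<eta> x)"
proof -
  note D = C2c_D[OF \<phi>]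
  obtain s where s: "\<And>x. norm x > s \<Longrightarrow> \<phi> x = 0" using D(6) by blast
  have i\<phi>: "integrable lborel \<phi>" "integrable lborel (partial j \<phi>)"
    by (rule integrable_continuous_bounded_support(1)[OF D(4) s], simp,
        rule integrable_continuous_bounded_support(1)[OF D(5) partial_eq_0_outside[OF s]], simp)
  have c: "continuous_on UNIV \<eta>" by (rule differentiable_imp_continuous_UNIV[OF \<eta>(1)])
  have p0: "partial j \<eta> x = 0" if "norm x > r" for x
    by (rule partial_eq_0_outside[OF \<eta>(3) that])
  obtain M where M: "\<And>x. norm (\<eta> x) \<le> M"
    using integrable_continuous_bounded_support(2)[OF c \<eta>(3)] by blast
  obtain M' where M': "\<And>x. norm (partial j \<eta> x) \<le> M'"
    using integrable_continuous_bounded_support(2)[OF \<eta>(2) p0] by blast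
  have [measurable]: "\<eta> \<in> borel_measurable borel" "partial j \<eta> \<in> borel_measurable borel"
    using c \<eta>(2) by (auto intro: borel_measurable_continuous_onI)
  have w': "weight (\<lambda>t. t * w t)"
    using w(1) by (auto simp: weight_def) (metis less_eq_real_def linorder_not_less mult_nonneg_nonneg mult_zero_right order_trans zero_le_one)
  have inner: "(LINT x|lborel. \<phi> (y + t *\<^sub>R (x - y)) * partial j \<eta> x) =
     - (LINT x|lborel. t * partial j \<phi> (y + t *\<^sub>R (x - y)) * \<eta> x)" for y t
  proof (rule integral_by_parts[where r = r and i = j])
    fix x
    have *: "((\<lambda>s. t * s) has_vector_derivative t) (at 0)"
      by (auto intro!: derivative_eq_intros)
    have "((\<lambda>s. \<phi> ((y + t *\<^sub>R (x - y)) + s *\<^sub>R axis j 1)) \<circ> (\<lambda>s. t * s) has_vector_derivative t *\<^sub>R partial j \<phi> (y + t *\<^sub>R (x - y))) (at 0)"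
      by (rule vector_diff_chain_at[OF *]) (use partial_has_vector_derivative[OF D(1), of "y + t *\<^sub>R (x - y)" j] in simp)
    moreover have "(\<lambda>s. \<phi> ((y + t *\<^sub>R (x - y)) + s *\<^sub>R axis j 1)) \<circ> (\<lambda>s. t * s) = (\<lambda>s. \<phi> (y + t *\<^sub>R (x + s *\<^sub>R axis j 1 - y)))"
      by (simp add: fun_eq_iff algebra_simps)
    ultimately show "((\<lambda>s. \<phi> (y + t *\<^sub>R (x + s *\<^sub>R axis j 1 - y))) has_vector_derivative t * partial j \<phi> (y + t *\<^sub>R (x - y))) (at 0)"
      by simp
    show "((\<lambda>s. \<eta> (x + s *\<^sub>R axis j 1)) has_vector_derivative partial j \<eta> x) (at 0)"
      by (rule partial_has_vector_derivative[OF \<eta>(1)])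
  next
    show "continuous_on UNIV (\<lambda>x. \<phi> (y + t *\<^sub>R (x - y)))"
      by (rule continuous_on_compose2[OF D(4)]) (auto intro!: continuous_intros)
    show "continuous_on UNIV (\<lambda>x. t * partial j \<phi> (y + t *\<^sub>R (x - y)))"
      by (rule continuous_on_mult_left, rule continuous_on_compose2[OF D(5)]) (auto intro!: continuous_intros)
  qed (use c \<eta> p0 in auto)
  have "(LINT x|lborel. bog_op w \<phi> g x *\<^sub>R partial j \<eta> x) =
      (LINT p|lborel. (w (fst p) * g (snd p)) *\<^sub>R (LINT x|lborel. \<phi> (snd p + fst p *\<^sub>R (x - snd p)) *\<^sub>R partial j \<eta> x))"
    by (rule integral_bog_op_scaleR_swap[OF w(1,2) i\<phi>(1) g _ M']) simp
  also have "\<dots> = (LINT p|lborel. (- (fst p * w (fst p) * g (snd p))) *\<^sub>R (LINT x|lborel. partial j \<phi> (snd p + fst p *\<^sub>R (x - snd p)) *\<^sub>R \<eta> x))"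
    by (simp add: inner mult.assoc) (simp add: mult_ac)
  also have "\<dots> = - (LINT p|lborel. (fst p * w (fst p) * g (snd p)) *\<^sub>R (LINT x|lborel. partial j \<phi> (snd p + fst p *\<^sub>R (x - snd p)) *\<^sub>R \<eta> x))"
    by simp
  also have "(LINT p|lborel. (fst p * w (fst p) * g (snd p)) *\<^sub>R (LINT x|lborel. partial j \<phi> (snd p + fst p *\<^sub>R (x - snd p)) *\<^sub>R \<eta> x)) =
     (LINT x|lborel. bog_op (\<lambda>t. t * w t) (partial j \<phi>) g x *\<^sub>R \<eta> x)"
    by (rule integral_bog_op_scaleR_swap[OF w' w(3) i\<phi>(2) g _ M, symmetric]) simp
  finally show ?thesis by simp
qed

text \<open>For fixed t the slice is a convolution of dilated copies of \<open>\<psi>\<close> and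
  \<open>g\<close>, so its transform is a product; the integral over t stays outside.\<close>

lemma fourier_bog_op:
  fixes \<psi> g :: "(real, 'n::finite) vec \<Rightarrow> real"
  assumes v: "weight v" "integrable lborel (\<lambda>t. v t / t ^ CARD('n))" and \<psi>: "integrable lborel \<psi>" and g: "integrable lborel g"
  shows "fourier (bog_op v \<psi> g) \<xi> = (LINT t|lborel. (v t / t ^ CARD('n)) *\<^sub>R (fourier \<psi> (\<xi> /\<^sub>R t) * fourier g ((1 - 1 / t) *\<^sub>R \<xi>)))"
proof -
  note [measurable] = weight_D(1)[OF v(1)]
  have [measurable]: "\<psi> \<in> borel_measurable borel" "g \<in> borel_measurable borel" using \<psi> g by auto
  let ?c = "\<lambda>x. cis (- (\<xi> \<bullet> x))"
  have inner: "(LINT x|lborel. \<psi> (y + t *\<^sub>R (x - y)) *\<^sub>R ?c x) =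
      (1 / t ^ CARD('n)) *\<^sub>R (fourier \<psi> (\<xi> /\<^sub>R t) * cis (- (((1 - 1 / t) *\<^sub>R \<xi>) \<bullet> y)))" if t: "t > 0" for t y
  proof -
    \<comment> \<open>The substitution x = (1 - 1/t) y + z/t reduces the argument of
      \<open>\<psi>\<close> to z and splits the character into a factor in z and a factor in
      y.\<close>
    have a: "y + t *\<^sub>R ((1 - 1 / t) *\<^sub>R y + (1 / t) *\<^sub>R z - y) = z" for z
      using t by (simp add: algebra_simps)
    have b: "?c ((1 - 1 / t) *\<^sub>R y + (1 / t) *\<^sub>R z) = cis (- ((\<xi> /\<^sub>R t) \<bullet> z)) * cis (- (((1 - 1 / t) *\<^sub>R \<xi>) \<bullet> y))" for z
      by (simp add: cis_mult inner_add_right divide_inverse algebra_simps)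
    have "(LINT x|lborel. \<psi> (y + t *\<^sub>R (x - y)) *\<^sub>R ?c x) =
        \<bar>1 / t\<bar> ^ CARD('n) *\<^sub>R (LINT z|lborel. \<psi> (y + t *\<^sub>R ((1 - 1 / t) *\<^sub>R y + (1 / t) *\<^sub>R z - y)) *\<^sub>R ?c ((1 - 1 / t) *\<^sub>R y + (1 / t) *\<^sub>R z))"
      using integral_lborel_affine[of "\<lambda>x. \<psi> (y + t *\<^sub>R (x - y)) *\<^sub>R ?c x" "1 / t" "(1 - 1 / t) *\<^sub>R y"] t
      by simp
    also have "\<dots> = (1 / t ^ CARD('n)) *\<^sub>R (LINT z|lborel. (\<psi> z *\<^sub>R cis (- ((\<xi> /\<^sub>R t) \<bullet> z))) * cis (- (((1 - 1 / t) *\<^sub>R \<xi>) \<bullet> y)))"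
      unfolding a b using t by (simp add: power_one_over)
    finally show ?thesis by (simp only: integral_mult_left_zero fourier_def)
  qed
  have "fourier (bog_op v \<psi> g) \<xi> = (LINT p|lborel. (v (fst p) * g (snd p)) *\<^sub>R (LINT x|lborel. \<psi> (snd p + fst p *\<^sub>R (x - snd p)) *\<^sub>R ?c x))"
    unfolding fourier_def by (rule integral_bog_op_scaleR_swap[OF v \<psi> g, where M = 1]) auto
  also have "\<dots> = (LINT p|lborel. ((v (fst p) / fst p ^ CARD('n)) *\<^sub>R fourier \<psi> (\<xi> /\<^sub>R fst p)) * (g (snd p) *\<^sub>R cis (- (((1 - 1 / fst p) *\<^sub>R \<xi>) \<bullet> snd p))))"
  proof (intro Bochner_Integration.integral_cong refl)
    fix p :: "real \<times> (real, 'n) vec"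
    show "(v (fst p) * g (snd p)) *\<^sub>R (LINT x|lborel. \<psi> (snd p + fst p *\<^sub>R (x - snd p)) *\<^sub>R ?c x) =
        ((v (fst p) / fst p ^ CARD('n)) *\<^sub>R fourier \<psi> (\<xi> /\<^sub>R fst p)) * (g (snd p) *\<^sub>R cis (- (((1 - 1 / fst p) *\<^sub>R \<xi>) \<bullet> snd p)))"
    proof (cases "v (fst p) = 0")
      case False
      then have "fst p > 0" using weight_D(3)[OF v(1)] by fastforce
      then show ?thesis by (simp only: inner) (simp add: mult_ac)
    qed simp
  qed
  also have "\<dots> = (LINT t|lborel. LINT y|lborel. ((v t / t ^ CARD('n)) *\<^sub>R fourier \<psi> (\<xi> /\<^sub>R t)) * (g y *\<^sub>R cis (- (((1 - 1 / t) *\<^sub>R \<xi>) \<bullet> y))))"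
  proof (subst integral_lborel_fst)
    have meas: "(\<lambda>t. fourier \<psi> (\<xi> /\<^sub>R t)) \<in> borel_measurable borel"
      by (rule measurable_compose[OF _ borel_measurable_fourier]) simp_all
    show "integrable lborel (\<lambda>p. ((v (fst p) / fst p ^ CARD('n)) *\<^sub>R fourier \<psi> (\<xi> /\<^sub>R fst p)) * (g (snd p) *\<^sub>R cis (- (((1 - 1 / fst p) *\<^sub>R \<xi>) \<bullet> snd p))))"
    proof (rule Bochner_Integration.integrable_bound)
      show "integrable lborel (\<lambda>p::real \<times> (real, 'n) vec. (LINT x|lborel. \<bar>\<psi> x\<bar>) * ((v (fst p) / fst p ^ CARD('n)) * g (snd p)))"
        by (intro integrable_mult_right integrable_lborel_mult_prod v g)
      show "(\<lambda>p. ((v (fst p) / fst p ^ CARD('n)) *\<^sub>R fourier \<psi> (\<xi> /\<^sub>R fst p)) * (g (snd p) *\<^sub>R cis (- (((1 - 1 / fst p) *\<^sub>R \<xi>) \<bullet> snd p)))) \<in> borel_measurable lborel"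
        using measurable_compose[OF borel_measurable_fst_borel meas] by measurable
      show "AE p in lborel. norm (((v (fst p) / fst p ^ CARD('n)) *\<^sub>R fourier \<psi> (\<xi> /\<^sub>R fst p)) * (g (snd p) *\<^sub>R cis (- (((1 - 1 / fst p) *\<^sub>R \<xi>) \<bullet> snd p))))
          \<le> norm ((LINT x|lborel. \<bar>\<psi> x\<bar>) * ((v (fst p) / fst p ^ CARD('n)) * g (snd p)))"
      proof (rule AE_I2)
        fix p :: "real \<times> (real, 'n) vec"
        have "norm (((v (fst p) / fst p ^ CARD('n)) *\<^sub>R fourier \<psi> (\<xi> /\<^sub>R fst p)) * (g (snd p) *\<^sub>R cis (- (((1 - 1 / fst p) *\<^sub>R \<xi>) \<bullet> snd p)))) =
            cmod (fourier \<psi> (\<xi> /\<^sub>R fst p)) * \<bar>(v (fst p) / fst p ^ CARD('n)) * g (snd p)\<bar>"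
          by (simp add: norm_mult abs_mult)
        also have "\<dots> \<le> (LINT x|lborel. \<bar>\<psi> x\<bar>) * \<bar>(v (fst p) / fst p ^ CARD('n)) * g (snd p)\<bar>"
          by (intro mult_right_mono norm_fourier_le) simp
        finally show "norm (((v (fst p) / fst p ^ CARD('n)) *\<^sub>R fourier \<psi> (\<xi> /\<^sub>R fst p)) * (g (snd p) *\<^sub>R cis (- (((1 - 1 / fst p) *\<^sub>R \<xi>) \<bullet> snd p))))
          \<le> norm ((LINT x|lborel. \<bar>\<psi> x\<bar>) * ((v (fst p) / fst p ^ CARD('n)) * g (snd p)))"
          by (simp add: abs_mult)
      qed
    qed
  qed simp
  also have "\<dots> = (LINT t|lborel. ((v t / t ^ CARD('n)) *\<^sub>R fourier \<psi> (\<xi> /\<^sub>R t)) * fourier g ((1 - 1 / t) *\<^sub>R \<xi>))"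
    by (simp only: integral_mult_right_zero fourier_def)
  finally show ?thesis by simp
qed

text \<open>This supplies the hypotheses of \<open>plancherel_lower\<close>. It asks for
  \<open>v\<close> itself to be integrable, as the truncated weights are.\<close>

lemma
  fixes \<psi> g :: "(real, 'n::finite) vec \<Rightarrow> real"
  assumes v: "integrable lborel v" and \<psi>: "continuous_on UNIV \<psi>" "\<And>x. \<bar>\<psi> x\<bar> \<le> M" and g: "integrable lborel g"
  shows continuous_on_bog_op: "continuous_on UNIV (bog_op v \<psi> g)"
    and bounded_bog_op: "\<exists>K. \<forall>x. \<bar>bog_op v \<psi> g x\<bar> \<le> K"
proof -
  have [measurable]: "v \<in> borel_measurable borel" "\<psi> \<in> borel_measurable borel" "g \<in> borel_measurable borel"
    using v g \<psi>(1) by (auto intro: borel_measurable_continuous_onI)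
  have M0: "M \<ge> 0" using \<psi>(2)[of 0] by linarith
  have i: "integrable lborel (\<lambda>p::real \<times> (real, 'n) vec. M * \<bar>v (fst p) * g (snd p)\<bar>)"
    by (intro integrable_mult_right integrable_abs integrable_lborel_mult_prod v g)
  have le: "norm (slice_integrand v \<psi> g x p) \<le> M * \<bar>v (fst p) * g (snd p)\<bar>" for x p
    using mult_right_mono[OF \<psi>(2)[of "snd p + fst p *\<^sub>R (x - snd p)"], of "\<bar>v (fst p) * g (snd p)\<bar>"]
    by (simp add: abs_mult mult_ac)
  show "\<exists>K. \<forall>x. \<bar>bog_op v \<psi> g x\<bar> \<le> K"
  proof (intro exI allI)
    fix x
    have "\<bar>bog_op v \<psi> g x\<bar> \<le> (LINT p|lborel. norm (slice_integrand v \<psi> g x p))"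
      unfolding bog_op_def by (rule order_trans[OF _ integral_norm_bound]) simp
    also have "\<dots> \<le> (LINT p|lborel. M * \<bar>v (fst p) * g (snd p)\<bar>)"
      by (rule integral_mono_AE'[OF i]) (use le M0 in auto)
    finally show "\<bar>bog_op v \<psi> g x\<bar> \<le> (LINT p|lborel. M * \<bar>v (fst p) * g (snd p)\<bar>)" .
  qed
  show "continuous_on UNIV (bog_op v \<psi> g)"
  proof (rule continuous_on_sequentiallyI)
    fix u and a :: "(real, 'n) vec" assume u: "u \<longlonglongrightarrow> a"
    show "(\<lambda>n. bog_op v \<psi> g (u n)) \<longlonglongrightarrow> bog_op v \<psi> g a"
      unfolding bog_op_def
    proof (rule integral_dominated_convergence[OF _ _ i])
      show "AE p in lborel. (\<lambda>n. v (fst p) * \<psi> (snd p + fst p *\<^sub>R (u n - snd p)) * g (snd p)) \<longlonglongrightarrow> v (fst p) * \<psi> (snd p + fst p *\<^sub>R (a - snd p)) * g (snd p)"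
      proof (rule AE_I2)
        fix p :: "real \<times> (real, 'n) vec"
        have "(\<lambda>n. snd p + fst p *\<^sub>R (u n - snd p)) \<longlonglongrightarrow> snd p + fst p *\<^sub>R (a - snd p)"
          by (intro tendsto_intros u)
        moreover have "isCont \<psi> (snd p + fst p *\<^sub>R (a - snd p))" using \<psi>(1) by (simp add: continuous_on_eq_continuous_at)
        ultimately have "(\<lambda>n. \<psi> (snd p + fst p *\<^sub>R (u n - snd p))) \<longlonglongrightarrow> \<psi> (snd p + fst p *\<^sub>R (a - snd p))"
          by (rule isCont_tendsto_compose[rotated])
        then show "(\<lambda>n. v (fst p) * \<psi> (snd p + fst p *\<^sub>R (u n - snd p)) * g (snd p)) \<longlonglongrightarrow> v (fst p) * \<psi> (snd p + fst p *\<^sub>R (a - snd p)) * g (snd p)"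
          by (intro tendsto_intros)
      qed
    qed (use le in auto)
  qed
qed


section \<open>Schur and Fourier bounds\<close>


abbreviation slice_mass ::
    "((real, 'n::finite) vec \<Rightarrow> real) \<Rightarrow> (real, 'n) vec set \<Rightarrow> real \<Rightarrow> (real, 'n) vec \<Rightarrow> ennreal" where
  "slice_mass \<phi> S t x \<equiv> (\<integral>\<^sup>+y. ennreal \<bar>\<phi> (y + t *\<^sub>R (x - y))\<bar> * indicator S y \<partial>lborel)"

text \<open>Schur's test in (t, y) jointly. Cauchy-Schwarz splits the integrand with a free factor
  \<open>\<mu>\<close> of t: one half is bounded uniformly in x through the y-slices, the other is
  integrated over x through the x-slices. The choice of \<open>\<mu>\<close> balances the
  two.\<close>

lemma bog_op_schur:
  fixes \<phi> g :: "(real, 'n::finite) vec \<Rightarrow> real" and \<beta> :: "real \<Rightarrow> ennreal"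
  assumes v: "weight v" and [measurable]: "\<mu> \<in> borel_measurable borel" and pos: "\<And>t. \<mu> t > (0::real)"
    and [measurable]: "\<phi> \<in> borel_measurable borel" "g \<in> borel_measurable borel" "S \<in> sets borel"
    and g0: "\<And>y. y \<notin> S \<Longrightarrow> g y = 0"
    and \<beta>: "\<And>x t. v t \<noteq> 0 \<Longrightarrow> slice_mass \<phi> S t x \<le> \<beta> t"
  shows "(\<integral>\<^sup>+x. ennreal ((bog_op v \<phi> g x)\<^sup>2) \<partial>lborel) \<le> (\<integral>\<^sup>+t. ennreal (v t * \<mu> t) * \<beta> t \<partial>lborel) *
     ((\<integral>\<^sup>+t. ennreal (v t / (\<mu> t * t ^ CARD('n))) \<partial>lborel) * (\<integral>\<^sup>+z. ennreal \<bar>\<phi> z\<bar> \<partial>lborel) * (\<integral>\<^sup>+y. ennreal ((g y)\<^sup>2) \<partial>lborel))"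
proof -
  note [measurable] = weight_D(1)[OF v]
  note v0 = weight_D(2)[OF v]
  \<comment> \<open>Since \<open>g\<close> vanishes off \<open>S\<close>, the indicator can be put
    into the half that no longer contains \<open>g\<close>; this is how the volume of
    \<open>S\<close> enters.\<close>
  let ?a = "\<lambda>x p. sqrt (v (fst p) * \<mu> (fst p) * \<bar>\<phi> (snd p + fst p *\<^sub>R (x - snd p))\<bar>) * indicat_real S (snd p)"
  let ?b = "\<lambda>x p. sqrt (v (fst p) / \<mu> (fst p) * \<bar>\<phi> (snd p + fst p *\<^sub>R (x - snd p))\<bar>) * \<bar>g (snd p)\<bar>"
  let ?I = "\<lambda>x. \<integral>\<^sup>+p. ennreal ((?b x p)\<^sup>2) \<partial>lborel"
  have a0: "?a x p \<ge> 0" "?b x p \<ge> 0" for x p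
    using pos[of "fst p"] v0[of "fst p"] by auto
  have ab: "ennreal (norm (slice_integrand v \<phi> g x p)) = ennreal (?a x p) * ennreal (?b x p)" for x p
  proof -
    have "?a x p * ?b x p = (sqrt (v (fst p) * \<mu> (fst p) * \<bar>\<phi> (snd p + fst p *\<^sub>R (x - snd p))\<bar>) * sqrt (v (fst p) / \<mu> (fst p) * \<bar>\<phi> (snd p + fst p *\<^sub>R (x - snd p))\<bar>)) * (\<bar>g (snd p)\<bar> * indicat_real S (snd p))"
      by (simp only: mult_ac)
    also have "sqrt (v (fst p) * \<mu> (fst p) * \<bar>\<phi> (snd p + fst p *\<^sub>R (x - snd p))\<bar>) * sqrt (v (fst p) / \<mu> (fst p) * \<bar>\<phi> (snd p + fst p *\<^sub>R (x - snd p))\<bar>)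
        = sqrt ((v (fst p) * \<bar>\<phi> (snd p + fst p *\<^sub>R (x - snd p))\<bar>)\<^sup>2)"
    proof -
      have "v (fst p) * \<mu> (fst p) * c * (v (fst p) / \<mu> (fst p) * c) = (v (fst p) * c)\<^sup>2" for c
        using pos[of "fst p"] by (simp add: power2_eq_square field_simps)
      then show ?thesis unfolding real_sqrt_mult[symmetric] by (simp only:)
    qed
    also have "\<dots> = v (fst p) * \<bar>\<phi> (snd p + fst p *\<^sub>R (x - snd p))\<bar>"
      using v0[of "fst p"] by simp
    also have "\<bar>g (snd p)\<bar> * indicat_real S (snd p) = \<bar>g (snd p)\<bar>"
      using g0[of "snd p"] by (cases "snd p \<in> S") auto
    finally have "?a x p * ?b x p = v (fst p) * \<bar>\<phi> (snd p + fst p *\<^sub>R (x - snd p))\<bar> * \<bar>g (snd p)\<bar>" .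
    moreover have "norm (slice_integrand v \<phi> g x p) = v (fst p) * \<bar>\<phi> (snd p + fst p *\<^sub>R (x - snd p))\<bar> * \<bar>g (snd p)\<bar>"
      using v0[of "fst p"] by (simp add: abs_mult)
    ultimately have "norm (slice_integrand v \<phi> g x p) = ?a x p * ?b x p"
      by (simp only:)
    then show ?thesis by (simp only: ennreal_mult[OF a0])
  qed
  have A: "(\<integral>\<^sup>+p. (ennreal (?a x p))\<^sup>2 \<partial>lborel) \<le> (\<integral>\<^sup>+t. ennreal (v t * \<mu> t) * \<beta> t \<partial>lborel)" for x
  proof -
    have "(ennreal (?a x p))\<^sup>2 = ennreal (v (fst p) * \<mu> (fst p)) * (ennreal \<bar>\<phi> (snd p + fst p *\<^sub>R (x - snd p))\<bar> * indicator S (snd p))" for p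
    proof -
      have "(ennreal (?a x p))\<^sup>2 = ennreal ((?a x p)\<^sup>2)" by (rule ennreal_power[OF a0(1)])
      also have "(?a x p)\<^sup>2 = (v (fst p) * \<mu> (fst p)) * (\<bar>\<phi> (snd p + fst p *\<^sub>R (x - snd p))\<bar> * indicat_real S (snd p))"
        using pos[of "fst p"] v0[of "fst p"] by (simp add: power_mult_distrib indicator_def)
      finally show ?thesis
        using pos[of "fst p"] v0[of "fst p"] by (simp add: ennreal_mult' ennreal_indicator)
    qed
    then have "(\<integral>\<^sup>+p. (ennreal (?a x p))\<^sup>2 \<partial>lborel) =
        (\<integral>\<^sup>+t. ennreal (v t * \<mu> t) * slice_mass \<phi> S t x \<partial>lborel)"
      by (simp only:) (subst nn_integral_lborel_fst, simp_all add: nn_integral_cmult)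
    also have "\<dots> \<le> (\<integral>\<^sup>+t. ennreal (v t * \<mu> t) * \<beta> t \<partial>lborel)"
    proof (rule nn_integral_mono)
      fix t
      show "ennreal (v t * \<mu> t) * slice_mass \<phi> S t x \<le> ennreal (v t * \<mu> t) * \<beta> t"
        by (cases "v t = 0") (auto intro!: mult_left_mono \<beta>)
    qed
    finally show ?thesis .
  qed
  have pw: "ennreal ((bog_op v \<phi> g x)\<^sup>2) \<le> (\<integral>\<^sup>+t. ennreal (v t * \<mu> t) * \<beta> t \<partial>lborel) * ?I x" for x
  proof -
    have "ennreal (norm (bog_op v \<phi> g x)) \<le> (\<integral>\<^sup>+p. ennreal (?a x p) * ennreal (?b x p) \<partial>lborel)"
    proof (cases "integrable lborel (\<lambda>p. slice_integrand v \<phi> g x p)")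
      case True
      then show ?thesis
        unfolding bog_op_def ab[symmetric] by (rule integral_norm_bound_ennreal)
    next
      \<comment> \<open>Without absolute convergence \<open>bog_op\<close> is 0 by default.\<close>
      case False
      then show ?thesis by (simp add: bog_op_def not_integrable_integral_eq)
    qed
    then have "(ennreal (norm (bog_op v \<phi> g x)))\<^sup>2 \<le> (\<integral>\<^sup>+p. ennreal (?a x p) * ennreal (?b x p) \<partial>lborel)\<^sup>2"
      by (rule power_mono) simp
    also have "\<dots> \<le> (\<integral>\<^sup>+p. (ennreal (?a x p))\<^sup>2 \<partial>lborel) * (\<integral>\<^sup>+p. (ennreal (?b x p))\<^sup>2 \<partial>lborel)"
      by (rule Cauchy_Schwarz_nn_integral) measurable
    also have "\<dots> \<le> (\<integral>\<^sup>+t. ennreal (v t * \<mu> t) * \<beta> t \<partial>lborel) * ?I x"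
      unfolding ennreal_power[OF a0(2)] by (rule mult_right_mono[OF A]) simp
    finally show ?thesis by (simp add: ennreal_power)
  qed
  have "(\<integral>\<^sup>+x. ennreal ((bog_op v \<phi> g x)\<^sup>2) \<partial>lborel) \<le> (\<integral>\<^sup>+x. (\<integral>\<^sup>+t. ennreal (v t * \<mu> t) * \<beta> t \<partial>lborel) * ?I x \<partial>lborel)"
    by (rule nn_integral_mono) (rule pw)
  also have "\<dots> = (\<integral>\<^sup>+t. ennreal (v t * \<mu> t) * \<beta> t \<partial>lborel) * (\<integral>\<^sup>+x. ?I x \<partial>lborel)"
    by (rule nn_integral_cmult) measurable
  also have "(\<integral>\<^sup>+x. ?I x \<partial>lborel) = (\<integral>\<^sup>+p. (\<integral>\<^sup>+x. ennreal ((?b x p)\<^sup>2) \<partial>lborel) \<partial>lborel)"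
  proof -
    have m: "(\<lambda>q::(real, 'n) vec \<times> real \<times> (real, 'n) vec. ennreal ((?b (fst q) (snd q))\<^sup>2)) \<in> borel_measurable borel"
      by measurable
    show ?thesis
      using nn_integral_lborel_fst[OF m] nn_integral_lborel_snd[OF m] by simp
  qed
  also have "\<dots> = (\<integral>\<^sup>+p. ennreal (v (fst p) / (\<mu> (fst p) * fst p ^ CARD('n))) * ennreal ((g (snd p))\<^sup>2) * (\<integral>\<^sup>+z. ennreal \<bar>\<phi> z\<bar> \<partial>lborel) \<partial>lborel)"
  proof (rule nn_integral_cong)
    fix p :: "real \<times> (real, 'n) vec"
    show "(\<integral>\<^sup>+x. ennreal ((?b x p)\<^sup>2) \<partial>lborel) = ennreal (v (fst p) / (\<mu> (fst p) * fst p ^ CARD('n))) * ennreal ((g (snd p))\<^sup>2) * (\<integral>\<^sup>+z. ennreal \<bar>\<phi> z\<bar> \<partial>lborel)"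
    proof (cases "v (fst p) = 0")
      case False
      then have t: "fst p > 0" using weight_D(3)[OF v] by fastforce
      have "ennreal ((?b x p)\<^sup>2) = ennreal (v (fst p) / \<mu> (fst p)) * ennreal ((g (snd p))\<^sup>2) * ennreal \<bar>\<phi> (snd p + fst p *\<^sub>R (x - snd p))\<bar>" for x
        using pos[of "fst p"] v0[of "fst p"]
        by (simp add: power_mult_distrib ennreal_mult[symmetric] mult_ac)
      then have "(\<integral>\<^sup>+x. ennreal ((?b x p)\<^sup>2) \<partial>lborel) = ennreal (v (fst p) / \<mu> (fst p)) * ennreal ((g (snd p))\<^sup>2) * (ennreal (1 / fst p ^ CARD('n)) * (\<integral>\<^sup>+z. ennreal \<bar>\<phi> z\<bar> \<partial>lborel))"
        by (simp only:) (subst nn_integral_cmult, simp_all add: nn_integral_slice_x[OF _ t, of "\<lambda>z. ennreal \<bar>\<phi> z\<bar>"])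
      also have "\<dots> = (ennreal (v (fst p) / \<mu> (fst p)) * ennreal (1 / fst p ^ CARD('n))) * ennreal ((g (snd p))\<^sup>2) * (\<integral>\<^sup>+z. ennreal \<bar>\<phi> z\<bar> \<partial>lborel)"
        by (simp only: mult_ac)
      also have "ennreal (v (fst p) / \<mu> (fst p)) * ennreal (1 / fst p ^ CARD('n)) = ennreal (v (fst p) / (\<mu> (fst p) * fst p ^ CARD('n)))"
        using t pos[of "fst p"] v0[of "fst p"] by (subst ennreal_mult[symmetric]) auto
      finally show ?thesis .
    qed simp
  qed
  also have "\<dots> = (\<integral>\<^sup>+t. ennreal (v t / (\<mu> t * t ^ CARD('n))) \<partial>lborel) * (\<integral>\<^sup>+y. ennreal ((g y)\<^sup>2) \<partial>lborel) * (\<integral>\<^sup>+z. ennreal \<bar>\<phi> z\<bar> \<partial>lborel)"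
    by (subst nn_integral_multc, simp, subst nn_integral_lborel_fst) (simp_all add: nn_integral_cmult nn_integral_multc)
  finally show ?thesis by (simp only: mult_ac)
qed

text \<open>The antiderivative is (A / rho) arctan (t / (rho r)). Its total increase does not depend
  on \<open>r\<close>, which will be |xi|: the bound is uniform in the frequency.\<close>

lemma nn_integral_arctan_kernel_le:
  fixes A \<rho> r :: real
  assumes "A \<ge> 0" "\<rho> > 0" "r \<ge> 0"
  shows "(\<integral>\<^sup>+t. ennreal (A * r / (t\<^sup>2 + \<rho>\<^sup>2 * r\<^sup>2)) * indicator {0..} t \<partial>lborel) \<le> ennreal (pi * A / (2 * \<rho>))"
proof (cases "r = 0")
  case False
  with assms have r: "\<rho> * r > 0" by simp
  have D: "DERIV (\<lambda>t. A / \<rho> * arctan (t / (\<rho> * r))) t :> A * r / (t\<^sup>2 + \<rho>\<^sup>2 * r\<^sup>2)" for t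
  proof -
    have p: "t\<^sup>2 + (\<rho> * r)\<^sup>2 > 0" using r by (intro add_nonneg_pos) auto
    have "DERIV (\<lambda>t. A / \<rho> * arctan (t / (\<rho> * r))) t :> A / \<rho> * (inverse (1 + (t / (\<rho> * r))\<^sup>2) * (1 / (\<rho> * r)))"
      using r assms False by (auto intro!: derivative_eq_intros simp: mult_ac)
    also have "inverse (1 + (t / (\<rho> * r))\<^sup>2) = (\<rho> * r)\<^sup>2 / (t\<^sup>2 + (\<rho> * r)\<^sup>2)"
    proof -
      have "1 + (t / (\<rho> * r))\<^sup>2 = (t\<^sup>2 + (\<rho> * r)\<^sup>2) / (\<rho> * r)\<^sup>2"
        using assms False by (simp add: power_divide add_divide_distrib)
      then show ?thesis by simp
    qed
    also have "A / \<rho> * ((\<rho> * r)\<^sup>2 / (t\<^sup>2 + (\<rho> * r)\<^sup>2) * (1 / (\<rho> * r))) = A * r / (t\<^sup>2 + (\<rho> * r)\<^sup>2)"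
      using r assms by (simp add: power2_eq_square)
    finally show ?thesis by (simp add: power_mult_distrib)
  qed
  have "((\<lambda>t. A / \<rho> * arctan (t / (\<rho> * r))) \<longlongrightarrow> A / \<rho> * (pi / 2)) at_top"
  proof (intro tendsto_mult tendsto_const filterlim_compose[OF tendsto_arctan_at_top])
    show "filterlim (\<lambda>t. t / (\<rho> * r)) at_top at_top"
      using filterlim_tendsto_pos_mult_at_top[OF tendsto_const[of "1 / (\<rho> * r)"] _ filterlim_ident] r by simp
  qed
  then have "(\<integral>\<^sup>+t. ennreal (A * r / (t\<^sup>2 + \<rho>\<^sup>2 * r\<^sup>2)) * indicator {0..} t \<partial>lborel) = ennreal (A / \<rho> * (pi / 2) - A / \<rho> * arctan (0 / (\<rho> * r)))"
    using assms D by (intro nn_integral_FTC_atLeast) auto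
  also have "\<dots> = ennreal (pi * A / (2 * \<rho>))" by (simp add: mult_ac)
  finally show ?thesis by simp
qed simp

text \<open>The kernel is 1/t times the bound A |zeta| / (1 + rho^2 |zeta|^2) at zeta = xi/t, the
  factor 1/t being the size of the weight. It is weighted here with the spectrum of \<open>g\<close>
  seen by the slice at t.\<close>

definition freq_slice :: "real \<Rightarrow> real \<Rightarrow> ((real, 'n::finite) vec \<Rightarrow> real) \<Rightarrow> real \<Rightarrow> ennreal" where
  "freq_slice A \<rho> g t = (\<integral>\<^sup>+\<xi>. ennreal (A * norm \<xi> / (t\<^sup>2 + \<rho>\<^sup>2 * (norm \<xi>)\<^sup>2)) * ennreal ((cmod (fourier g ((1 - 1 / t) *\<^sub>R \<xi>)))\<^sup>2) \<partial>lborel)"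

lemma freq_slice_measurable2:
  assumes [measurable]: "g \<in> borel_measurable borel"
  shows "(\<lambda>p::real \<times> (real, 'n::finite) vec. ennreal ((cmod (fourier g ((1 - 1 / fst p) *\<^sub>R snd p)))\<^sup>2)) \<in> borel_measurable borel"
proof -
  have "(\<lambda>p::real \<times> (real, 'n) vec. fourier g ((1 - 1 / fst p) *\<^sub>R snd p)) \<in> borel_measurable borel"
    by (rule measurable_compose[OF _ borel_measurable_fourier]) simp_all
  then show ?thesis by measurable
qed

text \<open>The kernel is written as a product of two square roots before Cauchy-Schwarz in t. One
  is used up by the arctan bound; the other stays with \<open>g\<close>, so that the result is an
  integral over the range of t. Its additivity in that range later makes the truncations a Cauchy
  sequence.\<close>

lemma bog_op_singular:
  fixes \<psi> g :: "(real, 'n::finite) vec \<Rightarrow> real" and A \<rho> :: real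
  assumes A: "A \<ge> 0" and \<rho>: "\<rho> > 0"
    and \<psi>: "continuous_on UNIV \<psi>" "\<And>x. norm x > r \<Longrightarrow> \<psi> x = 0"
      "\<And>\<zeta>. cmod (fourier \<psi> \<zeta>) \<le> A * norm \<zeta> / (1 + \<rho>\<^sup>2 * (norm \<zeta>)\<^sup>2)"
    and g: "integrable lborel g"
    and v: "weight v" "integrable lborel v" "integrable lborel (\<lambda>t. v t / t ^ CARD('n))" "\<And>t. v t \<noteq> 0 \<Longrightarrow> v t * t \<le> t ^ CARD('n)"
  shows "integrable lborel (\<lambda>x. (bog_op v \<psi> g x)\<^sup>2)"
    and "ennreal ((2 * pi) ^ CARD('n) * (LINT x|lborel. (bog_op v \<psi> g x)\<^sup>2)) \<le>
      ennreal (pi * A / (2 * \<rho>)) * (\<integral>\<^sup>+t. indicator {t. v t \<noteq> 0} t * freq_slice A \<rho> g t \<partial>lborel)"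
proof -
  note [measurable] = weight_D(1)[OF v(1)]
  have [measurable]: "\<psi> \<in> borel_measurable borel" "g \<in> borel_measurable borel"
    using g \<psi>(1) by (auto intro: borel_measurable_continuous_onI)
  have i\<psi>: "integrable lborel \<psi>" by (rule integrable_continuous_bounded_support(1)[OF \<psi>(1,2)])
  obtain M where M: "\<And>x. \<bar>\<psi> x\<bar> \<le> M" using integrable_continuous_bounded_support(2)[OF \<psi>(1,2)] by auto
  obtain K where K: "\<And>x. \<bar>bog_op v \<psi> g x\<bar> \<le> K" using bounded_bog_op[OF v(2) \<psi>(1) M g] by blast
  have ib: "integrable lborel (bog_op v \<psi> g)" by (rule integrable_bog_op[OF v(1,3) i\<psi> g])
  show "integrable lborel (\<lambda>x. (bog_op v \<psi> g x)\<^sup>2)" by (rule integrable_square_bounded[OF ib K])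
  let ?k = "\<lambda>t \<xi>::(real,'n) vec. A * norm \<xi> / (t\<^sup>2 + \<rho>\<^sup>2 * (norm \<xi>)\<^sup>2)"
  let ?f = "\<lambda>t \<xi>. cmod (fourier g ((1 - 1 / t) *\<^sub>R \<xi>))"
  have k0: "?k t \<xi> \<ge> 0" for t \<xi> using A by simp
  have pw: "ennreal ((cmod (fourier (bog_op v \<psi> g) \<xi>))\<^sup>2) \<le>
      ennreal (pi * A / (2 * \<rho>)) * (\<integral>\<^sup>+t. indicator {t. v t \<noteq> 0} t * (ennreal (?k t \<xi>) * ennreal ((?f t \<xi>)\<^sup>2)) \<partial>lborel)" for \<xi>
  proof -
    have fm: "(\<lambda>t. fourier g ((1 - 1 / t) *\<^sub>R \<xi>)) \<in> borel_measurable borel"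
      by (rule measurable_compose[OF _ borel_measurable_fourier]) simp_all
    note [measurable] = fm
    let ?h = "\<lambda>t. (v t / t ^ CARD('n)) *\<^sub>R (fourier \<psi> (\<xi> /\<^sub>R t) * fourier g ((1 - 1 / t) *\<^sub>R \<xi>))"
    let ?s = "\<lambda>t. sqrt (?k t \<xi>) * indicat_real {t. v t \<noteq> 0} t"
    have h: "norm (?h t) \<le> ?s t * (?s t * ?f t \<xi>)" for t
    proof (cases "v t = 0")
      case False
      then have t: "t \<ge> 1" using weight_D(3)[OF v(1)] by blast
      have n: "norm (\<xi> /\<^sub>R t) = norm \<xi> / t" using t by (simp add: divide_inverse)
      have "v t / t ^ CARD('n) \<le> 1 / t" using v(4)[OF False] t by (simp add: field_simps)
      then have "v t / t ^ CARD('n) * cmod (fourier \<psi> (\<xi> /\<^sub>R t)) \<le> 1 / t * (A * norm (\<xi> /\<^sub>R t) / (1 + \<rho>\<^sup>2 * (norm (\<xi> /\<^sub>R t))\<^sup>2))"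
        using \<psi>(3)[of "\<xi> /\<^sub>R t"] t by (intro mult_mono) auto
      also have "\<dots> = ?k t \<xi>"
      proof -
        have p: "1 + \<rho>\<^sup>2 * (norm \<xi> / t)\<^sup>2 = (t\<^sup>2 + \<rho>\<^sup>2 * (norm \<xi>)\<^sup>2) / t\<^sup>2"
          using t by (simp add: power_divide add_divide_distrib)
        show ?thesis unfolding n p using t by (simp add: power2_eq_square)
      qed
      finally have "(v t / t ^ CARD('n) * cmod (fourier \<psi> (\<xi> /\<^sub>R t))) * ?f t \<xi> \<le> ?k t \<xi> * ?f t \<xi>"
        by (rule mult_right_mono) simp
      moreover have "norm (?h t) = (v t / t ^ CARD('n) * cmod (fourier \<psi> (\<xi> /\<^sub>R t))) * ?f t \<xi>"
        using weight_D(2)[OF v(1), of t] t by (simp add: norm_mult)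
      ultimately have "norm (?h t) \<le> ?k t \<xi> * ?f t \<xi>" by (simp only:)
      also have "\<dots> = ?s t * (?s t * ?f t \<xi>)"
      proof -
        have "sqrt (?k t \<xi>) * sqrt (?k t \<xi>) = ?k t \<xi>"
          by (simp only: real_sqrt_mult_self abs_of_nonneg[OF k0])
        moreover have "?s t = sqrt (?k t \<xi>)" using False by simp
        ultimately show ?thesis by (simp only: mult.assoc[symmetric])
      qed
      finally show ?thesis .
    qed simp
    have s0: "?s t \<ge> 0" "?s t * ?f t \<xi> \<ge> 0" for t using k0[of \<xi> t] by auto
    have "ennreal (norm (fourier (bog_op v \<psi> g) \<xi>)) \<le> (\<integral>\<^sup>+t. ennreal (norm (?h t)) \<partial>lborel)"
      unfolding fourier_bog_op[OF v(1,3) i\<psi> g]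
    proof (cases "integrable lborel ?h")
      case True
      then show "ennreal (norm (LINT t|lborel. ?h t)) \<le> (\<integral>\<^sup>+t. ennreal (norm (?h t)) \<partial>lborel)"
        by (rule integral_norm_bound_ennreal)
    next
      case False
      then show "ennreal (norm (LINT t|lborel. ?h t)) \<le> (\<integral>\<^sup>+t. ennreal (norm (?h t)) \<partial>lborel)"
        unfolding not_integrable_integral_eq[OF False] by simp
    qed
    also have "\<dots> \<le> (\<integral>\<^sup>+t. ennreal (?s t) * ennreal (?s t * ?f t \<xi>) \<partial>lborel)"
      unfolding ennreal_mult[OF s0, symmetric] by (intro nn_integral_mono ennreal_leI h)
    finally have "(ennreal (norm (fourier (bog_op v \<psi> g) \<xi>)))\<^sup>2 \<le> (\<integral>\<^sup>+t. ennreal (?s t) * ennreal (?s t * ?f t \<xi>) \<partial>lborel)\<^sup>2"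
      by (rule power_mono) simp
    also have "\<dots> \<le> (\<integral>\<^sup>+t. (ennreal (?s t))\<^sup>2 \<partial>lborel) * (\<integral>\<^sup>+t. (ennreal (?s t * ?f t \<xi>))\<^sup>2 \<partial>lborel)"
      by (rule Cauchy_Schwarz_nn_integral) measurable
    also have "\<dots> \<le> ennreal (pi * A / (2 * \<rho>)) * (\<integral>\<^sup>+t. indicator {t. v t \<noteq> 0} t * (ennreal (?k t \<xi>) * ennreal ((?f t \<xi>)\<^sup>2)) \<partial>lborel)"
    proof (rule mult_mono)
      have "(ennreal (?s t))\<^sup>2 \<le> ennreal (A * norm \<xi> / (t\<^sup>2 + \<rho>\<^sup>2 * (norm \<xi>)\<^sup>2)) * indicator {0..} t" for t
      proof (cases "v t = 0")
        case False
        then have "t \<ge> 1" using weight_D(3)[OF v(1)] by blast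
        then show ?thesis using False k0[of \<xi> t] by (simp add: ennreal_power)
      qed simp
      then have "(\<integral>\<^sup>+t. (ennreal (?s t))\<^sup>2 \<partial>lborel) \<le> (\<integral>\<^sup>+t. ennreal (A * norm \<xi> / (t\<^sup>2 + \<rho>\<^sup>2 * (norm \<xi>)\<^sup>2)) * indicator {0..} t \<partial>lborel)"
        by (intro nn_integral_mono)
      also have "\<dots> \<le> ennreal (pi * A / (2 * \<rho>))"
        by (rule nn_integral_arctan_kernel_le[OF A \<rho>]) simp
      finally show "(\<integral>\<^sup>+t. (ennreal (?s t))\<^sup>2 \<partial>lborel) \<le> ennreal (pi * A / (2 * \<rho>))" .
      have "(ennreal (?s t * ?f t \<xi>))\<^sup>2 = indicator {t. v t \<noteq> 0} t * (ennreal (?k t \<xi>) * ennreal ((?f t \<xi>)\<^sup>2))" for t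
        unfolding ennreal_power[OF s0(2)] using k0[of \<xi> t]
        by (simp add: power_mult_distrib indicator_def ennreal_mult'[symmetric])
      then show "(\<integral>\<^sup>+t. (ennreal (?s t * ?f t \<xi>))\<^sup>2 \<partial>lborel) \<le> (\<integral>\<^sup>+t. indicator {t. v t \<noteq> 0} t * (ennreal (?k t \<xi>) * ennreal ((?f t \<xi>)\<^sup>2)) \<partial>lborel)"
        by simp
    qed auto
    finally show ?thesis by (simp add: ennreal_power)
  qed
  note [measurable] = freq_slice_measurable2[of g]
  have m: "(\<lambda>p::real \<times> (real,'n) vec. indicator {t. v t \<noteq> 0} (fst p) * (ennreal (?k (fst p) (snd p)) * ennreal ((?f (fst p) (snd p))\<^sup>2))) \<in> borel_measurable borel"
    by measurable
  have "ennreal ((2 * pi) ^ CARD('n) * (LINT x|lborel. (bog_op v \<psi> g x)\<^sup>2)) \<le> (\<integral>\<^sup>+\<xi>. ennreal ((cmod (fourier (bog_op v \<psi> g) \<xi>))\<^sup>2) \<partial>lborel)"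
    using plancherel_lower[OF ib continuous_on_bog_op[OF v(2) \<psi>(1) M g] K] by simp
  also have "\<dots> \<le> (\<integral>\<^sup>+\<xi>. ennreal (pi * A / (2 * \<rho>)) * (\<integral>\<^sup>+t. indicator {t. v t \<noteq> 0} t * (ennreal (?k t \<xi>) * ennreal ((?f t \<xi>)\<^sup>2)) \<partial>lborel) \<partial>lborel)"
    by (rule nn_integral_mono) (rule pw)
  also have "\<dots> = ennreal (pi * A / (2 * \<rho>)) * (\<integral>\<^sup>+\<xi>. (\<integral>\<^sup>+t. indicator {t. v t \<noteq> 0} t * (ennreal (?k t \<xi>) * ennreal ((?f t \<xi>)\<^sup>2)) \<partial>lborel) \<partial>lborel)"
    using borel_measurable_nn_integral_lborel_snd[OF m] by (intro nn_integral_cmult) simp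
  also have "(\<integral>\<^sup>+\<xi>. (\<integral>\<^sup>+t. indicator {t. v t \<noteq> 0} t * (ennreal (?k t \<xi>) * ennreal ((?f t \<xi>)\<^sup>2)) \<partial>lborel) \<partial>lborel) =
      (\<integral>\<^sup>+t. (\<integral>\<^sup>+\<xi>. indicator {t. v t \<noteq> 0} t * (ennreal (?k t \<xi>) * ennreal ((?f t \<xi>)\<^sup>2)) \<partial>lborel) \<partial>lborel)"
    using nn_integral_lborel_fst[OF m] nn_integral_lborel_snd[OF m] by simp
  also have "\<dots> = (\<integral>\<^sup>+t. indicator {t. v t \<noteq> 0} t * freq_slice A \<rho> g t \<partial>lborel)"
    unfolding freq_slice_def by (intro nn_integral_cong) (auto simp: indicator_def)
  finally show "ennreal ((2 * pi) ^ CARD('n) * (LINT x|lborel. (bog_op v \<psi> g x)\<^sup>2)) \<le>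
      ennreal (pi * A / (2 * \<rho>)) * (\<integral>\<^sup>+t. indicator {t. v t \<noteq> 0} t * freq_slice A \<rho> g t \<partial>lborel)" .
qed

lemma borel_measurable_freq_slice [measurable]:
  assumes [measurable]: "g \<in> borel_measurable borel"
  shows "freq_slice A \<rho> g \<in> borel_measurable borel"
proof -
  note [measurable] = freq_slice_measurable2[of g]
  have m: "(\<lambda>p::real \<times> (real,'a) vec. ennreal (A * norm (snd p) / ((fst p)\<^sup>2 + \<rho>\<^sup>2 * (norm (snd p))\<^sup>2)) *
      ennreal ((cmod (fourier g ((1 - 1 / fst p) *\<^sub>R snd p)))\<^sup>2)) \<in> borel_measurable borel"
    by measurable
  show ?thesis using borel_measurable_nn_integral_lborel_fst[OF m] by (simp add: freq_slice_def[abs_def])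
qed

text \<open>The dilation by s = t / (t - 1) undoes the factor 1 - 1/t. For t >= 2 one has 1 <= s <=
  2, so the Jacobian costs at most 2^n, and since t = s (t - 1) the dilated kernel is 1/s times the
  kernel at t - 1. After a shift in t the arctan bound applies.\<close>

lemma nn_integral_freq_slice_le:
  fixes g :: "(real, 'n::finite) vec \<Rightarrow> real"
  assumes A: "A \<ge> 0" and \<rho>: "\<rho> > 0" and [measurable]: "g \<in> borel_measurable borel"
  shows "(\<integral>\<^sup>+t. freq_slice A \<rho> g t * indicator {2..} t \<partial>lborel) \<le>
    ennreal (2 ^ CARD('n) * (pi * A / (2 * \<rho>))) * (\<integral>\<^sup>+\<xi>. ennreal ((cmod (fourier g \<xi>))\<^sup>2) \<partial>lborel)"
proof -
  let ?F = "\<lambda>\<xi>. ennreal ((cmod (fourier g \<xi>))\<^sup>2)"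
  let ?k = "\<lambda>t \<xi>::(real,'n) vec. ennreal (A * norm \<xi> / (t\<^sup>2 + \<rho>\<^sup>2 * (norm \<xi>)\<^sup>2))"
  have H: "freq_slice A \<rho> g t * indicator {2..} t \<le> (\<integral>\<^sup>+\<xi>. ennreal (2 ^ CARD('n)) * (?k (t - 1) \<xi> * indicator {0..} (t - 1) * ?F \<xi>) \<partial>lborel)" for t
  proof (cases "t \<ge> 2")
    case True
    define s where "s = t / (t - 1)"
    have s: "1 \<le> s" "s \<le> 2" "t = s * (t - 1)" "(1 - 1 / t) * s = 1" using True by (auto simp: s_def field_simps)
    have fm: "(\<lambda>\<xi>. fourier g ((1 - 1 / t) *\<^sub>R \<xi>)) \<in> borel_measurable borel"
      by (rule measurable_compose[OF _ borel_measurable_fourier]) simp_all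
    note [measurable] = fm
    have "freq_slice A \<rho> g t = ennreal (s ^ CARD('n)) * (\<integral>\<^sup>+\<xi>. ?k t (s *\<^sub>R \<xi>) * ?F \<xi> \<partial>lborel)"
      using nn_integral_lborel_affine[of "\<lambda>\<xi>. ?k t \<xi> * ?F ((1 - 1 / t) *\<^sub>R \<xi>)" s 0] s
      by (simp add: freq_slice_def)
    also have "\<dots> \<le> ennreal (2 ^ CARD('n)) * (\<integral>\<^sup>+\<xi>. ?k (t - 1) \<xi> * ?F \<xi> \<partial>lborel)"
    proof (intro mult_mono nn_integral_mono ennreal_leI power_mono)
      fix \<xi> :: "(real,'n) vec"
      have d: "(t - 1)\<^sup>2 + \<rho>\<^sup>2 * (norm \<xi>)\<^sup>2 > 0" using True by (intro add_pos_nonneg) auto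
      have "t\<^sup>2 = s\<^sup>2 * (t - 1)\<^sup>2" using s(3) by (metis power_mult_distrib)
      then have "A * norm (s *\<^sub>R \<xi>) / (t\<^sup>2 + \<rho>\<^sup>2 * (norm (s *\<^sub>R \<xi>))\<^sup>2) = A * s * norm \<xi> / (s\<^sup>2 * ((t - 1)\<^sup>2 + \<rho>\<^sup>2 * (norm \<xi>)\<^sup>2))"
        using s by (simp add: power_mult_distrib algebra_simps)
      also have "\<dots> = (A * norm \<xi> / ((t - 1)\<^sup>2 + \<rho>\<^sup>2 * (norm \<xi>)\<^sup>2)) / s"
        using s d by (simp add: power2_eq_square)
      also have "\<dots> \<le> A * norm \<xi> / ((t - 1)\<^sup>2 + \<rho>\<^sup>2 * (norm \<xi>)\<^sup>2)"
        using s A d by (intro divide_le_eq_1[THEN iffD2] order_trans[OF divide_left_mono[of 1 s]]) auto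
      finally show "A * norm (s *\<^sub>R \<xi>) / (t\<^sup>2 + \<rho>\<^sup>2 * (norm (s *\<^sub>R \<xi>))\<^sup>2) \<le> A * norm \<xi> / ((t - 1)\<^sup>2 + \<rho>\<^sup>2 * (norm \<xi>)\<^sup>2)" .
    qed (use s in auto)
    also have "\<dots> = (\<integral>\<^sup>+\<xi>. ennreal (2 ^ CARD('n)) * (?k (t - 1) \<xi> * indicator {0..} (t - 1) * ?F \<xi>) \<partial>lborel)"
      using True by (subst nn_integral_cmult[symmetric]) auto
    finally show ?thesis using True by simp
  qed simp
  have m: "(\<lambda>p::real \<times> (real,'n) vec. ennreal (2 ^ CARD('n)) * (?k (fst p - 1) (snd p) * indicator {0..} (fst p - 1) * ?F (snd p))) \<in> borel_measurable borel"
    by measurable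
  have "(\<integral>\<^sup>+t. freq_slice A \<rho> g t * indicator {2..} t \<partial>lborel) \<le>
      (\<integral>\<^sup>+t. \<integral>\<^sup>+\<xi>. ennreal (2 ^ CARD('n)) * (?k (t - 1) \<xi> * indicator {0..} (t - 1) * ?F \<xi>) \<partial>lborel \<partial>lborel)"
    by (intro nn_integral_mono H)
  also have "\<dots> = (\<integral>\<^sup>+\<xi>. \<integral>\<^sup>+t. ennreal (2 ^ CARD('n)) * (?k (t - 1) \<xi> * indicator {0..} (t - 1) * ?F \<xi>) \<partial>lborel \<partial>lborel)"
    using nn_integral_lborel_fst[OF m] nn_integral_lborel_snd[OF m] by simp
  also have "\<dots> \<le> (\<integral>\<^sup>+\<xi>. ennreal (2 ^ CARD('n) * (pi * A / (2 * \<rho>))) * ?F \<xi> \<partial>lborel)"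
  proof (rule nn_integral_mono)
    fix \<xi> :: "(real,'n) vec"
    have "(\<integral>\<^sup>+t. ?k (t - 1) \<xi> * indicator {0..} (t - 1) \<partial>lborel) = (\<integral>\<^sup>+t. ?k t \<xi> * indicator {0..} t \<partial>lborel)"
      using nn_integral_lborel_affine[of "\<lambda>t. ?k t \<xi> * indicator {0..} t" 1 "-1"] by (simp add: algebra_simps)
    also have "\<dots> \<le> ennreal (pi * A / (2 * \<rho>))"
      by (rule nn_integral_arctan_kernel_le[OF A \<rho>]) simp
    finally have "ennreal (2 ^ CARD('n)) * ((\<integral>\<^sup>+t. ?k (t - 1) \<xi> * indicator {0..} (t - 1) \<partial>lborel) * ?F \<xi>) \<le> ennreal (2 ^ CARD('n)) * (ennreal (pi * A / (2 * \<rho>)) * ?F \<xi>)"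
      by (intro mult_left_mono mult_right_mono) auto
    moreover have "(\<integral>\<^sup>+t. ennreal (2 ^ CARD('n)) * (?k (t - 1) \<xi> * indicator {0..} (t - 1) * ?F \<xi>) \<partial>lborel) = ennreal (2 ^ CARD('n)) * ((\<integral>\<^sup>+t. ?k (t - 1) \<xi> * indicator {0..} (t - 1) \<partial>lborel) * ?F \<xi>)"
      by (subst nn_integral_cmult, measurable, subst nn_integral_multc) measurable
    moreover have "ennreal (2 ^ CARD('n) * (pi * A / (2 * \<rho>))) = ennreal (2 ^ CARD('n)) * ennreal (pi * A / (2 * \<rho>))"
      using A \<rho> by (intro ennreal_mult) auto
    ultimately show "(\<integral>\<^sup>+t. ennreal (2 ^ CARD('n)) * (?k (t - 1) \<xi> * indicator {0..} (t - 1) * ?F \<xi>) \<partial>lborel) \<le> ennreal (2 ^ CARD('n) * (pi * A / (2 * \<rho>))) * ?F \<xi>"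
      by (simp only: mult.assoc)
  qed
  also have "\<dots> = ennreal (2 ^ CARD('n) * (pi * A / (2 * \<rho>))) * (\<integral>\<^sup>+\<xi>. ?F \<xi> \<partial>lborel)"
    by (rule nn_integral_cmult) simp
  finally show ?thesis .
qed



section \<open>Cauchy-Schwarz, sums and completeness in L^2\<close>

lemma
  fixes a b :: "'a \<Rightarrow> real"
  assumes m [measurable]: "a \<in> borel_measurable M" "b \<in> borel_measurable M"
    and i: "integrable M (\<lambda>x. (a x)\<^sup>2)" "integrable M (\<lambda>x. (b x)\<^sup>2)"
  shows integrable_mult_L2: "integrable M (\<lambda>x. a x * b x)"
    and Cauchy_Schwarz_integral: "(LINT x|M. \<bar>a x * b x\<bar>)\<^sup>2 \<le> (LINT x|M. (a x)\<^sup>2) * (LINT x|M. (b x)\<^sup>2)"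
proof -
  have "(\<integral>\<^sup>+x. ennreal \<bar>a x\<bar> * ennreal \<bar>b x\<bar> \<partial>M)\<^sup>2 \<le> (\<integral>\<^sup>+x. (ennreal \<bar>a x\<bar>)\<^sup>2 \<partial>M) * (\<integral>\<^sup>+x. (ennreal \<bar>b x\<bar>)\<^sup>2 \<partial>M)"
    by (rule Cauchy_Schwarz_nn_integral) measurable
  also have "\<dots> = ennreal (LINT x|M. (a x)\<^sup>2) * ennreal (LINT x|M. (b x)\<^sup>2)"
    using i by (simp add: ennreal_power nn_integral_eq_integral)
  finally have cs: "(\<integral>\<^sup>+x. ennreal \<bar>a x * b x\<bar> \<partial>M)\<^sup>2 \<le> ennreal ((LINT x|M. (a x)\<^sup>2) * (LINT x|M. (b x)\<^sup>2))"
    by (simp add: abs_mult ennreal_mult)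
  then have "(\<integral>\<^sup>+x. ennreal \<bar>a x * b x\<bar> \<partial>M)\<^sup>2 < \<infinity>"
    by (rule order.strict_trans1) simp
  then have "(\<integral>\<^sup>+x. ennreal \<bar>a x * b x\<bar> \<partial>M) < \<infinity>"
    by (simp add: power_less_top_ennreal)
  then show int: "integrable M (\<lambda>x. a x * b x)"
    by (intro integrableI_bounded) auto
  then have "(\<integral>\<^sup>+x. ennreal \<bar>a x * b x\<bar> \<partial>M) = ennreal (LINT x|M. \<bar>a x * b x\<bar>)"
    by (intro nn_integral_eq_integral) auto
  with cs show "(LINT x|M. \<bar>a x * b x\<bar>)\<^sup>2 \<le> (LINT x|M. (a x)\<^sup>2) * (LINT x|M. (b x)\<^sup>2)"
    by (simp add: ennreal_power)
qed

lemma integrable_power2_add: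
  fixes a b :: "'a \<Rightarrow> real"
  assumes [measurable]: "a \<in> borel_measurable M" "b \<in> borel_measurable M"
    and i: "integrable M (\<lambda>x. (a x)\<^sup>2)" "integrable M (\<lambda>x. (b x)\<^sup>2)"
  shows "integrable M (\<lambda>x. (a x + b x)\<^sup>2)" "integrable M (\<lambda>x. (a x - b x)\<^sup>2)"
    and "(LINT x|M. (a x + b x)\<^sup>2) \<le> 2 * (LINT x|M. (a x)\<^sup>2) + 2 * (LINT x|M. (b x)\<^sup>2)"
proof -
  have ab: "integrable M (\<lambda>x. 2 * a x * b x)"
    using integrable_mult_right[OF integrable_mult_L2[OF assms], of 2] by (simp add: mult.assoc)
  show 1: "integrable M (\<lambda>x. (a x + b x)\<^sup>2)" "integrable M (\<lambda>x. (a x - b x)\<^sup>2)"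
    unfolding power2_sum power2_diff using i ab by auto
  have "(LINT x|M. (a x + b x)\<^sup>2) \<le> (LINT x|M. 2 * (a x)\<^sup>2 + 2 * (b x)\<^sup>2)"
  proof (rule integral_mono[OF 1(1)])
    show "integrable M (\<lambda>x. 2 * (a x)\<^sup>2 + 2 * (b x)\<^sup>2)" using i by simp
    show "(a x + b x)\<^sup>2 \<le> 2 * (a x)\<^sup>2 + 2 * (b x)\<^sup>2" for x
      using sum_squares_bound[of "a x" "b x"] by (simp add: power2_sum)
  qed
  then show "(LINT x|M. (a x + b x)\<^sup>2) \<le> 2 * (LINT x|M. (a x)\<^sup>2) + 2 * (LINT x|M. (b x)\<^sup>2)"
    using i by simp
qed

text \<open>\<open>c1\<close> gives a subsequence converging almost everywhere, which defines the
  limit; Fatou's lemma carries the L^2 estimates over to it, and \<open>c2\<close> turns them into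
  convergence of the whole sequence.\<close>

lemma L2_complete:
  fixes f :: "nat \<Rightarrow> 'a \<Rightarrow> real"
  assumes i1: "\<And>n. integrable M (f n)" and i2: "\<And>n. integrable M (\<lambda>x. (f n x)\<^sup>2)"
    and c1: "\<And>e. e > 0 \<Longrightarrow> \<exists>N. \<forall>i\<ge>N. \<forall>j\<ge>N. (LINT x|M. norm (f i x - f j x)) < e"
    and c2: "\<And>e. e > 0 \<Longrightarrow> \<exists>N. \<forall>i\<ge>N. \<forall>j\<ge>N. (LINT x|M. (f i x - f j x)\<^sup>2) \<le> e"
    and B: "\<And>n. (LINT x|M. (f n x)\<^sup>2) \<le> B"
  obtains h where "h \<in> borel_measurable M" "integrable M (\<lambda>x. (h x)\<^sup>2)" "(LINT x|M. (h x)\<^sup>2) \<le> B"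
    "(\<lambda>n. LINT x|M. (h x - f n x)\<^sup>2) \<longlonglongrightarrow> 0"
proof -
  have [measurable]: "f n \<in> borel_measurable M" for n using i1 by auto
  obtain r where r: "strict_mono r" and C: "AE x in M. Cauchy (\<lambda>i. f (r i) x)"
    using cauchy_L1_AE_cauchy_subseq[of M f] i1 c1 by blast
  define h where "h x = lim (\<lambda>i. f (r i) x)" for x
  have hm [measurable]: "h \<in> borel_measurable M" unfolding h_def[abs_def] by (rule borel_measurable_lim_metric) measurable
  have lim: "AE x in M. (\<lambda>i. f (r i) x) \<longlonglongrightarrow> h x"
    using C by eventually_elim (simp add: h_def Cauchy_convergent convergent_LIMSEQ_iff[symmetric])
  \<comment> \<open>Used twice: with u = 0 for the norm of the limit, and with u a member of the
    sequence for the convergence.\<close>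
  have fatou: "(\<integral>\<^sup>+x. ennreal ((h x - u x)\<^sup>2) \<partial>M) \<le> ennreal e"
    if u [measurable]: "u \<in> borel_measurable M" "integrable M (\<lambda>x. (u x)\<^sup>2)"
      and le: "\<forall>\<^sub>F i in sequentially. (LINT x|M. (f (r i) x - u x)\<^sup>2) \<le> e" for u e
  proof -
    have "(\<integral>\<^sup>+x. ennreal ((h x - u x)\<^sup>2) \<partial>M) = (\<integral>\<^sup>+x. liminf (\<lambda>i. ennreal ((f (r i) x - u x)\<^sup>2)) \<partial>M)"
    proof (rule nn_integral_cong_AE)
      show "AE x in M. ennreal ((h x - u x)\<^sup>2) = liminf (\<lambda>i. ennreal ((f (r i) x - u x)\<^sup>2))"
        using lim
      proof eventually_elim
        case (elim x)
        then have "(\<lambda>i. ennreal ((f (r i) x - u x)\<^sup>2)) \<longlonglongrightarrow> ennreal ((h x - u x)\<^sup>2)"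
          by (intro tendsto_ennrealI tendsto_intros)
        then show ?case by (rule lim_imp_Liminf[OF sequentially_bot, symmetric])
      qed
    qed
    also have "\<dots> \<le> liminf (\<lambda>i. \<integral>\<^sup>+x. ennreal ((f (r i) x - u x)\<^sup>2) \<partial>M)"
      by (rule nn_integral_liminf) measurable
    also have "\<dots> \<le> liminf (\<lambda>i::nat. ennreal e)"
    proof (rule Liminf_mono)
      show "\<forall>\<^sub>F i in sequentially. (\<integral>\<^sup>+x. ennreal ((f (r i) x - u x)\<^sup>2) \<partial>M) \<le> ennreal e"
        using le
      proof eventually_elim
        case (elim i)
        have "(\<integral>\<^sup>+x. ennreal ((f (r i) x - u x)\<^sup>2) \<partial>M) = ennreal (LINT x|M. (f (r i) x - u x)\<^sup>2)"
          by (intro nn_integral_eq_integral integrable_power2_add i2 u) auto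
        then show ?case using elim by (simp add: ennreal_leI)
      qed
    qed
    finally show ?thesis by (simp add: Liminf_const)
  qed
  have h2: "(\<integral>\<^sup>+x. ennreal ((h x)\<^sup>2) \<partial>M) \<le> ennreal B"
    using fatou[of "\<lambda>_. 0" B] B by simp
  have B0: "B \<ge> 0" using B[of 0] by (intro order_trans[OF integral_nonneg_AE]) auto
  have ih: "integrable M (\<lambda>x. (h x)\<^sup>2)"
    using h2 by (intro integrableI_bounded) (auto simp: order.strict_trans1)
  have "ennreal (LINT x|M. (h x)\<^sup>2) \<le> ennreal B"
    using h2 nn_integral_eq_integral[OF ih] by simp
  then have hB: "(LINT x|M. (h x)\<^sup>2) \<le> B" using B0 by (simp add: ennreal_le_iff)
  have "(\<lambda>n. LINT x|M. (h x - f n x)\<^sup>2) \<longlonglongrightarrow> 0"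
  proof (rule LIMSEQ_I)
    fix e :: real assume e: "e > 0"
    obtain N where N: "\<forall>i\<ge>N. \<forall>j\<ge>N. (LINT x|M. (f i x - f j x)\<^sup>2) \<le> e / 2" using c2[of "e/2"] e by auto
    have "norm ((LINT x|M. (h x - f n x)\<^sup>2) - 0) < e" if n: "n \<ge> N" for n
    proof -
      have "\<forall>\<^sub>F i in sequentially. (LINT x|M. (f (r i) x - f n x)\<^sup>2) \<le> e / 2"
      proof (rule eventually_sequentiallyI)
        fix i assume "N \<le> i"
        then have "N \<le> r i" using seq_suble[OF r, of i] by linarith
        then show "(LINT x|M. (f (r i) x - f n x)\<^sup>2) \<le> e / 2" using N n by blast
      qed
      from fatou[OF _ i2 this] have "(\<integral>\<^sup>+x. ennreal ((h x - f n x)\<^sup>2) \<partial>M) \<le> ennreal (e / 2)" by simp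
      moreover have "integrable M (\<lambda>x. (h x - f n x)\<^sup>2)"
        by (intro integrable_power2_add ih i2) auto
      ultimately have "ennreal (LINT x|M. (h x - f n x)\<^sup>2) \<le> ennreal (e / 2)"
        by (simp add: nn_integral_eq_integral)
      then have "(LINT x|M. (h x - f n x)\<^sup>2) \<le> e / 2" using e by (simp add: ennreal_le_iff)
      moreover have "(LINT x|M. (h x - f n x)\<^sup>2) \<ge> 0" by (rule Bochner_Integration.integral_nonneg) simp
      ultimately show ?thesis unfolding real_norm_def diff_zero using e by linarith
    qed
    then show "\<exists>N. \<forall>n\<ge>N. norm ((LINT x|M. (h x - f n x)\<^sup>2) - 0) < e" by blast
  qed
  with hm ih hB show thesis by (rule that)
qed

text \<open>The weight of the kernel divided by t, because the moment identity consumes t together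
  with x - y. Differentiating in x puts the factor t back.\<close>

definition bog_weight :: "nat \<Rightarrow> nat \<Rightarrow> real \<Rightarrow> real" where
  "bog_weight n l t = indicator {1..} t * ((t - 1) ^ (n - l) * t ^ (l - 1)) / t"

lemma weight_bog_weight: "weight (bog_weight n l)"
proof -
  have "bog_weight n l \<in> borel_measurable borel" unfolding bog_weight_def[abs_def] by measurable
  then show ?thesis by (auto simp: weight_def bog_weight_def indicator_def)
qed

lemma weight_mult_indicator: "weight v \<Longrightarrow> S \<in> sets borel \<Longrightarrow> weight (\<lambda>t. indicator S t * v t)"
  by (auto simp: weight_def)

lemma weight_mult_id:
  assumes "weight v"
  shows "weight (\<lambda>t. t * v t)"
proof -
  note [measurable] = weight_D(1)[OF assms]
  have "t * v t \<ge> 0" for t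
    using weight_D(2,3)[OF assms, of t] by (cases "v t = 0") auto
  moreover have "(\<lambda>t. t * v t) \<in> borel_measurable borel" by measurable
  ultimately show ?thesis using assms by (auto simp: weight_def)
qed

text \<open>For t >= 1 this says that the weight over t^n is at most t^(-2), hence integrable, while
  the differentiated weight over t^n is bounded only by the borderline 1/t. The absolute value
  serves t < 1, where the left side is 0.\<close>

lemma bog_weight_bound:
  assumes l: "1 \<le> l" "l \<le> n"
  shows "t * bog_weight n l t * t \<le> \<bar>t\<bar> ^ n" and "t * bog_weight n l t * t \<ge> 0"
proof -
  have "t * bog_weight n l t * t \<le> \<bar>t\<bar> ^ n \<and> t * bog_weight n l t * t \<ge> 0"
  proof (cases "t \<ge> 1")
    case True
    have "t * bog_weight n l t * t = (t - 1) ^ (n - l) * t ^ l"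
      using True l by (simp add: bog_weight_def power_eq_if[of t l])
    also have "\<dots> \<le> t ^ (n - l) * t ^ l"
      using True by (intro mult_right_mono power_mono) auto
    also have "\<dots> = t ^ n" using l by (simp flip: power_add)
    finally have "t * bog_weight n l t * t \<le> t ^ n" .
    then show ?thesis using True by (auto simp: bog_weight_def)
  qed (auto simp: bog_weight_def)
  then show "t * bog_weight n l t * t \<le> \<bar>t\<bar> ^ n" "t * bog_weight n l t * t \<ge> 0" by auto
qed

lemma integrable_inverse_square: "integrable lborel (\<lambda>t::real. indicator {1..} t * (1 / t\<^sup>2))"
proof (rule integrableI_nonneg)
  have "((\<lambda>t::real. - 1 / t) \<longlongrightarrow> 0) at_top" by real_asymp
  then have "(\<integral>\<^sup>+t. ennreal (1 / t\<^sup>2) * indicator {1..} t \<partial>lborel) = ennreal (0 - (- 1 / (1::real)))"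
    by (intro nn_integral_FTC_atLeast) (auto intro!: derivative_eq_intros simp: power2_eq_square)
  moreover have "(\<integral>\<^sup>+t. ennreal (indicator {1..} t * (1 / t\<^sup>2)) \<partial>lborel) = (\<integral>\<^sup>+t. ennreal (1 / t\<^sup>2) * indicator {1..} t \<partial>lborel)"
    by (intro nn_integral_cong) (auto simp: indicator_def)
  ultimately show "(\<integral>\<^sup>+t. ennreal (indicator {1..} t * (1 / t\<^sup>2)) \<partial>lborel) < \<infinity>" by simp
qed auto

lemma integrable_bog_weight:
  assumes l: "1 \<le> l" "l \<le> n"
  shows "integrable lborel (\<lambda>t. bog_weight n l t / t ^ n)"
proof (rule Bochner_Integration.integrable_bound[OF integrable_inverse_square])
  note [measurable] = weight_D(1)[OF weight_bog_weight[of n l]]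
  show "(\<lambda>t. bog_weight n l t / t ^ n) \<in> borel_measurable lborel" by measurable
  have "norm (bog_weight n l t / t ^ n) \<le> norm (indicator {1..} t * (1 / t\<^sup>2))" for t
  proof (cases "t \<ge> 1")
    case True
    then have "bog_weight n l t * t\<^sup>2 \<le> t ^ n" using bog_weight_bound(1)[OF l, of t] by (simp add: power2_eq_square mult_ac)
    then have "bog_weight n l t / t ^ n \<le> 1 / t\<^sup>2" using True by (simp add: field_simps)
    then show ?thesis using True weight_D(2)[OF weight_bog_weight, of n l t] by simp
  qed (simp add: bog_weight_def)
  then show "AE t in lborel. norm (bog_weight n l t / t ^ n) \<le> norm (indicator {1..} t * (1 / t\<^sup>2))" by simp
qed

lemma
  assumes l: "1 \<le> l" "l \<le> n"
  shows integrable_bog_weight_cut: "integrable lborel (\<lambda>t. indicator {a..<b} t * (t * bog_weight n l t))"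
    and integrable_bog_weight_cut_div: "integrable lborel (\<lambda>t. indicator {a..<b} t * (t * bog_weight n l t) / t ^ n)"
proof -
  note [measurable] = weight_D(1)[OF weight_bog_weight[of n l]]
  have i: "integrable lborel (\<lambda>t. c * indicat_real {a..<b} t)" for c
  proof -
    have "emeasure lborel {a..<b} < \<infinity>"
      by (cases "a \<le> b") auto
    then show ?thesis by (intro integrable_mult_right integrable_real_indicator) simp_all
  qed
  have key: "0 \<le> t * bog_weight n l t \<and> t * bog_weight n l t \<le> t ^ n" if "t \<ge> 1" for t
  proof -
    have p: "t * bog_weight n l t \<ge> 0" using that weight_D(2)[OF weight_bog_weight, of n l t] by simp
    have "t * bog_weight n l t * 1 \<le> t * bog_weight n l t * t" by (rule mult_left_mono[OF that p])
    moreover have a: "\<bar>t\<bar> ^ n = t ^ n" using that by simp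
    ultimately show ?thesis using p bog_weight_bound(1)[OF l, of t] unfolding a mult_1_right by (intro conjI; linarith)
  qed
  show "integrable lborel (\<lambda>t. indicator {a..<b} t * (t * bog_weight n l t))"
  proof (rule Bochner_Integration.integrable_bound[OF i[of "\<bar>b\<bar> ^ n"]])
    have "norm (indicator {a..<b} t * (t * bog_weight n l t)) \<le> norm (\<bar>b\<bar> ^ n * indicat_real {a..<b} t)" for t
    proof (cases "t \<ge> 1 \<and> t < b \<and> a \<le> t")
      case True
      then have "t ^ n \<le> \<bar>b\<bar> ^ n" by (intro power_mono) auto
      then show ?thesis using key[of t] True by simp
    qed (auto simp: bog_weight_def indicator_def)
    then show "AE t in lborel. norm (indicator {a..<b} t * (t * bog_weight n l t)) \<le> norm (\<bar>b\<bar> ^ n * indicat_real {a..<b} t)" by (rule AE_I2)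
  qed measurable
  show "integrable lborel (\<lambda>t. indicator {a..<b} t * (t * bog_weight n l t) / t ^ n)"
  proof (rule Bochner_Integration.integrable_bound[OF i[of 1]])
    have "norm (indicator {a..<b} t * (t * bog_weight n l t) / t ^ n) \<le> norm (1 * indicat_real {a..<b} t)" for t
    proof (cases "t \<ge> 1 \<and> t < b \<and> a \<le> t")
      case True
      then show ?thesis using key[of t] by simp
    qed (auto simp: bog_weight_def indicator_def)
    then show "AE t in lborel. norm (indicator {a..<b} t * (t * bog_weight n l t) / t ^ n) \<le> norm (1 * indicat_real {a..<b} t)" by (rule AE_I2)
  qed measurable
qed

text \<open>Additivity can fail where one of the integrals takes its default value; those x form a
  null set.\<close>

lemma bog_op_add_AE:
  fixes \<phi> g :: "(real, 'n::finite) vec \<Rightarrow> real"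
  assumes v: "weight v1" "integrable lborel (\<lambda>t. v1 t / t ^ CARD('n))" "weight v2" "integrable lborel (\<lambda>t. v2 t / t ^ CARD('n))"
    and "integrable lborel \<phi>" "integrable lborel g"
  shows "AE x in lborel. bog_op (\<lambda>t. v1 t + v2 t) \<phi> g x = bog_op v1 \<phi> g x + bog_op v2 \<phi> g x"
  using AE_integrable_bog_op[OF v(1,2) assms(5,6)] AE_integrable_bog_op[OF v(3,4) assms(5,6)]
  by eventually_elim (simp only: bog_op_def distrib_right Bochner_Integration.integral_add)


section \<open>Weak derivatives of the averaging operator\<close>


text \<open>For \<open>t \<le> 1\<close> the quotient \<open>1 / (t - 1) ^ n\<close> would be a junk value.\<close>
definition slice_bd :: "nat \<Rightarrow> real \<Rightarrow> real \<Rightarrow> real" where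
  "slice_bd n q t = (if t \<le> 1 then q else min (1 / (t - 1) ^ n) q)"

lemma slice_bd_pos: "q > 0 \<Longrightarrow> slice_bd n q t > 0"
  by (auto simp: slice_bd_def)

lemma borel_measurable_slice_bd [measurable]: "slice_bd n q \<in> borel_measurable borel"
  unfolding slice_bd_def[abs_def] by measurable

text \<open>What Schur's test leaves for 1 <= t < 2 once its free factor is chosen as the inverse
  square root of the slice bound. With q = |\<Omega>| / |B| this integral produces kappa.\<close>

abbreviation regular_mass :: "nat \<Rightarrow> nat \<Rightarrow> real \<Rightarrow> ennreal" where
  "regular_mass n l q \<equiv> (\<integral>\<^sup>+t. ennreal (indicator {1..<2} t * (t * bog_weight n l t) * sqrt (slice_bd n q t)) \<partial>lborel)"

text \<open>The constant of \<open>bog_op_sing_bound\<close> with (A / rho)^2 taken out, doubled by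
  (a + b)^2 <= 2 a^2 + 2 b^2.\<close>

abbreviation sing_const :: "nat \<Rightarrow> real" where
  "sing_const n \<equiv> 2 * 2 ^ n * (pi * (1 + real n) / 2)\<^sup>2"

definition fourier_const :: "nat \<Rightarrow> real \<Rightarrow> real" where
  "fourier_const n A = (1 + real n) * A"

abbreviation cut_weight :: "nat \<Rightarrow> nat \<Rightarrow> real \<Rightarrow> real \<Rightarrow> real \<Rightarrow> real" where
  "cut_weight n l a b \<equiv> \<lambda>t. indicator {a..<b} t * (t * bog_weight n l t)"

text \<open>The setting is used twice, once for each term of the moment identity: theta against a
  moment of u, and a moment of theta against u. \<open>\<rho>\<close> stands for diam B,
  \<open>q\<close> for the volume ratio and \<open>S\<close> for a bound on the regular mass;
  \<open>A\<close> carries the size of the cut-off and scales by 1/rho with each derivative.\<close>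

locale bog_op_setting =
  fixes \<phi> g :: "(real, 'n::finite) vec \<Rightarrow> real" and A \<rho> q S :: real and l :: nat and \<Omega> :: "(real, 'n) vec set"
  assumes l: "1 \<le> l" "l \<le> CARD('n)"
    and \<phi>: "C2c \<phi>" and \<rho>: "\<rho> > 0" and A: "A \<ge> 0" and q: "q > 0" and S: "S \<ge> 0"
    and phi_L1: "(LINT x|lborel. \<bar>\<phi> x\<bar>) \<le> A"
    and dphi_L1: "\<And>k. (LINT x|lborel. \<bar>partial k \<phi> x\<bar>) \<le> A / \<rho>"
    and ddphi_L1: "\<And>k. (LINT x|lborel. \<bar>partial k (partial k \<phi>) x\<bar>) \<le> A / \<rho>\<^sup>2"
    and dphi_sup: "\<And>k x. \<bar>partial k \<phi> x\<bar> \<le> A / \<rho> ^ (CARD('n) + 1)"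
    and \<Omega> [measurable]: "\<Omega> \<in> sets borel" and vol: "emeasure lborel \<Omega> \<le> ennreal (q * \<rho> ^ CARD('n))"
    and g_meas [measurable]: "g \<in> borel_measurable borel" and g2: "sq_integrable g"
    and g0: "\<And>y. y \<notin> \<Omega> \<Longrightarrow> g y = 0"
    and S_ge: "regular_mass CARD('n) l q \<le> ennreal S"
begin

lemma vol_finite: "emeasure lborel \<Omega> < \<infinity>"
  using vol by (rule order.strict_trans1) simp

lemma indicator_L2: "integrable lborel (\<lambda>x. (indicat_real \<Omega> x)\<^sup>2)"
  using vol_finite by (simp add: power2_eq_square indicator_inter_arith[symmetric])

lemma g1: "integrable lborel g"
proof -
  have "integrable lborel (\<lambda>x. g x * indicat_real \<Omega> x)"
    by (rule integrable_mult_L2[OF _ _ g2 indicator_L2]) auto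
  moreover have "(\<lambda>x. g x * indicat_real \<Omega> x) = g" by (rule ext) (use g0 in \<open>auto simp: indicator_def\<close>)
  ultimately show ?thesis by simp
qed

lemma nn_g2: "(\<integral>\<^sup>+y. ennreal ((g y)\<^sup>2) \<partial>lborel) = ennreal (sq_norm g)"
  by (rule nn_integral_eq_integral[OF g2]) simp

lemma g2_nonneg: "(sq_norm g) \<ge> 0"
  by (rule Bochner_Integration.integral_nonneg) simp

lemma phi_supp: obtains r where "\<And>x. norm x > r \<Longrightarrow> \<phi> x = 0" "\<And>x j. norm x > r \<Longrightarrow> partial j \<phi> x = 0"
proof -
  obtain r where r: "\<And>x. norm x > r \<Longrightarrow> \<phi> x = 0" using C2c_D(6)[OF \<phi>] by blast
  show thesis by (rule that[of r]) (use r partial_eq_0_outside[OF r] in auto)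
qed

lemma phi_int: "integrable lborel \<phi>" "integrable lborel (partial j \<phi>)"
proof -
  obtain r where "\<And>x. norm x > r \<Longrightarrow> \<phi> x = 0" "\<And>x j. norm x > r \<Longrightarrow> partial j \<phi> x = 0" by (rule phi_supp) blast
  then show "integrable lborel \<phi>" "integrable lborel (partial j \<phi>)"
    using integrable_continuous_bounded_support(1) C2c_D(4,5)[OF \<phi>] by blast+
qed

lemma phi_meas [measurable]: "\<phi> \<in> borel_measurable borel" "partial j \<phi> \<in> borel_measurable borel"
  using phi_int by auto

lemma nn_L1:
  assumes "integrable lborel f" "(LINT x|lborel. \<bar>f x\<bar>) \<le> C"
  shows "(\<integral>\<^sup>+x. ennreal \<bar>f x\<bar> \<partial>lborel) \<le> ennreal C"
  using assms by (subst nn_integral_eq_integral) (auto intro: ennreal_leI)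

lemma slice_le:
  fixes f :: "(real, 'n) vec \<Rightarrow> real"
  assumes [measurable]: "f \<in> borel_measurable borel" and M: "\<And>x. \<bar>f x\<bar> \<le> M" "M \<ge> 0"
  shows "slice_mass f \<Omega> t x \<le> ennreal (M * (q * \<rho> ^ CARD('n)))"
    and "t > 1 \<Longrightarrow> slice_mass f \<Omega> t x \<le> ennreal (1 / (t - 1) ^ CARD('n)) * (\<integral>\<^sup>+z. ennreal \<bar>f z\<bar> \<partial>lborel)"
proof -
  have "slice_mass f \<Omega> t x \<le> (\<integral>\<^sup>+y. ennreal M * indicator \<Omega> y \<partial>lborel)"
    by (intro nn_integral_mono mult_right_mono ennreal_leI M) simp
  also have "\<dots> = ennreal M * emeasure lborel \<Omega>" by (rule nn_integral_cmult_indicator) simp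
  also have "\<dots> \<le> ennreal M * ennreal (q * \<rho> ^ CARD('n))" by (rule mult_left_mono[OF vol]) simp
  also have "\<dots> = ennreal (M * (q * \<rho> ^ CARD('n)))" using M(2) by (simp add: ennreal_mult')
  finally show "slice_mass f \<Omega> t x \<le> ennreal (M * (q * \<rho> ^ CARD('n)))" .
  assume t: "t > 1"
  have "slice_mass f \<Omega> t x \<le> (\<integral>\<^sup>+y. ennreal \<bar>f (y + t *\<^sub>R (x - y))\<bar> \<partial>lborel)"
    by (intro nn_integral_mono) (simp add: indicator_def)
  also have "\<dots> = ennreal (1 / (t - 1) ^ CARD('n)) * (\<integral>\<^sup>+z. ennreal \<bar>f z\<bar> \<partial>lborel)"
    by (rule nn_integral_slice_y[OF _ t, of "\<lambda>z. ennreal \<bar>f z\<bar>"]) simp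
  finally show "slice_mass f \<Omega> t x \<le> ennreal (1 / (t - 1) ^ CARD('n)) * (\<integral>\<^sup>+z. ennreal \<bar>f z\<bar> \<partial>lborel)" .
qed

lemma weights: "weight (bog_weight CARD('n) l)" "weight (cut_weight CARD('n) l a b)"
  by (rule weight_bog_weight, rule weight_mult_indicator[OF weight_mult_id[OF weight_bog_weight]]) simp

text \<open>Before differentiation no cancellation is required: Schur's test with factor 1 works
  once the y-slices are bounded by C / t^n. For t < 2 the volume of \<Omega> gives this, for t >= 2
  the inequality t <= 2 (t - 1); \<open>C\<close> is chosen to cover both.\<close>

lemma bog_op_L2: "integrable lborel (\<lambda>x. (bog_op (bog_weight CARD('n) l) \<phi> g x)\<^sup>2)"
proof -
  obtain M where M: "\<And>x. \<bar>\<phi> x\<bar> \<le> M"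
    using integrable_continuous_bounded_support(2)[OF C2c_D(4)[OF \<phi>]] phi_supp by (metis real_norm_def)
  have M0: "M \<ge> 0" using M[of 0] by linarith
  have qr: "q * \<rho> ^ CARD('n) \<ge> 0" using q \<rho> by simp
  define C where "C = 2 ^ CARD('n) * (A + M * (q * \<rho> ^ CARD('n)))"
  have C0: "C \<ge> 0" unfolding C_def using A M0 qr by simp
  have \<beta>: "slice_mass \<phi> \<Omega> t x \<le> ennreal (C / t ^ CARD('n))" if "(bog_weight CARD('n) l) t \<noteq> 0" for x t
  proof (cases "t < 2")
    case True
    have t: "t \<ge> 1" using weight_D(3)[OF weights(1) that] .
    have "slice_mass \<phi> \<Omega> t x \<le> ennreal (M * (q * \<rho> ^ CARD('n)))"
      by (rule slice_le(1)[OF _ M M0]) simp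
    also have "\<dots> \<le> ennreal (C / t ^ CARD('n))"
    proof (rule ennreal_leI)
      have "M * (q * \<rho> ^ CARD('n)) * t ^ CARD('n) \<le> M * (q * \<rho> ^ CARD('n)) * 2 ^ CARD('n)"
        using True t M0 qr by (intro mult_left_mono power_mono) auto
      also have "\<dots> \<le> C" unfolding C_def using A by (simp add: algebra_simps)
      finally show "M * (q * \<rho> ^ CARD('n)) \<le> C / t ^ CARD('n)" using t by (simp add: field_simps)
    qed
    finally show ?thesis .
  next
    case False
    have "slice_mass \<phi> \<Omega> t x \<le> ennreal (1 / (t - 1) ^ CARD('n)) * (\<integral>\<^sup>+z. ennreal \<bar>\<phi> z\<bar> \<partial>lborel)"
      by (rule slice_le(2)[OF _ M M0]) (use False in auto)
    also have "\<dots> \<le> ennreal (1 / (t - 1) ^ CARD('n)) * ennreal A"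
      by (intro mult_left_mono nn_L1 phi_int phi_L1) simp
    also have "\<dots> = ennreal (A / (t - 1) ^ CARD('n))" using False A by (subst ennreal_mult[symmetric]) auto
    also have "\<dots> \<le> ennreal (C / t ^ CARD('n))"
    proof (rule ennreal_leI)
      have "t ^ CARD('n) \<le> (2 * (t - 1)) ^ CARD('n)" using False by (intro power_mono) auto
      then have "A * t ^ CARD('n) \<le> A * (2 ^ CARD('n) * (t - 1) ^ CARD('n))" using A unfolding power_mult_distrib by (intro mult_left_mono)
      also have "\<dots> = 2 ^ CARD('n) * A * (t - 1) ^ CARD('n)" by (simp only: mult_ac)
      also have "\<dots> \<le> C * (t - 1) ^ CARD('n)"
        unfolding C_def using False mult_nonneg_nonneg[OF M0 qr] by (intro mult_right_mono mult_left_mono) simp_all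
      finally show "A / (t - 1) ^ CARD('n) \<le> C / t ^ CARD('n)" using False by (simp add: field_simps)
    qed
    finally show ?thesis .
  qed
  have "(\<integral>\<^sup>+x. ennreal ((bog_op (bog_weight CARD('n) l) \<phi> g x)\<^sup>2) \<partial>lborel) \<le> (\<integral>\<^sup>+t. ennreal ((bog_weight CARD('n) l) t * 1) * ennreal (C / t ^ CARD('n)) \<partial>lborel) *
     ((\<integral>\<^sup>+t. ennreal ((bog_weight CARD('n) l) t / (1 * t ^ CARD('n))) \<partial>lborel) * (\<integral>\<^sup>+z. ennreal \<bar>\<phi> z\<bar> \<partial>lborel) * (\<integral>\<^sup>+y. ennreal ((g y)\<^sup>2) \<partial>lborel))"
    by (rule bog_op_schur[OF weights(1) _ _ _ _ \<Omega> g0 \<beta>]) auto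
  also have "\<dots> < \<infinity>"
  proof -
    have w0: "(bog_weight CARD('n) l) t / t ^ CARD('n) \<ge> 0" for t
      using weight_D(2,3)[OF weights(1), of t] by (cases "(bog_weight CARD('n) l) t = 0") auto
    have 1: "(\<integral>\<^sup>+t. ennreal ((bog_weight CARD('n) l) t / (1 * t ^ CARD('n))) \<partial>lborel) < \<infinity>"
      using nn_integral_eq_integral[OF integrable_bog_weight[OF l]] w0 by simp
    have "ennreal ((bog_weight CARD('n) l) t * 1) * ennreal (C / t ^ CARD('n)) = ennreal C * ennreal ((bog_weight CARD('n) l) t / t ^ CARD('n))" for t
      using weight_D(2,3)[OF weights(1), of t] C0 w0[of t]
      by (cases "(bog_weight CARD('n) l) t = 0") (simp_all add: ennreal_mult[symmetric] mult_ac)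
    then have 2: "(\<integral>\<^sup>+t. ennreal ((bog_weight CARD('n) l) t * 1) * ennreal (C / t ^ CARD('n)) \<partial>lborel) < \<infinity>"
      using 1 weight_D(1)[OF weights(1)] by (simp add: nn_integral_cmult ennreal_mult_less_top)
    have 3: "(\<integral>\<^sup>+z. ennreal \<bar>\<phi> z\<bar> \<partial>lborel) < \<infinity>"
      using nn_L1[OF phi_int(1) phi_L1] by (rule order.strict_trans1) simp
    show ?thesis using 1 2 3 nn_g2 by (simp add: ennreal_mult_less_top)
  qed
  finally show ?thesis
    using weight_D(1)[OF weights(1)] by (intro integrableI_bounded) auto
qed

text \<open>With factor 1 / sqrt b, where b is the slice bound, both Schur integrals reduce to the
  integral of the weight times sqrt b: in the first, b / sqrt b = sqrt b; in the second, t^(-n) <= 1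
  is discarded. The powers of rho in the supremum bound and in the volume cancel up to
  1/rho.\<close>

lemma bog_op_regular:
  "integrable lborel (\<lambda>x. (bog_op (cut_weight CARD('n) l 1 2) (partial j \<phi>) g x)\<^sup>2)"
  "(LINT x|lborel. (bog_op (cut_weight CARD('n) l 1 2) (partial j \<phi>) g x)\<^sup>2) \<le> (A / \<rho>)\<^sup>2 * S\<^sup>2 * (sq_norm g)"
proof -
  let ?b = "slice_bd CARD('n) q"
  note [measurable] = weight_D(1)[OF weights(2)[of 1 2]]
  have Ar: "A / \<rho> \<ge> 0" using A \<rho> by simp
  have b: "?b t > 0" for t by (rule slice_bd_pos[OF q])
  have v0: "(cut_weight CARD('n) l 1 2) t \<ge> 0" for t by (rule weight_D(2)[OF weights(2)])
  have \<beta>: "slice_mass (partial j \<phi>) \<Omega> t x \<le> ennreal (A / \<rho> * ?b t)" if "(cut_weight CARD('n) l 1 2) t \<noteq> 0" for x t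
  proof -
    have M: "0 \<le> A / \<rho> ^ (CARD('n) + 1)" using A \<rho> by simp
    have "slice_mass (partial j \<phi>) \<Omega> t x \<le> ennreal (A / \<rho> ^ (CARD('n) + 1) * (q * \<rho> ^ CARD('n)))"
      by (rule slice_le(1)[OF _ dphi_sup M]) simp
    also have "A / \<rho> ^ (CARD('n) + 1) * (q * \<rho> ^ CARD('n)) = A / \<rho> * q" using \<rho> by simp
    finally have 1: "slice_mass (partial j \<phi>) \<Omega> t x \<le> ennreal (A / \<rho> * q)" .
    show ?thesis
    proof (cases "t \<le> 1")
      case True then show ?thesis using 1 by (simp add: slice_bd_def)
    next
      case False
      have "slice_mass (partial j \<phi>) \<Omega> t x \<le> ennreal (1 / (t - 1) ^ CARD('n)) * (\<integral>\<^sup>+z. ennreal \<bar>partial j \<phi> z\<bar> \<partial>lborel)"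
        by (rule slice_le(2)[OF _ dphi_sup M]) (use False in auto)
      also have "\<dots> \<le> ennreal (1 / (t - 1) ^ CARD('n)) * ennreal (A / \<rho>)"
        by (intro mult_left_mono nn_L1 phi_int dphi_L1) simp
      also have "\<dots> = ennreal (A / \<rho> * (1 / (t - 1) ^ CARD('n)))"
        using False Ar by (subst ennreal_mult[symmetric]) (auto simp: mult.commute)
      finally show ?thesis using 1 False by (simp only: slice_bd_def if_False min_def split: if_split) simp
    qed
  qed
  have "(\<integral>\<^sup>+x. ennreal ((bog_op (cut_weight CARD('n) l 1 2) (partial j \<phi>) g x)\<^sup>2) \<partial>lborel) \<le> (\<integral>\<^sup>+t. ennreal ((cut_weight CARD('n) l 1 2) t * (1 / sqrt (?b t))) * ennreal (A / \<rho> * ?b t) \<partial>lborel) *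
     ((\<integral>\<^sup>+t. ennreal ((cut_weight CARD('n) l 1 2) t / ((1 / sqrt (?b t)) * t ^ CARD('n))) \<partial>lborel) * (\<integral>\<^sup>+z. ennreal \<bar>partial j \<phi> z\<bar> \<partial>lborel) * (\<integral>\<^sup>+y. ennreal ((g y)\<^sup>2) \<partial>lborel))"
    by (rule bog_op_schur[OF weights(2) _ _ _ _ \<Omega> g0 \<beta>]) (use b in auto)
  also have "\<dots> \<le> (ennreal (A / \<rho>) * ennreal S) * ((ennreal S * ennreal (A / \<rho>)) * ennreal (sq_norm g))"
  proof (intro mult_mono)
    have "ennreal ((cut_weight CARD('n) l 1 2) t * (1 / sqrt (?b t))) * ennreal (A / \<rho> * ?b t) = ennreal (A / \<rho>) * ennreal ((cut_weight CARD('n) l 1 2) t * sqrt (?b t))" for t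
    proof -
      have "(cut_weight CARD('n) l 1 2) t * (1 / sqrt (?b t)) * (A / \<rho> * ?b t) = A / \<rho> * ((cut_weight CARD('n) l 1 2) t * sqrt (?b t))"
      proof -
        have *: "u * (1 / s) * (c * (s * s)) = c * (u * s)" if "s > 0" for u c s :: real using that by simp
        have "sqrt (?b t) * sqrt (?b t) = ?b t" using b[of t] by simp
        then show ?thesis using *[of "sqrt (?b t)" "cut_weight CARD('n) l 1 2 t" "A / \<rho>"] b[of t] by (simp only: real_sqrt_gt_0_iff)
      qed
      then show ?thesis using v0[of t] b[of t] Ar by (simp only: ennreal_mult[symmetric] mult_nonneg_nonneg real_sqrt_ge_zero less_imp_le zero_le_divide_1_iff)
    qed
    then have "(\<integral>\<^sup>+t. ennreal ((cut_weight CARD('n) l 1 2) t * (1 / sqrt (?b t))) * ennreal (A / \<rho> * ?b t) \<partial>lborel) = ennreal (A / \<rho>) * (\<integral>\<^sup>+t. ennreal ((cut_weight CARD('n) l 1 2) t * sqrt (?b t)) \<partial>lborel)"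
      by (simp only:) (rule nn_integral_cmult, measurable)
    also have "\<dots> \<le> ennreal (A / \<rho>) * ennreal S" by (rule mult_left_mono[OF S_ge]) simp
    finally show "(\<integral>\<^sup>+t. ennreal ((cut_weight CARD('n) l 1 2) t * (1 / sqrt (?b t))) * ennreal (A / \<rho> * ?b t) \<partial>lborel) \<le> ennreal (A / \<rho>) * ennreal S" .
    have "(cut_weight CARD('n) l 1 2) t / ((1 / sqrt (?b t)) * t ^ CARD('n)) \<le> (cut_weight CARD('n) l 1 2) t * sqrt (?b t)" for t
    proof (cases "(cut_weight CARD('n) l 1 2) t = 0")
      case False
      then have "t \<ge> 1" by (rule weight_D(3)[OF weights(2)])
      then have "(cut_weight CARD('n) l 1 2) t * sqrt (?b t) / t ^ CARD('n) \<le> (cut_weight CARD('n) l 1 2) t * sqrt (?b t) / 1"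
        using v0[of t] b[of t] by (intro divide_left_mono) auto
      then show ?thesis by simp
    next
      case True
      show ?thesis unfolding True by simp
    qed
    then have "(\<integral>\<^sup>+t. ennreal ((cut_weight CARD('n) l 1 2) t / ((1 / sqrt (?b t)) * t ^ CARD('n))) \<partial>lborel) \<le> (\<integral>\<^sup>+t. ennreal ((cut_weight CARD('n) l 1 2) t * sqrt (?b t)) \<partial>lborel)"
      by (intro nn_integral_mono ennreal_leI)
    then show "(\<integral>\<^sup>+t. ennreal ((cut_weight CARD('n) l 1 2) t / ((1 / sqrt (?b t)) * t ^ CARD('n))) \<partial>lborel) \<le> ennreal S"
      using S_ge by (rule order_trans)
    show "(\<integral>\<^sup>+z. ennreal \<bar>partial j \<phi> z\<bar> \<partial>lborel) \<le> ennreal (A / \<rho>)"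
      by (rule nn_L1[OF phi_int(2) dphi_L1])
  qed (auto simp: nn_g2)
  also have "\<dots> = ennreal ((A / \<rho>)\<^sup>2 * S\<^sup>2 * (sq_norm g))"
  proof -
    have "(A / \<rho>)\<^sup>2 * S\<^sup>2 * (sq_norm g) = (A / \<rho> * S) * ((S * (A / \<rho>)) * (sq_norm g))"
      by (simp add: power2_eq_square)
    then show ?thesis using Ar S g2_nonneg by (simp only: ennreal_mult mult_nonneg_nonneg)
  qed
  finally have le: "(\<integral>\<^sup>+x. ennreal ((bog_op (cut_weight CARD('n) l 1 2) (partial j \<phi>) g x)\<^sup>2) \<partial>lborel) \<le> ennreal ((A / \<rho>)\<^sup>2 * S\<^sup>2 * (sq_norm g))" .
  then have "(\<integral>\<^sup>+x. ennreal ((bog_op (cut_weight CARD('n) l 1 2) (partial j \<phi>) g x)\<^sup>2) \<partial>lborel) < \<infinity>"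
    by (rule order.strict_trans1) simp
  then show i: "integrable lborel (\<lambda>x. (bog_op (cut_weight CARD('n) l 1 2) (partial j \<phi>) g x)\<^sup>2)"
    by (intro integrableI_bounded) auto
  from le show "(LINT x|lborel. (bog_op (cut_weight CARD('n) l 1 2) (partial j \<phi>) g x)\<^sup>2) \<le> (A / \<rho>)\<^sup>2 * S\<^sup>2 * (sq_norm g)"
    using nn_integral_eq_integral[OF i] g2_nonneg by (simp add: ennreal_le_iff)
qed

lemma fourier_const_nonneg: "fourier_const CARD('n) A \<ge> 0" using A by (simp add: fourier_const_def)

text \<open>Controls the squared norm of the part of the singular average with t in [a, b). It is
  additive in the interval and bounded beyond 2.\<close>

definition "freq_mass a b = (\<integral>\<^sup>+t. indicator {a..<b} t * freq_slice (fourier_const CARD('n) A) \<rho> g t \<partial>lborel)"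

lemma bog_op_sing:
  assumes a: "a \<ge> 1"
  shows "integrable lborel (\<lambda>x. (bog_op (cut_weight CARD('n) l a b) (partial j \<phi>) g x)\<^sup>2)"
    and "ennreal ((2 * pi) ^ CARD('n) * (LINT x|lborel. (bog_op (cut_weight CARD('n) l a b) (partial j \<phi>) g x)\<^sup>2)) \<le> ennreal (pi * fourier_const CARD('n) A / (2 * \<rho>)) * freq_mass a b"
proof -
  obtain r where r: "\<And>x j. norm x > r \<Longrightarrow> partial j \<phi> x = 0" by (rule phi_supp) blast
  have F: "cmod (fourier (partial j \<phi>) \<zeta>) \<le> fourier_const CARD('n) A * norm \<zeta> / (1 + \<rho>\<^sup>2 * (norm \<zeta>)\<^sup>2)" for \<zeta>
    using fourier_partial_le[OF \<phi> \<rho> phi_L1 ddphi_L1, of j \<zeta>] by (simp add: fourier_const_def)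
  have v: "cut_weight CARD('n) l a b t * t \<le> t ^ CARD('n)" if "cut_weight CARD('n) l a b t \<noteq> 0" for t
  proof -
    have t: "t \<ge> 1" using that by (rule weight_D(3)[OF weights(2)])
    have e: "cut_weight CARD('n) l a b t = t * bog_weight CARD('n) l t" using that by (auto simp: indicator_def)
    show ?thesis unfolding e using t bog_weight_bound(1)[OF l, of t] by simp
  qed
  note * = bog_op_singular[OF fourier_const_nonneg \<rho> C2c_D(5)[OF \<phi>] r F g1 weights(2) integrable_bog_weight_cut[OF l] integrable_bog_weight_cut_div[OF l] v]
  show "integrable lborel (\<lambda>x. (bog_op (cut_weight CARD('n) l a b) (partial j \<phi>) g x)\<^sup>2)" by (rule *(1))
  have "(\<integral>\<^sup>+t. indicator {t. cut_weight CARD('n) l a b t \<noteq> 0} t * freq_slice (fourier_const CARD('n) A) \<rho> g t \<partial>lborel) \<le> freq_mass a b"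
    unfolding freq_mass_def by (intro nn_integral_mono mult_right_mono) (auto simp: indicator_def)
  from order_trans[OF *(2) mult_left_mono[OF this zero_le]]
  show "ennreal ((2 * pi) ^ CARD('n) * (LINT x|lborel. (bog_op (cut_weight CARD('n) l a b) (partial j \<phi>) g x)\<^sup>2)) \<le> ennreal (pi * fourier_const CARD('n) A / (2 * \<rho>)) * freq_mass a b" .
qed

lemma freq_mass_le: "a \<ge> 2 \<Longrightarrow> freq_mass a b \<le> ennreal (2 ^ CARD('n) * (pi * fourier_const CARD('n) A / (2 * \<rho>)) * ((2 * pi) ^ CARD('n) * (sq_norm g)))"
proof -
  assume a: "a \<ge> 2"
  have p: "0 \<le> 2 ^ CARD('n) * (pi * fourier_const CARD('n) A / (2 * \<rho>))" using fourier_const_nonneg \<rho> by simp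
  have "freq_mass a b \<le> (\<integral>\<^sup>+t. freq_slice (fourier_const CARD('n) A) \<rho> g t * indicator {2..} t \<partial>lborel)"
    unfolding freq_mass_def using a by (intro nn_integral_mono) (auto simp: indicator_def)
  also have "\<dots> \<le> ennreal (2 ^ CARD('n) * (pi * fourier_const CARD('n) A / (2 * \<rho>))) * (\<integral>\<^sup>+\<xi>. ennreal ((cmod (fourier g \<xi>))\<^sup>2) \<partial>lborel)"
    by (rule nn_integral_freq_slice_le[OF fourier_const_nonneg \<rho> g_meas])
  also have "\<dots> \<le> ennreal (2 ^ CARD('n) * (pi * fourier_const CARD('n) A / (2 * \<rho>))) * ennreal ((2 * pi) ^ CARD('n) * (sq_norm g))"
    using plancherel_upper[OF g1 g2] by (intro mult_left_mono) simp_all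
  also have "\<dots> = ennreal (2 ^ CARD('n) * (pi * fourier_const CARD('n) A / (2 * \<rho>)) * ((2 * pi) ^ CARD('n) * (sq_norm g)))"
    using p g2_nonneg by (intro ennreal_mult[symmetric]) simp_all
  finally show ?thesis .
qed

lemma freq_mass_add: "a \<le> b \<Longrightarrow> b \<le> c \<Longrightarrow> freq_mass a c = freq_mass a b + freq_mass b c"
proof -
  assume "a \<le> b" "b \<le> c"
  then have "indicator {a..<c} t * freq_slice (fourier_const CARD('n) A) \<rho> g t = indicator {a..<b} t * freq_slice (fourier_const CARD('n) A) \<rho> g t + indicator {b..<c} t * freq_slice (fourier_const CARD('n) A) \<rho> g t" for t
    by (auto simp: indicator_def)
  then show ?thesis unfolding freq_mass_def by (simp only:) (rule nn_integral_add, measurable)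
qed

text \<open>The factors (2 pi)^n of the two Plancherel inequalities cancel, and the bound does not
  depend on the upper end \<open>b\<close>.\<close>

lemma bog_op_sing_bound:
  assumes a: "a \<ge> 2"
  shows "(LINT x|lborel. (bog_op (cut_weight CARD('n) l a b) (partial j \<phi>) g x)\<^sup>2) \<le> 2 ^ CARD('n) * (pi * fourier_const CARD('n) A / (2 * \<rho>))\<^sup>2 * (sq_norm g)"
proof -
  define c where "c = pi * fourier_const CARD('n) A / (2 * \<rho>)"
  have c0: "c \<ge> 0" unfolding c_def using fourier_const_nonneg \<rho> by simp
  have "ennreal ((2 * pi) ^ CARD('n) * (LINT x|lborel. (bog_op (cut_weight CARD('n) l a b) (partial j \<phi>) g x)\<^sup>2)) \<le> ennreal c * freq_mass a b"
    unfolding c_def using a by (intro bog_op_sing) simp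
  also have "\<dots> \<le> ennreal c * ennreal (2 ^ CARD('n) * c * ((2 * pi) ^ CARD('n) * (sq_norm g)))"
    unfolding c_def by (rule mult_left_mono[OF freq_mass_le[OF a]]) simp
  also have "\<dots> = ennreal (c * (2 ^ CARD('n) * c * ((2 * pi) ^ CARD('n) * (sq_norm g))))"
    using c0 g2_nonneg by (intro ennreal_mult[symmetric]) simp_all
  finally have "(2 * pi) ^ CARD('n) * (LINT x|lborel. (bog_op (cut_weight CARD('n) l a b) (partial j \<phi>) g x)\<^sup>2) \<le> c * (2 ^ CARD('n) * c * ((2 * pi) ^ CARD('n) * (sq_norm g)))"
    using c0 g2_nonneg by (subst (asm) ennreal_le_iff) simp_all
  also have "\<dots> = (2 * pi) ^ CARD('n) * (2 ^ CARD('n) * c\<^sup>2 * (sq_norm g))" by (simp add: power2_eq_square)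
  finally show ?thesis unfolding c_def[symmetric] by (subst (asm) mult_le_cancel_left_pos) simp_all
qed

text \<open>The squared distance of two truncations is at most a constant times an increment of the
  bounded increasing sequence \<open>freq_mass 2 (2 + n)\<close>, so the truncations are Cauchy in
  L^2. Restricting them to \<Omega>, which has finite measure, makes them Cauchy in L^1 as well, as
  \<open>L2_complete\<close> demands.\<close>

lemma sing_limit:
  obtains h where "h \<in> borel_measurable borel" "sq_integrable h"
    "(sq_norm h) \<le> 2 ^ CARD('n) * (pi * fourier_const CARD('n) A / (2 * \<rho>))\<^sup>2 * (sq_norm g)"
    "(\<lambda>n. LINT x|lborel. (h x - indicator \<Omega> x * bog_op (cut_weight CARD('n) l 2 (2 + real n)) (partial j \<phi>) g x)\<^sup>2) \<longlonglongrightarrow> 0"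
proof -
  define c where "c = pi * fourier_const CARD('n) A / (2 * \<rho>)"
  have c0: "c \<ge> 0" unfolding c_def using fourier_const_nonneg \<rho> by simp
  let ?W = "\<lambda>a b x. bog_op (cut_weight CARD('n) l a b) (partial j \<phi>) g x"
  let ?f = "\<lambda>n x. indicat_real \<Omega> x * ?W 2 (2 + real n) x"
  note [measurable] = weight_D(1)[OF weights(2)]
  have iW: "integrable lborel (?W a b)" for a b
    by (rule integrable_bog_op[OF weights(2) integrable_bog_weight_cut_div[OF l] phi_int(2) g1])
  have i1: "integrable lborel (?f n)" for n
    using integrable_mult_indicator[OF _ iW, of \<Omega>] by simp
  have sq: "(indicat_real \<Omega> x * u)\<^sup>2 = indicat_real \<Omega> x * u\<^sup>2" for x u
    by (simp add: indicator_def)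
  have i2: "integrable lborel (\<lambda>x. (?f n x)\<^sup>2)" for n
    unfolding sq using integrable_mult_indicator[OF _ bog_op_sing(1)[of 2], of \<Omega>] by simp
  define H where "H n = freq_mass 2 (2 + real n)" for n
  define K where "K = 2 ^ CARD('n) * c * ((2 * pi) ^ CARD('n) * (sq_norm g))"
  have HK: "H n \<le> ennreal K" for n unfolding H_def K_def c_def by (rule freq_mass_le) simp
  have Hfin: "H n < top" for n using HK[of n] by (rule order.strict_trans1) simp
  have Hmono: "H m + freq_mass (2 + real m) (2 + real n) = H n" if "m \<le> n" for m n
    unfolding H_def using that by (intro freq_mass_add[symmetric]) auto
  have Hle: "H m \<le> H n" if "m \<le> n" for m n
    by (subst Hmono[OF that, symmetric]) simp
  have diff: "(LINT x|lborel. (?f n x - ?f m x)\<^sup>2) \<le> c / (2 * pi) ^ CARD('n) * (enn2real (H n) - enn2real (H m))" if mn: "m \<le> n" for m n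
  proof -
    have add: "cut_weight CARD('n) l 2 (2 + real n) = (\<lambda>t. cut_weight CARD('n) l 2 (2 + real m) t + cut_weight CARD('n) l (2 + real m) (2 + real n) t)"
      using mn by (auto simp: fun_eq_iff indicator_def)
    have "AE x in lborel. ?W 2 (2 + real n) x = ?W 2 (2 + real m) x + ?W (2 + real m) (2 + real n) x"
      unfolding add by (rule bog_op_add_AE[OF weights(2) integrable_bog_weight_cut_div[OF l] weights(2) integrable_bog_weight_cut_div[OF l] phi_int(2) g1])
    then have "AE x in lborel. (?f n x - ?f m x)\<^sup>2 = indicat_real \<Omega> x * (?W (2 + real m) (2 + real n) x)\<^sup>2"
      by eventually_elim (simp add: sq[symmetric] algebra_simps)
    then have "(LINT x|lborel. (?f n x - ?f m x)\<^sup>2) = (LINT x|lborel. indicat_real \<Omega> x * (?W (2 + real m) (2 + real n) x)\<^sup>2)"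
      by (intro integral_cong_AE) auto
    also have "\<dots> \<le> (LINT x|lborel. (?W (2 + real m) (2 + real n) x)\<^sup>2)"
      by (rule integral_mono'[OF bog_op_sing(1)]) (auto simp: indicator_def)
    finally have le: "(LINT x|lborel. (?f n x - ?f m x)\<^sup>2) \<le> (LINT x|lborel. (?W (2 + real m) (2 + real n) x)\<^sup>2)" .
    have hd: "freq_mass (2 + real m) (2 + real n) = ennreal (enn2real (H n) - enn2real (H m))"
    proof -
      have fin: "freq_mass (2 + real m) (2 + real n) < top" using Hmono[OF mn] Hfin[of n] by (metis ennreal_add_less_top)
      have "enn2real (H n) = enn2real (H m) + enn2real (freq_mass (2 + real m) (2 + real n))"
        unfolding Hmono[OF mn, symmetric] by (rule enn2real_plus[OF Hfin fin])
      then show ?thesis using fin by (simp add: ennreal_enn2real_if less_top)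
    qed
    have "enn2real (H m) \<le> enn2real (H n)"
      by (rule enn2real_mono[OF Hle[OF mn] Hfin])
    then have "ennreal ((2 * pi) ^ CARD('n) * (LINT x|lborel. (?W (2 + real m) (2 + real n) x)\<^sup>2)) \<le> ennreal (c * (enn2real (H n) - enn2real (H m)))"
      using bog_op_sing(2)[of "2 + real m" "2 + real n" j] c0 unfolding hd c_def[symmetric] by (simp add: ennreal_mult)
    then have "(2 * pi) ^ CARD('n) * (LINT x|lborel. (?W (2 + real m) (2 + real n) x)\<^sup>2) \<le> c * (enn2real (H n) - enn2real (H m))"
      using c0 \<open>enn2real (H m) \<le> enn2real (H n)\<close> by (subst (asm) ennreal_le_iff) simp_all
    then have "(LINT x|lborel. (?W (2 + real m) (2 + real n) x)\<^sup>2) \<le> c / (2 * pi) ^ CARD('n) * (enn2real (H n) - enn2real (H m))"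
      by (simp add: field_simps)
    with le show ?thesis by (rule order_trans)
  qed
  have cau: "Cauchy (\<lambda>n. enn2real (H n))"
  proof (rule convergent_Cauchy, rule Bseq_monoseq_convergent)
    have "norm (enn2real (H n)) \<le> enn2real (ennreal K)" for n
      using enn2real_mono[OF HK[of n]] by simp
    then show "Bseq (\<lambda>n. enn2real (H n))" by (rule BseqI')
    have "enn2real (H m) \<le> enn2real (H n)" if "m \<le> n" for m n
      by (rule enn2real_mono[OF Hle[OF that] Hfin])
    then show "monoseq (\<lambda>n. enn2real (H n))" by (simp add: monoseq_def)
  qed
  define D where "D = c / (2 * pi) ^ CARD('n)"
  have D0: "D \<ge> 0" unfolding D_def using c0 by simp
  have c2: "\<exists>M. \<forall>i\<ge>M. \<forall>k\<ge>M. (LINT x|lborel. (?f i x - ?f k x)\<^sup>2) \<le> e" if e: "e > 0" for e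
  proof -
    \<comment> \<open>\<open>D + 1\<close> in place of \<open>D\<close> covers the case
      \<open>D = 0\<close>; the same device is used with \<open>V\<close> below.\<close>
    obtain M where M: "\<And>i k. i \<ge> M \<Longrightarrow> k \<ge> M \<Longrightarrow> \<bar>enn2real (H i) - enn2real (H k)\<bar> < e / (D + 1)"
      using CauchyD[OF cau, of "e / (D + 1)"] e D0 by auto
    have "(LINT x|lborel. (?f i x - ?f k x)\<^sup>2) \<le> e" if ik: "i \<ge> M" "k \<ge> M" for i k
    proof -
      have "(LINT x|lborel. (?f i x - ?f k x)\<^sup>2) \<le> D * \<bar>enn2real (H i) - enn2real (H k)\<bar>"
      proof (cases "k \<le> i")
        case True
        have "(LINT x|lborel. (?f i x - ?f k x)\<^sup>2) \<le> D * (enn2real (H i) - enn2real (H k))"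
          using diff[OF True] unfolding D_def .
        also have "\<dots> \<le> D * \<bar>enn2real (H i) - enn2real (H k)\<bar>" by (intro mult_left_mono D0) simp
        finally show ?thesis .
      next
        case False
        then have "(LINT x|lborel. (?f k x - ?f i x)\<^sup>2) \<le> D * (enn2real (H k) - enn2real (H i))"
          using diff[of i k] unfolding D_def by simp
        also have "\<dots> \<le> D * \<bar>enn2real (H i) - enn2real (H k)\<bar>" by (intro mult_left_mono D0) simp
        finally show ?thesis by (simp only: power2_commute)
      qed
      also have "\<dots> \<le> D * (e / (D + 1))" using M[OF ik] D0 by (intro mult_left_mono) auto
      also have "\<dots> \<le> e" using D0 e by (simp add: field_simps)
      finally show ?thesis .
    qed
    then show ?thesis by blast
  qed
  define V where "V = (LINT x|lborel. (indicat_real \<Omega> x)\<^sup>2)"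
  have V0: "V \<ge> 0" unfolding V_def by (rule Bochner_Integration.integral_nonneg) simp
  have c1: "\<exists>M. \<forall>i\<ge>M. \<forall>k\<ge>M. (LINT x|lborel. norm (?f i x - ?f k x)) < e" if e: "e > 0" for e
  proof -
    obtain M where M: "\<And>i k. i \<ge> M \<Longrightarrow> k \<ge> M \<Longrightarrow> (LINT x|lborel. (?f i x - ?f k x)\<^sup>2) \<le> (e / 2)\<^sup>2 / (V + 1)"
      using c2[of "(e / 2)\<^sup>2 / (V + 1)"] e V0 by auto
    have "(LINT x|lborel. norm (?f i x - ?f k x)) < e" if ik: "i \<ge> M" "k \<ge> M" for i k
    proof -
      have "(LINT x|lborel. \<bar>(?f i x - ?f k x) * indicat_real \<Omega> x\<bar>)\<^sup>2 \<le> (LINT x|lborel. (?f i x - ?f k x)\<^sup>2) * V"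
        unfolding V_def by (rule Cauchy_Schwarz_integral) (auto intro!: integrable_power2_add i2 indicator_L2[simplified])
      also have "\<dots> \<le> (e / 2)\<^sup>2 / (V + 1) * V" by (rule mult_right_mono[OF M[OF ik] V0])
      also have "\<dots> \<le> (e / 2)\<^sup>2" using V0 by (simp add: field_simps)
      finally have "(LINT x|lborel. \<bar>(?f i x - ?f k x) * indicat_real \<Omega> x\<bar>) \<le> e / 2"
        by (rule power2_le_imp_le) (use e in simp)
      moreover have "\<bar>(?f i x - ?f k x) * indicat_real \<Omega> x\<bar> = norm (?f i x - ?f k x)" for x by (simp add: indicator_def)
      ultimately show ?thesis using e by simp
    qed
    then show ?thesis by blast
  qed
  have B: "(LINT x|lborel. (?f n x)\<^sup>2) \<le> 2 ^ CARD('n) * (pi * fourier_const CARD('n) A / (2 * \<rho>))\<^sup>2 * (sq_norm g)" for n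
  proof -
    have "(LINT x|lborel. (?f n x)\<^sup>2) \<le> (LINT x|lborel. (?W 2 (2 + real n) x)\<^sup>2)"
      by (rule integral_mono'[OF bog_op_sing(1)]) (auto simp: indicator_def)
    also have "\<dots> \<le> 2 ^ CARD('n) * (pi * fourier_const CARD('n) A / (2 * \<rho>))\<^sup>2 * (sq_norm g)" by (rule bog_op_sing_bound) simp
    finally show ?thesis .
  qed
  obtain h where h: "h \<in> borel_measurable lborel" "sq_integrable h"
      "(sq_norm h) \<le> 2 ^ CARD('n) * (pi * fourier_const CARD('n) A / (2 * \<rho>))\<^sup>2 * (sq_norm g)"
      "(\<lambda>n. LINT x|lborel. (h x - ?f n x)\<^sup>2) \<longlonglongrightarrow> 0"
    using L2_complete[OF i1 i2 c1 c2 B] by blast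
  show thesis by (rule that[of h]) (use h in \<open>simp_all only: measurable_lborel2\<close>)
qed

text \<open>W is the regular part plus the L^2 limit of the truncated singular parts. Integration by
  parts is carried out for the truncated weights, where everything converges absolutely. Then the
  left side passes to the limit by dominated convergence, and the singular term on the right by L^2
  convergence.\<close>

theorem bog_op_weak_derivative:
  obtains W where "W \<in> borel_measurable borel" "sq_integrable W"
    "(sq_norm W) \<le> (A / \<rho>)\<^sup>2 * (2 * S\<^sup>2 + sing_const CARD('n)) * (sq_norm g)"
    "\<And>\<eta> r. (\<And>x. \<eta> differentiable (at x)) \<Longrightarrow> continuous_on UNIV (partial j \<eta>) \<Longrightarrow> (\<And>x. norm x > r \<Longrightarrow> \<eta> x = 0) \<Longrightarrow>
       (\<And>x. x \<notin> \<Omega> \<Longrightarrow> \<eta> x = 0) \<Longrightarrow>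
       (LINT x|lborel. bog_op (bog_weight CARD('n) l) \<phi> g x * partial j \<eta> x) = - (LINT x|lborel. W x * \<eta> x)"
proof -
  let ?G = "LINT y|lborel. (g y)\<^sup>2"
  let ?R = "bog_op (cut_weight CARD('n) l 1 2) (partial j \<phi>) g"
  let ?W = "\<lambda>n::nat. bog_op (cut_weight CARD('n) l 2 (2 + real n)) (partial j \<phi>) g"
  let ?w = "bog_weight CARD('n) l"
  note [measurable] = weight_D(1)[OF weights(1)]
  have [measurable]: "?R \<in> borel_measurable borel" "?W n \<in> borel_measurable borel" for n
    by measurable
  obtain h where hm [measurable]: "h \<in> borel_measurable borel" and h2: "sq_integrable h"
    and hB: "(sq_norm h) \<le> 2 ^ CARD('n) * (pi * fourier_const CARD('n) A / (2 * \<rho>))\<^sup>2 * ?G"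
    and hlim: "(\<lambda>n. LINT x|lborel. (h x - indicator \<Omega> x * ?W n x)\<^sup>2) \<longlonglongrightarrow> 0"
    by (rule sing_limit)
  note R2 = bog_op_regular[of j]
  show thesis
  proof (rule that[of "\<lambda>x. ?R x + h x"])
    show "(\<lambda>x. ?R x + h x) \<in> borel_measurable borel" by measurable
    show "integrable lborel (\<lambda>x. (?R x + h x)\<^sup>2)"
      by (rule integrable_power2_add(1)[OF _ _ R2(1) h2]) auto
    have "(LINT x|lborel. (?R x + h x)\<^sup>2) \<le> 2 * (LINT x|lborel. (?R x)\<^sup>2) + 2 * (sq_norm h)"
      by (rule integrable_power2_add(3)[OF _ _ R2(1) h2]) auto
    also have "\<dots> \<le> 2 * ((A / \<rho>)\<^sup>2 * S\<^sup>2 * ?G) + 2 * (2 ^ CARD('n) * (pi * fourier_const CARD('n) A / (2 * \<rho>))\<^sup>2 * ?G)"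
      by (intro add_mono mult_left_mono R2(2) hB) auto
    also have "\<dots> = (A / \<rho>)\<^sup>2 * (2 * S\<^sup>2 + sing_const CARD('n)) * ?G"
    proof -
      have "pi * fourier_const CARD('n) A / (2 * \<rho>) = (A / \<rho>) * (pi * (1 + real CARD('n)) / 2)"
        by (simp add: fourier_const_def mult_ac)
      then show ?thesis by (simp only: power_mult_distrib distrib_left distrib_right mult_ac)
    qed
    finally show "(LINT x|lborel. (?R x + h x)\<^sup>2) \<le> (A / \<rho>)\<^sup>2 * (2 * S\<^sup>2 + sing_const CARD('n)) * ?G" .
  next
    fix \<eta> r
    assume \<eta>: "\<And>x. \<eta> differentiable (at x)" "continuous_on UNIV (partial j \<eta>)" "\<And>x. norm x > r \<Longrightarrow> \<eta> x = 0"
      and \<eta>\<Omega>: "\<And>x. x \<notin> \<Omega> \<Longrightarrow> \<eta> x = 0"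
    have c: "continuous_on UNIV \<eta>" by (rule differentiable_imp_continuous_UNIV[OF \<eta>(1)])
    have p0: "partial j \<eta> x = 0" if "norm x > r" for x by (rule partial_eq_0_outside[OF \<eta>(3) that])
    obtain M where M: "\<And>x. norm (\<eta> x) \<le> M" using integrable_continuous_bounded_support(2)[OF c \<eta>(3)] by blast
    obtain M' where M': "\<And>x. norm (partial j \<eta> x) \<le> M'" using integrable_continuous_bounded_support(2)[OF \<eta>(2) p0] by blast
    have [measurable]: "\<eta> \<in> borel_measurable borel" "partial j \<eta> \<in> borel_measurable borel"
      using c \<eta>(2) by (auto intro: borel_measurable_continuous_onI)
    have \<eta>2: "integrable lborel (\<lambda>x. (\<eta> x)\<^sup>2)"
      by (rule integrable_continuous_bounded_support(1)[where r = r]) (auto intro!: continuous_intros c \<eta>(3))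
    have iprod: "integrable lborel (\<lambda>x. u x * \<eta> x)" if "integrable lborel u" for u
      using that by (rule Bochner_Integration.integrable_bound[OF integrable_mult_right[of M]])
        (use that M in \<open>auto simp: abs_mult mult.commute[of "\<bar>u _\<bar>"] intro!: AE_I2 mult_right_mono order_trans[OF M abs_ge_self, simplified]\<close>)
    \<comment> \<open>The truncation acts on the weight before differentiation. Multiplied by t it
      splits at 2 into the regular weight and a truncated singular weight
      (\<open>tw\<close>).\<close>
    define w' where "w' n t = indicator {1..<2 + real n} t * ?w t" for n t
    have ww: "weight (w' n)" for n unfolding w'_def by (rule weight_mult_indicator[OF weights(1)]) simp
    have wi: "integrable lborel (\<lambda>t. w' n t / t ^ CARD('n))" for n
    proof (rule Bochner_Integration.integrable_bound[OF integrable_bog_weight[OF l]])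
      show "(\<lambda>t. w' n t / t ^ CARD('n)) \<in> borel_measurable lborel" unfolding w'_def by measurable
      show "AE t in lborel. norm (w' n t / t ^ CARD('n)) \<le> norm (?w t / t ^ CARD('n))"
        by (rule AE_I2) (simp add: w'_def indicator_def)
    qed
    have tw: "(\<lambda>t. t * w' n t) = (\<lambda>t. cut_weight CARD('n) l 1 2 t + cut_weight CARD('n) l 2 (2 + real n) t)" for n
      by (auto simp: fun_eq_iff w'_def indicator_def)
    have twi: "integrable lborel (\<lambda>t. t * w' n t / t ^ CARD('n))" for n
    proof -
      have "t * w' n t / t ^ CARD('n) = cut_weight CARD('n) l 1 2 t / t ^ CARD('n) + cut_weight CARD('n) l 2 (2 + real n) t / t ^ CARD('n)" for t
        using fun_cong[OF tw[of n], of t] by (simp only: add_divide_distrib)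
      then show ?thesis using Bochner_Integration.integrable_add[OF integrable_bog_weight_cut_div[OF l, of 1 2] integrable_bog_weight_cut_div[OF l, of 2 "2 + real n"]] by (simp only:)
    qed
    have iR: "integrable lborel ?R" "integrable lborel (?W n)" for n
      by (rule integrable_bog_op[OF weights(2) integrable_bog_weight_cut_div[OF l] phi_int(2) g1])+
    have parts: "(LINT x|lborel. bog_op (w' n) \<phi> g x * partial j \<eta> x) = - ((LINT x|lborel. ?R x * \<eta> x) + (LINT x|lborel. ?W n x * \<eta> x))" for n
    proof -
      have "(LINT x|lborel. bog_op (w' n) \<phi> g x * partial j \<eta> x) = - (LINT x|lborel. bog_op (\<lambda>t. t * w' n t) (partial j \<phi>) g x * \<eta> x)"
        by (rule bog_op_by_parts[OF ww wi twi \<phi> g1 \<eta>])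
      also have "(LINT x|lborel. bog_op (\<lambda>t. t * w' n t) (partial j \<phi>) g x * \<eta> x) = (LINT x|lborel. ?R x * \<eta> x + ?W n x * \<eta> x)"
      proof (rule integral_cong_AE)
        have "AE x in lborel. bog_op (\<lambda>t. cut_weight CARD('n) l 1 2 t + cut_weight CARD('n) l 2 (2 + real n) t) (partial j \<phi>) g x = ?R x + ?W n x"
          by (rule bog_op_add_AE[OF weights(2) integrable_bog_weight_cut_div[OF l] weights(2) integrable_bog_weight_cut_div[OF l] phi_int(2) g1])
        then show "AE x in lborel. bog_op (\<lambda>t. t * w' n t) (partial j \<phi>) g x * \<eta> x = ?R x * \<eta> x + ?W n x * \<eta> x"
          unfolding tw by eventually_elim (simp only: distrib_right)
        show "(\<lambda>x. bog_op (\<lambda>t. t * w' n t) (partial j \<phi>) g x * \<eta> x) \<in> borel_measurable lborel"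
          unfolding tw by measurable
      qed measurable
      also have "\<dots> = (LINT x|lborel. ?R x * \<eta> x) + (LINT x|lborel. ?W n x * \<eta> x)"
        by (rule Bochner_Integration.integral_add) (intro iprod iR)+
      finally show ?thesis .
    qed
    have lim1: "(\<lambda>n. LINT x|lborel. bog_op (w' n) \<phi> g x * partial j \<eta> x) \<longlonglongrightarrow> (LINT x|lborel. bog_op ?w \<phi> g x * partial j \<eta> x)"
    proof -
      let ?K = "\<lambda>v q. (slice_integrand v \<phi> g (fst q) (snd q)) *\<^sub>R partial j \<eta> (fst q)"
      have e: "(LINT x|lborel. bog_op v \<phi> g x * partial j \<eta> x) = (LINT q|lborel. ?K v q)"
        if "weight v" "integrable lborel (\<lambda>t. v t / t ^ CARD('n))" for v
        using integral_bog_op_scaleR[OF that phi_int(1) g1 _ M'] by simp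
      have i: "integrable lborel (\<lambda>q. norm (?K ?w q))"
        by (intro integrable_norm bog_op_scaleR_integrable[OF weights(1) integrable_bog_weight[OF l] phi_int(1) g1 _ M']) measurable
      have [measurable]: "w' n \<in> borel_measurable borel" for n by (rule weight_D(1)[OF ww])
      show ?thesis
        unfolding e[OF ww wi] e[OF weights(1) integrable_bog_weight[OF l]]
      proof (rule integral_dominated_convergence[OF _ _ i])
        show "AE q in lborel. (\<lambda>n. ?K (w' n) q) \<longlonglongrightarrow> ?K ?w q"
        proof (rule AE_I2)
          fix q :: "(real, 'n) vec \<times> real \<times> (real, 'n) vec"
          \<comment> \<open>At a fixed point the truncation is inactive as soon as n exceeds its
            t-coordinate.\<close>
          obtain m :: nat where m: "fst (snd q) < real m" using reals_Archimedean2 by blast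
          have "w' n (fst (snd q)) = ?w (fst (snd q))" if "n \<ge> m" for n
            using m that by (auto simp: w'_def indicator_def bog_weight_def)
          then have "\<forall>\<^sub>F n in sequentially. ?K (w' n) q = ?K ?w q"
            by (intro eventually_sequentiallyI[of m]) simp
          then show "(\<lambda>n. ?K (w' n) q) \<longlonglongrightarrow> ?K ?w q" by (rule tendsto_eventually)
        qed
        show "AE q in lborel. norm (?K (w' n) q) \<le> norm (?K ?w q)" for n
          by (rule AE_I2) (simp add: w'_def indicator_def)
      qed measurable
    qed
    have lim2: "(\<lambda>n. LINT x|lborel. ?W n x * \<eta> x) \<longlonglongrightarrow> (LINT x|lborel. h x * \<eta> x)"
    proof -
      let ?f = "\<lambda>n x. indicat_real \<Omega> x * ?W n x"
      \<comment> \<open>The limit is known for the restrictions to \<Omega> only;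
        \<open>\<eta>\<close> vanishes elsewhere, so the indicator may be inserted.\<close>
      have W\<Omega>: "(\<lambda>x. ?W n x * \<eta> x) = (\<lambda>x. ?f n x * \<eta> x)" for n
        using \<eta>\<Omega> by (auto simp: fun_eq_iff indicator_def)
      have f2: "integrable lborel (\<lambda>x. (?f n x)\<^sup>2)" for n
      proof -
        have sq: "(indicat_real \<Omega> x * u)\<^sup>2 = indicat_real \<Omega> x * u\<^sup>2" for x u
          by (simp add: indicator_def)
        show ?thesis
          unfolding sq using integrable_mult_indicator[OF _ bog_op_sing(1)[of 2 "2 + real n" j], of \<Omega>] by simp
      qed
      have hf2: "integrable lborel (\<lambda>x. (h x - ?f n x)\<^sup>2)" for n
        by (rule integrable_power2_add(2)[OF _ _ h2 f2]) measurable
      have ih: "integrable lborel (\<lambda>x. h x * \<eta> x)" by (rule integrable_mult_L2[OF _ _ h2 \<eta>2]) auto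
      have bound: "\<bar>(LINT x|lborel. h x * \<eta> x) - (LINT x|lborel. ?W n x * \<eta> x)\<bar> \<le> sqrt ((LINT x|lborel. (h x - ?f n x)\<^sup>2) * (LINT x|lborel. (\<eta> x)\<^sup>2))" for n
      proof -
        have "(LINT x|lborel. h x * \<eta> x) - (LINT x|lborel. ?W n x * \<eta> x) = (LINT x|lborel. (h x - ?f n x) * \<eta> x)"
        proof -
          have "integrable lborel (\<lambda>x. ?f n x * \<eta> x)" using iprod[OF iR(2)] unfolding W\<Omega> .
          then show ?thesis unfolding W\<Omega> left_diff_distrib by (rule Bochner_Integration.integral_diff[OF ih, symmetric])
        qed
        then have "\<bar>(LINT x|lborel. h x * \<eta> x) - (LINT x|lborel. ?W n x * \<eta> x)\<bar> \<le> (LINT x|lborel. \<bar>(h x - ?f n x) * \<eta> x\<bar>)"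
          by (simp only: integral_abs_bound)
        also have "\<dots> \<le> sqrt ((LINT x|lborel. (h x - ?f n x)\<^sup>2) * (LINT x|lborel. (\<eta> x)\<^sup>2))"
          by (intro real_le_rsqrt Cauchy_Schwarz_integral hf2 \<eta>2) measurable
        finally show ?thesis .
      qed
      have "(\<lambda>n. sqrt ((LINT x|lborel. (h x - ?f n x)\<^sup>2) * (LINT x|lborel. (\<eta> x)\<^sup>2))) \<longlonglongrightarrow> sqrt (0 * (LINT x|lborel. (\<eta> x)\<^sup>2))"
        by (intro tendsto_intros hlim)
      then have z: "(\<lambda>n. sqrt ((LINT x|lborel. (h x - ?f n x)\<^sup>2) * (LINT x|lborel. (\<eta> x)\<^sup>2))) \<longlonglongrightarrow> 0" by simp
      show ?thesis
        by (rule LIM_zero_cancel, rule Lim_null_comparison[OF _ z])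
           (use bound in \<open>simp add: abs_minus_commute\<close>)
    qed
    have "(\<lambda>n. LINT x|lborel. bog_op (w' n) \<phi> g x * partial j \<eta> x) \<longlonglongrightarrow> - ((LINT x|lborel. ?R x * \<eta> x) + (LINT x|lborel. h x * \<eta> x))"
      unfolding parts by (intro tendsto_intros lim2)
    with lim1 have "(LINT x|lborel. bog_op ?w \<phi> g x * partial j \<eta> x) = - ((LINT x|lborel. ?R x * \<eta> x) + (LINT x|lborel. h x * \<eta> x))"
      by (rule LIMSEQ_unique)
    also have "(LINT x|lborel. ?R x * \<eta> x) + (LINT x|lborel. h x * \<eta> x) = (LINT x|lborel. ?R x * \<eta> x + h x * \<eta> x)"
      by (rule Bochner_Integration.integral_add[symmetric, OF iprod[OF iR(1)] integrable_mult_L2[OF _ _ h2 \<eta>2]]) auto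
    finally show "(LINT x|lborel. bog_op ?w \<phi> g x * partial j \<eta> x) = - (LINT x|lborel. (?R x + h x) * \<eta> x)"
      by (simp only: distrib_right)
  qed
qed

end


section \<open>The fundamental lemma of the calculus of variations\<close>


lemma has_derivative_shift_iff:
  "((\<lambda>y. f (y - x)) has_derivative f') (at y) \<longleftrightarrow> (f has_derivative f') (at (y - x))"
proof
  assume "((\<lambda>y. f (y - x)) has_derivative f') (at y)"
  then have "((\<lambda>z. f ((z + x) - x)) has_derivative (\<lambda>h. f' h)) (at (y - x))"
    by (intro has_derivative_compose[where f = "\<lambda>z. z + x" and g = "\<lambda>y. f (y - x)"]) (auto intro!: derivative_eq_intros)
  then show "(f has_derivative f') (at (y - x))" by simp
next
  assume "(f has_derivative f') (at (y - x))"
  then show "((\<lambda>y. f (y - x)) has_derivative f') (at y)"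
    by (intro has_derivative_compose[where f = "\<lambda>y. y - x" and g = f and g' = f' and f' = "\<lambda>h. h"]) (auto intro!: derivative_eq_intros)
qed

lemma partial_shift: "partial i (\<lambda>y. f (y - x)) = (\<lambda>y. partial i f (y - x))"
  by (rule ext) (simp add: partial_def frechet_derivative_def has_derivative_shift_iff)

lemma partials_shift: "partials is (\<lambda>y. f (y - x)) = (\<lambda>y. partials is f (y - x))"
  by (induction "is") (simp_all add: partial_shift)

lemma smooth_shift: "smooth f \<Longrightarrow> smooth (\<lambda>y. f (y - x))"
  by (simp add: smooth_def partials_shift differentiable_def has_derivative_shift_iff)

lemma test_function_shift:
  assumes "test_function (ball 0 e) f" "ball x e \<subseteq> U"
  shows "test_function U (\<lambda>y. f (y - x))"
proof -
  have eq: "{y. f (y - x) \<noteq> 0} = (\<lambda>y. x + y) ` {y. f y \<noteq> 0}"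
    by (force simp: image_iff)
  have cl: "closure {y. f (y - x) \<noteq> 0} = (\<lambda>y. x + y) ` closure {y. f y \<noteq> 0}"
    unfolding eq by (rule closure_translation)
  show ?thesis
    unfolding test_function_def cl
  proof (intro conjI)
    show "smooth (\<lambda>y. f (y - x))" using assms(1) by (simp add: test_function_def smooth_shift)
    show "compact ((\<lambda>y. x + y) ` closure {y. f y \<noteq> 0})"
      using assms(1) unfolding test_function_def by (intro compact_translation) blast
    have "(\<lambda>y. x + y) ` closure {y. f y \<noteq> 0} \<subseteq> (\<lambda>y. x + y) ` ball 0 e"
      using assms(1) by (intro image_mono) (simp add: test_function_def)
    also have "\<dots> \<subseteq> ball x e" by (auto simp: dist_norm)
    also note assms(2)
    finally show "(\<lambda>y. x + y) ` closure {y. f y \<noteq> 0} \<subseteq> U" .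
  qed
qed

lemma smooth_D:
  assumes "smooth f"
  shows "f differentiable (at x)" "partial i f differentiable (at x)" "continuous_on UNIV f"
    "continuous_on UNIV (partial i f)" "continuous_on UNIV (partial i (partial j f))"
proof -
  have *: "partials is f differentiable (at x)" for "is" x using assms by (simp add: smooth_def)
  show d: "f differentiable (at x)" "partial i f differentiable (at x)" for x
    using *[of "[]"] *[of "[i]"] by simp_all
  show "continuous_on UNIV f" "continuous_on UNIV (partial i f)"
    by (intro differentiable_imp_continuous_UNIV d)+
  show "continuous_on UNIV (partial i (partial j f))"
    using *[of "[i, j]"] by (intro differentiable_imp_continuous_UNIV) simp
qed

lemma test_function_D:
  assumes "test_function U f"
  shows "smooth f" "\<exists>r. \<forall>x. norm x > r \<longrightarrow> f x = 0" "x \<notin> U \<Longrightarrow> f x = 0" "x \<notin> U \<Longrightarrow> partial i f x = 0"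
proof -
  let ?K = "closure {x. f x \<noteq> 0}"
  show "smooth f" using assms by (simp add: test_function_def)
  have 0: "f x = 0" if "x \<notin> ?K" for x using that closure_subset[of "{x. f x \<noteq> 0}"] by blast
  have "bounded ?K" using assms by (simp add: test_function_def compact_imp_bounded)
  then obtain r where "\<And>x. x \<in> ?K \<Longrightarrow> norm x \<le> r" by (auto simp: bounded_iff)
  then show "\<exists>r. \<forall>x. norm x > r \<longrightarrow> f x = 0" using 0 by (meson not_le)
  assume "x \<notin> U"
  then have x: "x \<notin> ?K" using assms by (auto simp: test_function_def)
  then show "f x = 0" by (rule 0)
  have "(f has_derivative (\<lambda>_. 0)) (at x)"
  proof (rule has_derivative_transform_within_open[OF has_derivative_const[of 0]])
    show "open (- ?K)" by (intro open_Compl closed_closure)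
    show "x \<in> - ?K" using x by simp
    show "0 = f y" if "y \<in> - ?K" for y using 0[of y] that by simp
  qed
  then show "partial i f x = 0"
    unfolding partial_def by (metis frechet_derivative_at)
qed

lemma AE_not_in_cbox_diff_box: "AE x in lborel. x \<notin> cbox a b - box a (b::'a::euclidean_space)"
proof (rule AE_not_in, rule null_setsI)
  have "emeasure lborel (cbox a b - box a b) = emeasure lborel (cbox a b) - emeasure lborel (box a b)"
    using box_subset_cbox[of a b] emeasure_lborel_box_finite[of a b] by (intro emeasure_Diff) auto
  also have "\<dots> = 0" by (simp add: emeasure_lborel_box_eq emeasure_lborel_cbox_eq)
  finally show "emeasure lborel (cbox a b - box a b) = 0" .
qed auto

text \<open>The positive and the negative part of \<open>f\<close> are densities of two finite
  measures. They agree on boxes, an intersection-stable generator, and hence everywhere; evaluating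
  both on {f > 0} and on {f < 0} makes each part vanish.\<close>

lemma AE_eq_0_if_box_integrals_eq_0:
  fixes f :: "'a::euclidean_space \<Rightarrow> real"
  assumes f: "integrable lborel f" and cbox: "\<And>a b. (LINT x|lborel. indicator (cbox a b) x * f x) = 0"
  shows "AE x in lborel. f x = 0"
proof -
  have [measurable]: "f \<in> borel_measurable borel" using f by auto
  let ?P = "density lborel (\<lambda>x. ennreal (f x))" and ?N = "density lborel (\<lambda>x. ennreal (- f x))"
  have fin: "(\<integral>\<^sup>+x. ennreal (f x) \<partial>lborel) < \<infinity>" "(\<integral>\<^sup>+x. ennreal (- f x) \<partial>lborel) < \<infinity>"
  proof -
    have n: "(\<integral>\<^sup>+x. ennreal (norm (f x)) \<partial>lborel) < \<infinity>" using f by (simp add: integrable_iff_bounded)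
    show "(\<integral>\<^sup>+x. ennreal (f x) \<partial>lborel) < \<infinity>" "(\<integral>\<^sup>+x. ennreal (- f x) \<partial>lborel) < \<infinity>"
      by (rule order.strict_trans1[OF nn_integral_mono n], simp add: ennreal_leI)+
  qed
  have box: "(LINT x|lborel. indicator (box a b) x * f x) = 0" for a b
  proof -
    have "(LINT x|lborel. indicator (box a b) x * f x) = (LINT x|lborel. indicator (cbox a b) x * f x)"
    proof (rule integral_cong_AE)
      show "AE x in lborel. indicator (box a b) x * f x = indicator (cbox a b) x * f x"
        using AE_not_in_cbox_diff_box[of a b]
        by eventually_elim (use box_subset_cbox[of a b] in \<open>auto simp: indicator_def\<close>)
    qed measurable
    then show ?thesis by (simp only: cbox)
  qed
  have eqB: "emeasure ?P (box a b) = emeasure ?N (box a b)" for a b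
  proof -
    let ?u = "\<lambda>x. indicator (box a b) x * f x"
    have i: "integrable lborel ?u" using integrable_mult_indicator[OF _ f, of "box a b"] by simp
    have "enn2real (\<integral>\<^sup>+x. ennreal (?u x) \<partial>lborel) = enn2real (\<integral>\<^sup>+x. ennreal (- ?u x) \<partial>lborel)"
      using real_lebesgue_integral_def[OF i] box by simp
    moreover have "(\<integral>\<^sup>+x. ennreal (?u x) \<partial>lborel) < \<infinity>" "(\<integral>\<^sup>+x. ennreal (- ?u x) \<partial>lborel) < \<infinity>"
      by (rule order.strict_trans1[OF nn_integral_mono fin(1)], simp add: indicator_def ennreal_leI,
          rule order.strict_trans1[OF nn_integral_mono fin(2)], simp add: indicator_def ennreal_leI)
    ultimately have "(\<integral>\<^sup>+x. ennreal (?u x) \<partial>lborel) = (\<integral>\<^sup>+x. ennreal (- ?u x) \<partial>lborel)"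
      by (metis ennreal_enn2real infinity_ennreal_def)
    moreover have "ennreal (?u x) = ennreal (f x) * indicator (box a b) x" "ennreal (- ?u x) = ennreal (- f x) * indicator (box a b) x" for x
      by (auto simp: indicator_def)
    ultimately show ?thesis by (simp add: emeasure_density)
  qed
  have PN: "?P = ?N"
  proof (rule measure_eqI_generator_eq[where E = "range (\<lambda>(a, b). box a b)" and \<Omega> = UNIV and A = "\<lambda>n::nat. box (- real n *\<^sub>R One) (real n *\<^sub>R One)"])
    show "Int_stable (range (\<lambda>(a, b). box a b :: 'a set))"
      by (auto simp: Int_stable_def box_Int_box)
    show "sets ?P = sigma_sets UNIV (range (\<lambda>(a, b). box a b))" "sets ?N = sigma_sets UNIV (range (\<lambda>(a, b). box a b))"
      by (simp_all add: borel_eq_box)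
    show "(\<Union>i::nat. box (- real i *\<^sub>R One) (real i *\<^sub>R One)) = (UNIV :: 'a set)"
      using UN_box_eq_UNIV by simp
    show "emeasure ?P (box (- real i *\<^sub>R One) (real i *\<^sub>R One)) \<noteq> \<infinity>" for i
    proof -
      have "emeasure ?P (box (- real i *\<^sub>R One) (real i *\<^sub>R One)) \<le> emeasure ?P UNIV" by (rule emeasure_mono) auto
      also have "\<dots> < \<infinity>" using fin(1) by (simp add: emeasure_density)
      finally show ?thesis by simp
    qed
  qed (auto simp: eqB)
  have "emeasure ?P {x. f x > 0} = emeasure ?N {x. f x > 0}" by (simp only: PN)
  moreover have "emeasure ?N {x. f x > 0} = (\<integral>\<^sup>+x. 0 \<partial>(lborel :: 'a measure))"
    by (subst emeasure_density, measurable, intro nn_integral_cong) (auto simp: indicator_def ennreal_neg)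
  moreover have "emeasure ?P {x. f x > 0} = (\<integral>\<^sup>+x. ennreal (f x) \<partial>lborel)"
    by (subst emeasure_density, measurable, intro nn_integral_cong) (auto simp: indicator_def ennreal_neg)
  ultimately have "(\<integral>\<^sup>+x. ennreal (f x) \<partial>lborel) = 0" by simp
  then have "AE x in lborel. ennreal (f x) = 0" by (subst (asm) nn_integral_0_iff_AE) auto
  then have 1: "AE x in lborel. f x \<le> 0" by eventually_elim (simp add: ennreal_eq_0_iff)
  have "emeasure ?P {x. f x < 0} = emeasure ?N {x. f x < 0}" by (simp only: PN)
  moreover have "emeasure ?P {x. f x < 0} = (\<integral>\<^sup>+x. 0 \<partial>(lborel :: 'a measure))"
    by (subst emeasure_density, measurable, intro nn_integral_cong) (auto simp: indicator_def ennreal_neg)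
  moreover have "emeasure ?N {x. f x < 0} = (\<integral>\<^sup>+x. ennreal (- f x) \<partial>lborel)"
    by (subst emeasure_density, measurable, intro nn_integral_cong) (auto simp: indicator_def ennreal_neg)
  ultimately have "(\<integral>\<^sup>+x. ennreal (- f x) \<partial>lborel) = 0" by simp
  then have "AE x in lborel. ennreal (- f x) = 0" by (subst (asm) nn_integral_0_iff_AE) auto
  then have 2: "AE x in lborel. f x \<ge> 0" by eventually_elim (simp add: ennreal_eq_0_iff)
  from 1 2 show ?thesis by eventually_elim simp
qed

text \<open>The test functions are mollified indicators of boxes. The mollifiers are a hypothesis,
  because admissible cut-offs on small balls will supply them; they may change sign, hence the bound
  \<open>C\<close> on their L^1 norms, which also yields the majorant. Countably many boxes then
  exhaust \<open>U\<close>.\<close>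

lemma fundamental_lemma:
  fixes h :: "(real, 'n::{finite,linorder}) vec \<Rightarrow> real" and U :: "(real, 'n) vec set"
  assumes moll: "\<And>e. e > 0 \<Longrightarrow> \<exists>f. test_function (ball (0 :: (real, 'n) vec) e) f \<and> (LINT x|lborel. f x) = 1 \<and> (LINT x|lborel. \<bar>f x\<bar>) \<le> C"
    and U: "open U" and h: "integrable lborel h" and h0: "\<And>x. x \<notin> U \<Longrightarrow> h x = 0"
    and test: "\<And>f. test_function U f \<Longrightarrow> (LINT x|lborel. h x * f x) = 0"
  shows "AE x in lborel. h x = 0"
proof -
  have [measurable]: "h \<in> borel_measurable borel" using h by auto
  have boxU: "(LINT x|lborel. indicator (cbox a b) x * h x) = 0" if ab: "cbox a b \<subseteq> U" for a b
  proof (cases "cbox a b = {}")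
    case False
    \<comment> \<open>The box keeps a positive distance to the complement of \<open>U\<close>, so
      mollifiers of radius at most \<open>d\<close> centred at its points are test functions in
      \<open>U\<close>.\<close>
    obtain d where d: "d > 0" "\<And>x. x \<in> cbox a b \<Longrightarrow> ball x d \<subseteq> U"
      using compact_subset_open_imp_ball_epsilon_subset[OF compact_cbox U ab] by (metis UN_subset_iff)
    define e where "e n = d * inverse (real (Suc n))" for n
    have e: "e n > 0" "e n \<le> d" for n using d(1) by (auto simp: e_def divide_simps)
    have e0: "e \<longlonglongrightarrow> 0" unfolding e_def using tendsto_mult_right_zero[OF LIMSEQ_inverse_real_of_nat] .
    have "\<forall>n. \<exists>f. test_function (ball (0 :: (real, 'n) vec) (e n)) f \<and> (LINT x|lborel. f x) = 1 \<and> (LINT x|lborel. \<bar>f x\<bar>) \<le> C"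
      by (rule allI, rule moll, rule e(1))
    from choice[OF this] obtain f :: "nat \<Rightarrow> (real, 'n) vec \<Rightarrow> real" where "\<forall>n. test_function (ball 0 (e n)) (f n) \<and> (LINT x|lborel. f n x) = 1 \<and> (LINT x|lborel. \<bar>f n x\<bar>) \<le> C" ..
    then have f: "\<And>n. test_function (ball 0 (e n)) (f n)" "\<And>n. (LINT x|lborel. f n x) = 1" "\<And>n. (LINT x|lborel. \<bar>f n x\<bar>) \<le> C"
      by simp_all
    have fi: "integrable lborel (f n)" for n
    proof -
      obtain r where "\<forall>x. norm x > r \<longrightarrow> f n x = 0" using test_function_D(2)[OF f(1)] ..
      then show ?thesis
        by (intro integrable_continuous_bounded_support(1)[OF smooth_D(3)[OF test_function_D(1)[OF f(1)]], of r]) simp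
    qed
    have [measurable]: "f n \<in> borel_measurable borel" for n using fi[of n] by auto
    let ?I = "indicat_real (cbox a b)"
    \<comment> \<open>The mollified indicator of the box. Exchanging the integrals reduces testing
      with it to testing with translates of the mollifier.\<close>
    define m where "m n y = (LINT x|lborel. ?I x * f n (y - x))" for n y
    have reflect: "integrable lborel (\<lambda>x. u (y - x))" "(LINT x|lborel. u (y - x)) = (LINT x|lborel. u x)"
      if "integrable lborel u" for u :: "(real, 'n) vec \<Rightarrow> real" and y
      using integrable_lborel_affine[OF that, of "-1" y] integral_lborel_affine[of u "-1" y] that by auto
    have iI: "integrable lborel (\<lambda>x. ?I x * f n (y - x))" for n y
      using integrable_mult_indicator[OF _ reflect(1)[OF fi], of "cbox a b" n y] by simp
    have mb: "\<bar>m n y\<bar> \<le> C" for n y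
    proof -
      have "\<bar>m n y\<bar> \<le> (LINT x|lborel. \<bar>?I x * f n (y - x)\<bar>)" unfolding m_def by (rule integral_abs_bound)
      also have "\<dots> \<le> (LINT x|lborel. \<bar>f n (y - x)\<bar>)"
        by (rule integral_mono) (use iI reflect(1)[OF fi] in \<open>auto simp: indicator_def\<close>)
      also have "\<dots> = (LINT x|lborel. \<bar>f n x\<bar>)" by (rule reflect(2)) (use fi in auto)
      finally show ?thesis using f(3)[of n] by simp
    qed
    have C0: "C \<ge> 0" using mb[of 0 0] by linarith
    have mm [measurable]: "m n \<in> borel_measurable borel" for n unfolding m_def[abs_def] by measurable
    have zero: "(LINT y|lborel. h y * m n y) = 0" for n
    proof -
      have i2: "integrable lborel (\<lambda>p. ?I (fst p) * (h (snd p) * f n (snd p - fst p)))"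
      proof (rule integrableI_bounded)
        have "(\<integral>\<^sup>+p. ennreal (norm (?I (fst p) * (h (snd p) * f n (snd p - fst p)))) \<partial>lborel) =
            (\<integral>\<^sup>+y. ennreal \<bar>h y\<bar> * (\<integral>\<^sup>+x. ennreal \<bar>?I x * f n (y - x)\<bar> \<partial>lborel) \<partial>lborel)"
          by (subst nn_integral_lborel_snd, measurable, subst nn_integral_cmult[symmetric])
             (simp_all add: abs_mult ennreal_mult' mult_ac)
        also have "\<dots> \<le> (\<integral>\<^sup>+y. ennreal \<bar>h y\<bar> * ennreal C \<partial>lborel)"
        proof (intro nn_integral_mono mult_left_mono)
          fix y
          have "(\<integral>\<^sup>+x. ennreal \<bar>?I x * f n (y - x)\<bar> \<partial>lborel) = ennreal (LINT x|lborel. \<bar>?I x * f n (y - x)\<bar>)"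
            by (rule nn_integral_eq_integral) (use iI in auto)
          also have "(LINT x|lborel. \<bar>?I x * f n (y - x)\<bar>) \<le> (LINT x|lborel. \<bar>f n (y - x)\<bar>)"
            by (rule integral_mono) (use iI reflect(1)[OF fi] in \<open>auto simp: indicator_def\<close>)
          also have "\<dots> = (LINT x|lborel. \<bar>f n x\<bar>)" by (rule reflect(2)) (use fi in auto)
          finally show "(\<integral>\<^sup>+x. ennreal \<bar>?I x * f n (y - x)\<bar> \<partial>lborel) \<le> ennreal C"
            using f(3)[of n] by (meson ennreal_leI order_trans)
        qed simp
        also have "\<dots> < \<infinity>" using h by (simp add: nn_integral_multc integrable_iff_bounded ennreal_mult_less_top)
        finally show "(\<integral>\<^sup>+p. ennreal (norm (?I (fst p) * (h (snd p) * f n (snd p - fst p)))) \<partial>lborel) < \<infinity>" .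
      qed measurable
      have "(LINT y|lborel. h y * f n (y - x)) = 0" if "x \<in> cbox a b" for x
        using d(2)[OF that] e(2)[of n] by (intro test test_function_shift[OF f(1)]) (meson subset_ball order_trans)
      then have 0: "(LINT y|lborel. ?I x * (h y * f n (y - x))) = 0" for x
        by (cases "x \<in> cbox a b") simp_all
      have "(LINT y|lborel. h y * m n y) = (LINT y|lborel. LINT x|lborel. ?I x * (h y * f n (y - x)))"
        unfolding m_def integral_mult_right_zero[symmetric] by (simp only: mult.left_commute)
      also have "\<dots> = (LINT x|lborel. LINT y|lborel. ?I x * (h y * f n (y - x)))"
        using integral_lborel_fst[OF i2] integral_lborel_snd[OF i2] by simp
      finally show ?thesis by (simp only: 0 Bochner_Integration.integral_zero)
    qed
    \<comment> \<open>Off the boundary of the box the sequence is eventually constant, because then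
      a small ball lies entirely inside or entirely outside; the boundary is a null set.\<close>
    have lim: "(\<lambda>n. m n y) \<longlonglongrightarrow> ?I y" if y: "y \<notin> cbox a b - box a b" for y
    proof -
      have fz: "f n z = 0" if "norm z \<ge> e n" for n z
        by (rule test_function_D(3)[OF f(1)]) (use that in simp)
      consider "y \<in> box a b" | "y \<notin> cbox a b" using y by blast
      then show ?thesis
      proof cases
        case 1
        then obtain s where s: "s > 0" "ball y s \<subseteq> box a b" using open_box open_contains_ball by blast
        have "\<forall>\<^sub>F n in sequentially. e n < s" using e0 s(1) by (rule order_tendstoD)
        then have "\<forall>\<^sub>F n in sequentially. m n y = ?I y"
        proof eventually_elim
          case (elim n)
          have "?I x * f n (y - x) = f n (y - x)" for x
          proof (cases "norm (y - x) < e n")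
            case True
            then have "x \<in> cbox a b" using s(2) elim box_subset_cbox by (force simp: dist_norm)
            then show ?thesis by simp
          qed (simp add: fz)
          then have "m n y = (LINT x|lborel. f n (y - x))" by (simp only: m_def)
          also have "\<dots> = 1" using reflect(2)[OF fi] f(2) by simp
          finally show ?case using 1 box_subset_cbox by (auto simp: indicator_def)
        qed
        then show ?thesis by (rule tendsto_eventually)
      next
        case 2
        have "open (- cbox a b)" by (rule open_Compl[OF closed_cbox])
        with 2 obtain s where s: "s > 0" "ball y s \<subseteq> - cbox a b"
          unfolding open_contains_ball by blast
        have "\<forall>\<^sub>F n in sequentially. e n < s" using e0 s(1) by (rule order_tendstoD)
        then have "\<forall>\<^sub>F n in sequentially. m n y = ?I y"
        proof eventually_elim
          case (elim n)
          have "?I x * f n (y - x) = 0" for x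
          proof (cases "norm (y - x) < e n")
            case True
            then have "x \<notin> cbox a b" using s(2) elim by (force simp: dist_norm)
            then show ?thesis by simp
          qed (simp add: fz)
          then have "m n y = 0" by (simp only: m_def Bochner_Integration.integral_zero)
          then show ?case using 2 by simp
        qed
        then show ?thesis by (rule tendsto_eventually)
      qed
    qed
    have "(\<lambda>n. LINT y|lborel. h y * m n y) \<longlonglongrightarrow> (LINT y|lborel. h y * ?I y)"
    proof (rule integral_dominated_convergence)
      show "integrable lborel (\<lambda>y. C * \<bar>h y\<bar>)" using h by simp
      show "AE y in lborel. (\<lambda>n. h y * m n y) \<longlonglongrightarrow> h y * ?I y"
        using AE_not_in_cbox_diff_box[of a b] by eventually_elim (intro tendsto_intros lim)
      show "AE y in lborel. norm (h y * m n y) \<le> C * \<bar>h y\<bar>" for n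
      proof (rule AE_I2)
        fix y
        have "norm (h y * m n y) = \<bar>m n y\<bar> * \<bar>h y\<bar>" by (simp add: abs_mult)
        also have "\<dots> \<le> C * \<bar>h y\<bar>" by (rule mult_right_mono[OF mb]) simp
        finally show "norm (h y * m n y) \<le> C * \<bar>h y\<bar>" .
      qed
    qed measurable
    then have "(\<lambda>n::nat. 0) \<longlonglongrightarrow> (LINT y|lborel. h y * ?I y)" by (simp only: zero)
    then show ?thesis by (simp add: LIMSEQ_const_iff mult.commute)
  qed simp
  have boxK: "AE x in lborel. indicat_real (cbox a b) x * h x = 0" if ab: "cbox a b \<subseteq> U" for a b
  proof (rule AE_eq_0_if_box_integrals_eq_0)
    show "integrable lborel (\<lambda>x. indicat_real (cbox a b) x * h x)"
      using integrable_mult_indicator[OF _ h, of "cbox a b"] by simp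
    fix c d
    have eq: "indicator (cbox c d) x * (indicat_real (cbox a b) x * h x) = indicator (cbox c d \<inter> cbox a b) x * h x" for x
      by (simp add: indicator_def)
    have "\<exists>a' b'. cbox c d \<inter> cbox a b = cbox a' b'" unfolding Int_interval by blast
    then obtain a' b' where ab': "cbox c d \<inter> cbox a b = cbox a' b'" by blast
    then show "(LINT x|lborel. indicator (cbox c d) x * (indicat_real (cbox a b) x * h x)) = 0"
      unfolding eq using boxU[of a' b'] ab by auto
  qed
  obtain D where D: "countable D" "D \<subseteq> Pow U" "\<And>X. X \<in> D \<Longrightarrow> \<exists>a b. X = cbox a b" "\<Union>D = U"
    using open_countable_Union_open_cbox[OF U] by blast
  have "AE x in lborel. indicat_real X x * h x = 0" if X: "X \<in> D" for X
  proof -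
    obtain a b where ab: "X = cbox a b" using D(3)[OF X] by blast
    have "cbox a b \<subseteq> U" using D(2) X ab by blast
    then show ?thesis unfolding ab by (rule boxK)
  qed
  then have "AE x in lborel. \<forall>X\<in>D. indicat_real X x * h x = 0"
    unfolding AE_ball_countable[OF D(1)] by blast
  then show ?thesis
  proof eventually_elim
    case (elim x)
    show ?case
    proof (cases "x \<in> U")
      case True
      then obtain X where "X \<in> D" "x \<in> X" using D(4) by blast
      then show ?thesis using elim by fastforce
    qed (rule h0)
  qed
qed


section \<open>The regular part: dependence on the volume ratio\<close>


lemma regular_weight_le:
  assumes l: "1 \<le> l" "l \<le> n" and t: "1 < t" "t < 2"
  shows "t * bog_weight n l t \<le> 2 ^ n * (t - 1) ^ (n - l)"
proof -
  have "t ^ (l - 1) \<le> 2 ^ (l - 1)" using t by (intro power_mono) auto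
  also have "(2::real) ^ (l - 1) \<le> 2 ^ n" using l by (intro power_increasing) auto
  finally have "(t - 1) ^ (n - l) * t ^ (l - 1) \<le> (t - 1) ^ (n - l) * 2 ^ n"
    using t by (intro mult_left_mono) auto
  then show ?thesis using t by (simp add: bog_weight_def mult.commute)
qed

lemma sqrt_inverse_power:
  assumes "s > 0"
  shows "sqrt (1 / s ^ n) = s powr (- (real n / 2))"
proof -
  have e: "1 / s ^ n = s powr (- real n)" using assms by (simp add: powr_minus_divide powr_realpow)
  have "sqrt (s powr (- real n)) = (s powr (- real n)) powr (1 / 2)" by (intro powr_half_sqrt[symmetric]) simp
  also have "\<dots> = s powr (- real n * (1 / 2))" by (rule powr_powr)
  finally show ?thesis unfolding e by simp
qed

text \<open>With s = t - 1 the powers of t are absorbed into 2^n, so only the behaviour at s = 0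
  remains to be estimated.\<close>

lemma regular_integral_le:
  assumes l: "1 \<le> l" "l \<le> n" and b: "\<And>s. 0 < s \<Longrightarrow> s < 1 \<Longrightarrow> s ^ (n - l) * sqrt (min (1 / s ^ n) q) \<le> b s"
    and [measurable]: "b \<in> borel_measurable borel" and q: "q \<ge> 0"
  shows "regular_mass n l q
    \<le> ennreal (2 ^ n) * (\<integral>\<^sup>+s. ennreal (indicator {0<..<1} s * b s) \<partial>lborel)"
proof -
  have "regular_mass n l q \<le>
     (\<integral>\<^sup>+t. ennreal (2 ^ n) * ennreal (indicator {0<..<1} (t - 1) * b (t - 1)) \<partial>lborel)"
  proof (rule nn_integral_mono_AE)
    have "AE t in lborel. t \<noteq> (1::real)" by (rule AE_lborel_singleton)
    then show "AE t in lborel. ennreal (indicator {1..<2} t * (t * bog_weight n l t) * sqrt (slice_bd n q t)) \<le> ennreal (2 ^ n) * ennreal (indicator {0<..<1} (t - 1) * b (t - 1))"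
    proof eventually_elim
      case (elim t)
      show ?case
      proof (cases "1 < t \<and> t < 2")
        case True
        have e: "slice_bd n q t = min (1 / (t - 1) ^ n) q" using True by (simp add: slice_bd_def)
        have "t * bog_weight n l t * sqrt (slice_bd n q t) \<le> (2 ^ n * (t - 1) ^ (n - l)) * sqrt (min (1 / (t - 1) ^ n) q)"
          unfolding e using True q by (intro mult_right_mono regular_weight_le l) auto
        also have "\<dots> \<le> 2 ^ n * b (t - 1)"
          using b[of "t - 1"] True by (simp add: mult.assoc)
        finally show ?thesis using True by (simp add: ennreal_mult'[symmetric] ennreal_leI)
      qed (use elim in \<open>auto simp: indicator_def\<close>)
    qed
  qed
  also have "\<dots> = ennreal (2 ^ n) * (\<integral>\<^sup>+t. ennreal (indicator {0<..<1} (t - 1) * b (t - 1)) \<partial>lborel)"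
    by (rule nn_integral_cmult) measurable
  also have "(\<integral>\<^sup>+t. ennreal (indicator {0<..<1} (t - 1) * b (t - 1)) \<partial>lborel) = (\<integral>\<^sup>+s. ennreal (indicator {0<..<1} s * b s) \<partial>lborel)"
    using nn_integral_lborel_affine[of "\<lambda>s. ennreal (indicator {0<..<1} s * b s)" 1 "-1"] by (simp add: algebra_simps)
  finally show ?thesis .
qed

text \<open>The volume bound is given up: s^(n - l) s^(-n/2) = s^(n/2 - l) is integrable at 0
  exactly when l < n/2 + 1, and no dependence on \<open>q\<close> is left.\<close>

lemma regular_integral_small:
  assumes l: "1 \<le> l" "l \<le> n" and small: "real l < real n / 2 + 1" and q: "q \<ge> 1"
  shows "regular_mass n l q
    \<le> ennreal (2 ^ n / (real n / 2 - real l + 1))"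
proof -
  define e where "e = real n / 2 - real l"
  have e: "e > -1" using small by (simp add: e_def)
  have b: "s ^ (n - l) * sqrt (min (1 / s ^ n) q) \<le> s powr e" if s: "0 < s" for s
  proof -
    have "s ^ (n - l) * sqrt (min (1 / s ^ n) q) \<le> s ^ (n - l) * sqrt (1 / s ^ n)"
      using s by (intro mult_left_mono real_sqrt_le_mono) auto
    also have "\<dots> = s powr (real (n - l)) * s powr (- (real n / 2))"
      using s by (simp only: sqrt_inverse_power powr_realpow)
    also have "\<dots> = s powr e"
    proof -
      have "real (n - l) + - (real n / 2) = e" using l by (simp add: e_def of_nat_diff)
      then show ?thesis by (simp only: powr_add[symmetric])
    qed
    finally show ?thesis .
  qed
  have "(\<integral>\<^sup>+s. ennreal (indicator {0<..<1} s * s powr e) \<partial>lborel) \<le> (\<integral>\<^sup>+s. ennreal (indicator {0..1} s * s powr e) \<partial>lborel)"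
    by (intro nn_integral_mono) (auto simp: indicator_def)
  also have "\<dots> = ennreal (1 powr (e + 1) / (e + 1))"
    using has_integral_powr_from_0[OF e, of 1] by (intro nn_integral_has_integral_lebesgue) auto
  finally have I: "(\<integral>\<^sup>+s. ennreal (indicator {0<..<1} s * s powr e) \<partial>lborel) \<le> ennreal (1 / (e + 1))" by simp
  have "regular_mass n l q
    \<le> ennreal (2 ^ n) * (\<integral>\<^sup>+s. ennreal (indicator {0<..<1} s * s powr e) \<partial>lborel)"
    by (rule regular_integral_le[OF l b]) (use q in auto)
  also have "\<dots> \<le> ennreal (2 ^ n) * ennreal (1 / (e + 1))" by (rule mult_left_mono[OF I]) simp
  also have "\<dots> = ennreal (2 ^ n / (e + 1))" using e by (simp add: ennreal_mult[symmetric])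
  finally show ?thesis by (simp add: e_def)
qed

text \<open>The range is split at d = q^(-1/n), where the two slice bounds s^(-n) and q coincide.
  Below d the constant bound contributes exactly Q = q^(p/n). Above d the estimate s^(-p) <= d^(-p)
  = Q leaves 1/s, and its integral is the logarithm.\<close>

lemma regular_integral_large:
  assumes l: "1 \<le> l" "l \<le> n" and large: "real l \<ge> real n / 2 + 1" and q: "q \<ge> 1"
  shows "regular_mass n l q
    \<le> ennreal (2 ^ n * (q powr ((real l - 1 - real n / 2) / n) * (1 + ln q)))"
proof -
  define p where "p = real l - 1 - real n / 2"
  define d where "d = q powr (- 1 / n)"
  have n: "n > 0" and p: "p \<ge> 0" using l large by (auto simp: p_def)
  have "q powr (- 1 / n) \<le> q powr 0" using q n by (intro powr_mono) auto
  then have d: "0 < d" "d \<le> 1" using q by (auto simp: d_def)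
  define Q where "Q = q powr (p / n)"
  have Q0: "Q \<ge> 0" by (simp add: Q_def)
  let ?b = "\<lambda>s. indicator {0..d} s * (d ^ (n - l) * sqrt q) + indicator {d..1} s * (Q * (1 / s))"
  have b: "s ^ (n - l) * sqrt (min (1 / s ^ n) q) \<le> ?b s" if s: "0 < s" "s < 1" for s
  proof (cases "s \<le> d")
    case True
    have "s ^ (n - l) * sqrt (min (1 / s ^ n) q) \<le> d ^ (n - l) * sqrt q"
      using s True q by (intro mult_mono power_mono real_sqrt_le_mono) auto
    also have "\<dots> \<le> ?b s" using s True Q0 by (auto simp: indicator_def)
    finally show ?thesis .
  next
    case False
    have "s ^ (n - l) * sqrt (min (1 / s ^ n) q) \<le> s ^ (n - l) * sqrt (1 / s ^ n)"
      using s by (intro mult_left_mono real_sqrt_le_mono) auto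
    also have "\<dots> = s powr (real (n - l)) * s powr (- (real n / 2))"
      using s by (simp only: sqrt_inverse_power powr_realpow)
    also have "\<dots> = s powr (- p) * s powr (- 1)"
    proof -
      have "real (n - l) + - (real n / 2) = - p + - 1" using l by (simp add: p_def of_nat_diff)
      then show ?thesis by (simp only: powr_add[symmetric])
    qed
    also have "\<dots> \<le> d powr (- p) * s powr (- 1)"
      using False d p by (intro mult_right_mono powr_mono2') auto
    also have "d powr (- p) = Q" unfolding d_def Q_def by (simp add: powr_powr)
    also have "s powr (- 1) = 1 / s" using s by (simp add: powr_minus_divide)
    finally show ?thesis using False s by simp
  qed
  have I1: "(\<integral>\<^sup>+s. ennreal (indicator {0..d} s * (d ^ (n - l) * sqrt q)) \<partial>lborel) = ennreal Q"
  proof -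
    have "d ^ (n - l) * sqrt q * d = Q"
    proof -
      have "d ^ (n - l) * sqrt q * d = d powr (real (n - l)) * q powr (1 / 2) * d powr 1"
        using d q by (simp add: powr_realpow powr_half_sqrt)
      also have "\<dots> = q powr (- 1 / n * real (n - l)) * q powr (1 / 2) * q powr (- 1 / n * 1)"
        by (simp only: d_def powr_powr)
      also have "\<dots> = q powr (- 1 / n * real (n - l) + 1 / 2 + - 1 / n * 1)" by (simp only: powr_add)
      also have "- 1 / n * real (n - l) + 1 / 2 + - 1 / n * 1 = p / n"
        using n l by (simp add: p_def of_nat_diff field_simps)
      finally show ?thesis by (simp add: Q_def)
    qed
    moreover have "(\<integral>\<^sup>+s. ennreal (indicator {0..d} s * (d ^ (n - l) * sqrt q)) \<partial>lborel) = (\<integral>\<^sup>+s. ennreal (d ^ (n - l) * sqrt q) * indicator {0..d} s \<partial>lborel)"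
      by (intro nn_integral_cong) (auto simp: indicator_def)
    moreover have "\<dots> = ennreal (d ^ (n - l) * sqrt q) * ennreal d"
      using d by (subst nn_integral_cmult_indicator) auto
    ultimately show ?thesis using d q by (simp add: ennreal_mult[symmetric])
  qed
  have I2: "(\<integral>\<^sup>+s. ennreal (indicator {d..1} s * (Q * (1 / s))) \<partial>lborel) = ennreal (Q * (ln q / n))"
  proof -
    have "((\<lambda>s. Q * (1 / s)) has_integral Q * ln 1 - Q * ln d) {d..1}"
    proof (rule fundamental_theorem_of_calculus)
      show "((\<lambda>s. Q * ln s) has_vector_derivative Q * (1 / s)) (at s within {d..1})" if "s \<in> {d..1}" for s
      proof -
        have "s > 0" using that d by auto
        then have "((\<lambda>s. Q * ln s) has_real_derivative Q * (1 / s)) (at s within {d..1})"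
          by (auto intro!: derivative_eq_intros)
        then show ?thesis by (simp add: has_real_derivative_iff_has_vector_derivative)
      qed
    qed (use d in auto)
    moreover have "Q * ln 1 - Q * ln d = Q * (ln q / n)" using q by (simp add: d_def ln_powr)
    ultimately have "((\<lambda>s. Q * (1 / s)) has_integral Q * (ln q / n)) {d..1}" by simp
    then show ?thesis using d Q0 by (intro nn_integral_has_integral_lebesgue) auto
  qed
  have "regular_mass n l q
    \<le> ennreal (2 ^ n) * (\<integral>\<^sup>+s. ennreal (indicator {0<..<1} s * ?b s) \<partial>lborel)"
    by (rule regular_integral_le[OF l b]) (use q in auto)
  also have "\<dots> \<le> ennreal (2 ^ n) * (\<integral>\<^sup>+s. ennreal (indicator {0..d} s * (d ^ (n - l) * sqrt q)) + ennreal (indicator {d..1} s * (Q * (1 / s))) \<partial>lborel)"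
  proof (intro mult_left_mono nn_integral_mono)
    fix s
    have "indicat_real {0..d} s * (d ^ (n - l) * sqrt q) \<ge> 0" "indicat_real {d..1} s * (Q * (1 / s)) \<ge> 0"
      using d q Q0 by (auto simp: indicator_def)
    then show "ennreal (indicator {0<..<1} s * ?b s) \<le> ennreal (indicator {0..d} s * (d ^ (n - l) * sqrt q)) + ennreal (indicator {d..1} s * (Q * (1 / s)))"
      by (subst ennreal_plus[symmetric]) (auto simp: indicator_def intro!: ennreal_leI)
  qed simp
  also have "\<dots> = ennreal (2 ^ n) * (ennreal Q + ennreal (Q * (ln q / n)))"
    by (subst nn_integral_add) (simp_all only: I1 I2, measurable)
  also have "\<dots> = ennreal (2 ^ n * (Q + Q * (ln q / n)))"
    using Q0 q by (simp add: ennreal_mult ennreal_plus[symmetric] del: ennreal_plus)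
  also have "\<dots> \<le> ennreal (2 ^ n * (Q * (1 + ln q)))"
  proof (rule ennreal_leI)
    have "ln q / n \<le> ln q" using q n by (simp add: divide_le_eq mult_le_cancel_left1)
    then have "Q * (ln q / n) \<le> Q * ln q" using Q0 by (rule mult_left_mono)
    moreover have "Q * (1 + ln q) = Q + Q * ln q" by (simp add: distrib_left)
    ultimately have "Q + Q * (ln q / n) \<le> Q * (1 + ln q)" by linarith
    then show "2 ^ n * (Q + Q * (ln q / n)) \<le> 2 ^ n * (Q * (1 + ln q))" by (rule mult_left_mono) simp
  qed
  finally show ?thesis by (simp add: Q_def p_def)
qed

text \<open>The exponent p/n found above is smaller than the exponent p/m of kappa, as m = l - 1 <
  n, and the gap h absorbs the factor 1 + ln q. For p = 0 one has n = 2 m and both sides agree. For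
  q near 1 the power of ln q may be small, and there the summand 1 of kappa carries the
  bound.\<close>

lemma log_power_absorb:
  fixes n l :: nat
  assumes l: "1 \<le> l" "l \<le> n" and large: "real l \<ge> real n / 2 + 1"
  shows "\<exists>C\<ge>0. \<forall>q\<ge>1. q powr ((real l - 1 - real n / 2) / n) * (1 + ln q) \<le>
     C * (1 + ln q powr (n / (2 * (real l - 1))) * q powr ((2 * (real l - 1) - n) / (2 * (real l - 1))))"
proof -
  define m where "m = real l - 1"
  define p where "p = m - real n / 2"
  have n: "n > 0" and p: "p \<ge> 0" and m: "m > 0" "m < n" using l large by (auto simp: p_def m_def)
  have ex: "(2 * m - n) / (2 * m) = p / m" using m(1) by (simp add: p_def field_simps)
  show ?thesis
  proof (cases "p = 0")
    case True
    then have nm: "real n = 2 * m" by (simp add: p_def)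
    have "q powr (p / n) * (1 + ln q) \<le> 1 * (1 + ln q powr (n / (2 * m)) * q powr ((2 * m - n) / (2 * m)))" if "q \<ge> 1" for q
      using that m unfolding True nm by simp
    then show ?thesis unfolding m_def[symmetric] p_def[symmetric] by (intro exI[of _ 1]) auto
  next
    case False
    with p have p: "p > 0" by simp
    define h where "h = p / m - p / n"
    have "p / n < p / m" using p m by (intro divide_strict_left_mono) auto
    then have h: "h > 0" by (simp add: h_def)
    \<comment> \<open>2 e serves q <= e, where q^(p/n) <= e and ln q <= 1. 2/h serves q > e, where 1
      + ln q <= 2 ln q <= 2 q^h / h.\<close>
    define C where "C = max (2 * exp 1) (2 / h)"
    have C: "C \<ge> 2 * exp 1" "C \<ge> 2 / h" "C \<ge> 0" unfolding C_def by (auto intro: max.coboundedI1)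
    have "q powr (p / n) * (1 + ln q) \<le> C * (1 + ln q powr (n / (2 * m)) * q powr (p / m))" if q: "q \<ge> 1" for q
    proof (cases "q \<le> exp 1")
      case True
      have "ln q \<le> ln (exp 1)" using q True by (subst ln_le_cancel_iff) auto
      then have lq: "0 \<le> ln q" "ln q \<le> 1" using q by auto
      have "q powr (p / n) \<le> q powr 1" using q n l by (intro powr_mono) (auto simp: p_def m_def)
      then have "q powr (p / n) \<le> exp 1" using q True by simp
      then have "q powr (p / n) * (1 + ln q) \<le> exp 1 * 2" using lq by (intro mult_mono) auto
      also have "\<dots> \<le> C * 1" using C by simp
      also have "\<dots> \<le> C * (1 + ln q powr (n / (2 * m)) * q powr (p / m))" using C(3) by (intro mult_left_mono) auto
      finally show ?thesis .
    next
      case False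
      have lq: "ln q \<ge> 1" using False q by (simp add: ln_ge_iff)
      have "q powr (p / n) * (1 + ln q) \<le> q powr (p / n) * (2 * (q powr h / h))"
        using lq ln_powr_bound[OF q h] by (intro mult_left_mono) auto
      also have "\<dots> = 2 / h * (q powr (p / n) * q powr h)" by simp
      also have "\<dots> = 2 / h * q powr (p / m)" by (simp add: powr_add[symmetric] h_def)
      also have "\<dots> \<le> C * (ln q powr (n / (2 * m)) * q powr (p / m))"
      proof (rule mult_mono[OF C(2) _ C(3)])
        have "1 \<le> ln q powr (n / (2 * m))" using lq m by (intro ge_one_powr_ge_zero) auto
        then have "1 * q powr (p / m) \<le> ln q powr (n / (2 * m)) * q powr (p / m)" by (rule mult_right_mono) simp
        then show "q powr (p / m) \<le> ln q powr (n / (2 * m)) * q powr (p / m)" by simp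
      qed simp
      also have "\<dots> \<le> C * (1 + ln q powr (n / (2 * m)) * q powr (p / m))" using C(3) by (intro mult_left_mono) auto
      finally show ?thesis .
    qed
    then show ?thesis unfolding m_def[symmetric] p_def[symmetric] ex using C(3) by blast
  qed
qed


section \<open>Forms\<close>


text \<open>Every Leibniz term contains the i-th argument exactly once, at the position that the
  permutation sends to i.\<close>

lemma linear_dx_arg:
  fixes J :: "'n::finite list"
  assumes "length vs = length J" "i < length J"
  shows "linear (\<lambda>v. dx J (vs[i := v]))"
proof -
  let ?l = "length J"
  have "linear (\<lambda>v. of_int (sign p) * (\<Prod>a<?l. (vs[i := v]) ! p a $ (J ! a)))" if p: "p permutes {..<?l}" for p
  proof -
    obtain k where k: "k < ?l" "p k = i"
      using p assms(2) by (metis lessThan_iff permutes_in_image permutes_surj surjD)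
    have "(\<Prod>a<?l. (vs[i := v]) ! p a $ (J ! a)) = v $ (J ! k) * (\<Prod>a\<in>{..<?l} - {k}. vs ! p a $ (J ! a))" for v
    proof -
      have "(\<Prod>a<?l. (vs[i := v]) ! p a $ (J ! a)) = (vs[i := v]) ! p k $ (J ! k) * (\<Prod>a\<in>{..<?l} - {k}. (vs[i := v]) ! p a $ (J ! a))"
        using k by (intro prod.remove) auto
      also have "(\<Prod>a\<in>{..<?l} - {k}. (vs[i := v]) ! p a $ (J ! a)) = (\<Prod>a\<in>{..<?l} - {k}. vs ! p a $ (J ! a))"
      proof (rule prod.cong[OF refl])
        fix a assume "a \<in> {..<?l} - {k}"
        then have "p a \<noteq> i" using k(2) permutes_inj[OF p] by (auto dest: injD)
        then show "(vs[i := v]) ! p a $ (J ! a) = vs ! p a $ (J ! a)" by simp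
      qed
      also have "(vs[i := v]) ! p k = v" using k assms by simp
      finally show ?thesis .
    qed
    then show ?thesis
      by (intro linearI) (simp_all add: algebra_simps)
  qed
  then have "linear (\<lambda>v. \<Sum>p | p permutes {..<?l}. of_int (sign p) * (\<Prod>a<?l. (vs[i := v]) ! p a $ (J ! a)))"
    by (intro linear_compose_sum) blast
  then show ?thesis using assms by (simp add: dx_def)
qed

text \<open>Composition with the transposition of i and j permutes the Leibniz terms and reverses
  their signs, so the sum equals its own negative.\<close>

lemma dx_repeated_arg:
  fixes J :: "'n::finite list"
  assumes len: "length vs = length J" and ij: "i < j" "j < length J" "vs ! i = vs ! j"
  shows "dx J vs = 0"
proof -
  let ?l = "length J" and ?t = "Transposition.transpose i j"
  let ?f = "\<lambda>p. of_int (sign p) * (\<Prod>a<?l. vs ! p a $ (J ! a))"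
  have t: "?t permutes {..<?l}" using ij by (intro permutes_swap_id) auto
  have "(\<Sum>p | p permutes {..<?l}. ?f p) = (\<Sum>p | p permutes {..<?l}. ?f (?t \<circ> p))"
    by (rule setum_permutations_compose_left[OF t])
  also have "\<dots> = (\<Sum>p | p permutes {..<?l}. - ?f p)"
  proof (rule sum.cong[OF refl])
    fix p assume "p \<in> {p. p permutes {..<?l}}"
    then have p: "permutation p" using permutation_permutes by auto
    have "sign (?t \<circ> p) = - sign p"
      using ij p by (subst sign_compose) (auto simp: sign_swap_id permutation_swap_id)
    moreover have "vs ! (?t \<circ> p) a = vs ! p a" for a
      using ij by (auto simp: Transposition.transpose_def)
    ultimately show "?f (?t \<circ> p) = - ?f p" by simp
  qed
  finally have "(\<Sum>p | p permutes {..<?l}. ?f p) = 0" by (simp add: sum_negf)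
  then show ?thesis using len by (simp add: dx_def)
qed

lemma alt_form_dx: "alt_form (length J) (dx J)"
  by (auto simp: alt_form_def linear_dx_arg dx_repeated_arg) (simp add: dx_def)

lemma alt_form_sum_dx:
  fixes c :: "'n::{finite,linorder} list \<Rightarrow> real"
  shows "alt_form l (\<lambda>vs. \<Sum>J\<in>inc_tuples l. c J * dx J vs)"
proof -
  have a: "alt_form l (dx J)" if "J \<in> inc_tuples l" for J :: "'n list"
    using alt_form_dx[of J] that by (simp add: inc_tuples_def)
  show ?thesis unfolding alt_form_def
  proof (intro conjI allI impI)
    show "linear (\<lambda>v. \<Sum>J\<in>inc_tuples l. c J * dx J (vs[i := v]))" if "length vs = l" "i < l" for vs :: "(real, 'n) vec list" and i
    proof (rule linear_compose_sum, rule ballI)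
      fix J :: "'n list" assume "J \<in> inc_tuples l"
      then have "linear (\<lambda>v. dx J (vs[i := v]))" using a that by (simp add: alt_form_def)
      from linear_compose_scale_right[OF this, of "c J"]
      show "linear (\<lambda>v. c J * dx J (vs[i := v]))" by simp
    qed
  qed (use a in \<open>auto simp: alt_form_def intro!: sum.neutral\<close>)
qed

lemma finite_inc_tuples: "finite (inc_tuples l :: 'n::{finite,linorder} list set)"
  by (rule finite_subset[OF _ finite_lists_length_eq[of "UNIV :: 'n set" l]]) (auto simp: inc_tuples_def)

lemma form_coeff_contraction:
  "form_coeff (contraction l z w) J =
    (\<Sum>I\<in>inc_tuples l. \<Sum>m<l. ((-1) ^ m * form_coeff (dx (drop_nth m I)) J) * (z $ (I ! m) * form_coeff w I))"
  unfolding form_coeff_def contraction_def sum_distrib_left by (simp only: mult_ac)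

text \<open>Being constant in \<open>x\<close>, the values of \<open>dx\<^sub>J\<close> on basis vectors need not be computed.\<close>
lemma form_coeff_bogovskii:
  "form_coeff (bogovskii l \<theta> U u x) K =
    (\<Sum>J\<in>inc_tuples (l - 1). form_coeff (dx J) K *
       (LINT y|lebesgue. (\<Sum>I\<in>inc_tuples l. \<Sum>m<l. ((-1) ^ m * form_coeff (dx (drop_nth m I)) J) *
          (bogovskii_kernel l \<theta> x y * ((x - y) $ (I ! m) * (if y \<in> U then form_coeff (u y) I else 0))))))"
proof -
  have "bogovskii_kernel l \<theta> x y * form_coeff (contraction l (x - y) (if y \<in> U then u y else (\<lambda>_. 0))) J =
     (\<Sum>I\<in>inc_tuples l. \<Sum>m<l. ((-1) ^ m * form_coeff (dx (drop_nth m I)) J) *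
          (bogovskii_kernel l \<theta> x y * ((x - y) $ (I ! m) * (if y \<in> U then form_coeff (u y) I else 0))))" for y J
  proof -
    have "form_coeff (if y \<in> U then u y else (\<lambda>_. 0)) I = (if y \<in> U then form_coeff (u y) I else 0)" for I
      by (simp add: form_coeff_def)
    then show ?thesis by (simp only: form_coeff_contraction sum_distrib_left mult.left_commute)
  qed
  then show ?thesis
    unfolding form_coeff_def[of "bogovskii l \<theta> U u x" K] bogovskii_def by (simp only: form_coeff_def mult.commute)
qed


section \<open>Weakly differentiable functions with bounds\<close>


lemma borel_measurable_lebesgue_AE_eq:
  fixes f g :: "'a::euclidean_space \<Rightarrow> real"
  assumes f: "f \<in> borel_measurable lebesgue" and ae: "AE x in lebesgue. f x = g x"
  shows "g \<in> borel_measurable lebesgue"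
proof (rule measurableI)
  fix Y :: "real set" assume "Y \<in> sets borel"
  with f have "f -` Y \<in> sets lebesgue" by (auto dest: measurable_sets)
  moreover have "AE x in lebesgue. x \<in> f -` Y \<longleftrightarrow> x \<in> g -` Y"
    using ae by eventually_elim auto
  ultimately show "g -` Y \<inter> space lebesgue \<in> sets lebesgue"
    by (intro completion.in_sets_AE[of "f -` Y" "g -` Y \<inter> space lebesgue"]) auto
qed simp

lemma AE_lebesgue_iff_lborel: "(AE x in lebesgue. P x) \<longleftrightarrow> (AE x in lborel. P x)"
  by (rule AE_completion_iff)

lemma integrable_lebesgue_iff_lborel:
  fixes f :: "'a::euclidean_space \<Rightarrow> real"
  shows "f \<in> borel_measurable borel \<Longrightarrow> integrable lebesgue f \<longleftrightarrow> integrable lborel f"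
  by (rule integrable_completion) simp

lemma integral_lebesgue_eq_lborel:
  fixes f :: "'a::euclidean_space \<Rightarrow> real"
  shows "f \<in> borel_measurable borel \<Longrightarrow> integral\<^sup>L lebesgue f = integral\<^sup>L lborel f"
  by (rule integral_completion) simp

lemma test_function_L2:
  assumes "test_function U f"
  shows "f \<in> borel_measurable borel" "partial i f \<in> borel_measurable borel"
    "sq_integrable f" "integrable lborel (\<lambda>x. (partial i f x)\<^sup>2)"
proof -
  note sm = smooth_D[OF test_function_D(1)[OF assms]]
  obtain r where r: "\<And>x. norm x > r \<Longrightarrow> f x = 0" using test_function_D(2)[OF assms] by blast
  show "f \<in> borel_measurable borel" "partial i f \<in> borel_measurable borel"
    using sm(3,4) by (auto intro: borel_measurable_continuous_onI)
  show "sq_integrable f"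
    by (rule integrable_continuous_bounded_support(1)[where r = r]) (auto intro!: continuous_intros sm r)
  show "integrable lborel (\<lambda>x. (partial i f x)\<^sup>2)"
    by (rule integrable_continuous_bounded_support(1)[where r = r]) (auto intro!: continuous_intros sm partial_eq_0_outside[OF r])
qed

abbreviation weak_deriv_bd ::
    "(real ^ 'n::finite) set \<Rightarrow> real \<Rightarrow> ((real, 'n) vec \<Rightarrow> real) \<Rightarrow> 'n \<Rightarrow> ((real, 'n) vec \<Rightarrow> real) \<Rightarrow> bool" where
  "weak_deriv_bd U K f j W \<equiv> W \<in> borel_measurable borel \<and> sq_integrable W \<and>
     (sq_norm W) \<le> K \<and>
     (\<forall>h. test_function U h \<longrightarrow> (LINT x|lborel. f x * partial j h x) = - (LINT x|lborel. W x * h x))"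

text \<open>A stand-in for \<open>f \<in> H\<^sup>1(U)\<close> with every \<open>\<parallel>\<partial>\<^sub>j f\<parallel>\<^sup>2 \<le> K\<close>, phrased with Borel representatives
  so that it is stable under linear combinations without any triangle inequality for \<open>L2_norm\<close>.\<close>
definition weakly_diff_bd :: "(real ^ 'n::finite) set \<Rightarrow> real \<Rightarrow> ((real, 'n) vec \<Rightarrow> real) \<Rightarrow> bool" where
  "weakly_diff_bd U K f \<longleftrightarrow> K \<ge> 0 \<and> (\<exists>f'. f' \<in> borel_measurable borel \<and> sq_integrable f' \<and>
     (AE x in lborel. f x = f' x) \<and>
     (\<forall>j. \<exists>W. weak_deriv_bd U K f' j W))"

lemma weakly_diff_bd_AE:
  assumes "weakly_diff_bd U K f" "AE x in lborel. g x = f x"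
  shows "weakly_diff_bd U K g"
proof -
  have "AE x in lborel. g x = f' x" if "AE x in lborel. f x = f' x" for f'
    using assms(2) that by eventually_elim simp
  then show ?thesis using assms(1) unfolding weakly_diff_bd_def by blast
qed

lemma weakly_diff_bd_mono:
  assumes "weakly_diff_bd U K f" "K \<le> K'"
  shows "weakly_diff_bd U K' f"
  using assms unfolding weakly_diff_bd_def by (meson order_trans)

lemma weakly_diff_bd_add:
  assumes "weakly_diff_bd U K f" "weakly_diff_bd U K' g"
  shows "weakly_diff_bd U (2 * K + 2 * K') (\<lambda>x. f x + g x)"
proof -
  obtain f' where K: "K \<ge> 0" and f': "f' \<in> borel_measurable borel" "sq_integrable f'"
      "AE x in lborel. f x = f' x" and
    Wf: "\<And>j. \<exists>W. weak_deriv_bd U K f' j W"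
    using assms(1) unfolding weakly_diff_bd_def by blast
  obtain g' where K': "K' \<ge> 0" and g': "g' \<in> borel_measurable borel" "sq_integrable g'"
      "AE x in lborel. g x = g' x" and
    Wg: "\<And>j. \<exists>W. weak_deriv_bd U K' g' j W"
    using assms(2) unfolding weakly_diff_bd_def by blast
  have "\<exists>W. W \<in> borel_measurable borel \<and> sq_integrable W \<and> (sq_norm W) \<le> 2 * K + 2 * K' \<and>
        (\<forall>h. test_function U h \<longrightarrow> (LINT x|lborel. (f' x + g' x) * partial j h x) = - (LINT x|lborel. W x * h x))" for j
  proof -
    obtain V where V: "V \<in> borel_measurable borel" "sq_integrable V" "(sq_norm V) \<le> K"
      "\<And>h. test_function U h \<Longrightarrow> (LINT x|lborel. f' x * partial j h x) = - (LINT x|lborel. V x * h x)"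
      using Wf[of j] by blast
    obtain W where W: "W \<in> borel_measurable borel" "sq_integrable W" "(sq_norm W) \<le> K'"
      "\<And>h. test_function U h \<Longrightarrow> (LINT x|lborel. g' x * partial j h x) = - (LINT x|lborel. W x * h x)"
      using Wg[of j] by blast
    have m: "V \<in> borel_measurable lborel" "W \<in> borel_measurable lborel" using V W by auto
    show ?thesis
    proof (intro exI[of _ "\<lambda>x. V x + W x"] conjI allI impI)
      show "(\<lambda>x. V x + W x) \<in> borel_measurable borel" using V(1) W(1) by measurable
      show "integrable lborel (\<lambda>x. (V x + W x)\<^sup>2)" by (rule integrable_power2_add(1)[OF m V(2) W(2)])
      show "(LINT x|lborel. (V x + W x)\<^sup>2) \<le> 2 * K + 2 * K'"
        using integrable_power2_add(3)[OF m V(2) W(2)] V(3) W(3) by linarith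
      fix h assume h: "test_function U h"
      note T = test_function_L2[OF h]
      have "integrable lborel (\<lambda>x. f' x * partial j h x)" "integrable lborel (\<lambda>x. g' x * partial j h x)"
        "integrable lborel (\<lambda>x. V x * h x)" "integrable lborel (\<lambda>x. W x * h x)"
        by (intro integrable_mult_L2 f' g' V W T; use f' g' V W T in simp)+
      then show "(LINT x|lborel. (f' x + g' x) * partial j h x) = - (LINT x|lborel. (V x + W x) * h x)"
        using V(4)[OF h] W(4)[OF h] by (simp add: distrib_right)
    qed
  qed
  moreover have "integrable lborel (\<lambda>x. (f' x + g' x)\<^sup>2)"
    by (rule integrable_power2_add(1)) (use f' g' in auto)
  moreover have "AE x in lborel. f x + g x = f' x + g' x" using f'(3) g'(3) by eventually_elim simp
  moreover have "(\<lambda>x. f' x + g' x) \<in> borel_measurable borel" using f'(1) g'(1) by measurable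
  ultimately show ?thesis using K K' unfolding weakly_diff_bd_def by (intro conjI exI[of _ "\<lambda>x. f' x + g' x"]) auto
qed

lemma weakly_diff_bd_cmult:
  assumes "weakly_diff_bd U K f"
  shows "weakly_diff_bd U (c\<^sup>2 * K) (\<lambda>x. c * f x)"
proof -
  obtain f' where K: "K \<ge> 0" and f': "f' \<in> borel_measurable borel" "sq_integrable f'"
      "AE x in lborel. f x = f' x" and
    Wf: "\<And>j. \<exists>W. weak_deriv_bd U K f' j W"
    using assms(1) unfolding weakly_diff_bd_def by blast
  have "\<exists>W. W \<in> borel_measurable borel \<and> sq_integrable W \<and> (sq_norm W) \<le> c\<^sup>2 * K \<and>
        (\<forall>h. test_function U h \<longrightarrow> (LINT x|lborel. (c * f' x) * partial j h x) = - (LINT x|lborel. W x * h x))" for j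
  proof -
    obtain V where V: "V \<in> borel_measurable borel" "sq_integrable V" "(sq_norm V) \<le> K"
      "\<And>h. test_function U h \<Longrightarrow> (LINT x|lborel. f' x * partial j h x) = - (LINT x|lborel. V x * h x)"
      using Wf[of j] by blast
    show ?thesis
      by (intro exI[of _ "\<lambda>x. c * V x"])
         (use V in \<open>auto simp: power_mult_distrib mult.assoc intro!: mult_left_mono\<close>)
  qed
  moreover have "integrable lborel (\<lambda>x. (c * f' x)\<^sup>2)" using f'(2) by (simp add: power_mult_distrib)
  moreover have "AE x in lborel. c * f x = c * f' x" using f'(3) by eventually_elim simp
  moreover have "(\<lambda>x. c * f' x) \<in> borel_measurable borel" using f'(1) by measurable
  ultimately show ?thesis using K unfolding weakly_diff_bd_def by (intro conjI exI[of _ "\<lambda>x. c * f' x"]) auto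
qed

text \<open>The factor 4 per summand is crude, but it closes the induction: 2 K + 2 (4^k K) <= 4^(k
  + 1) K. The index sets will depend on n and l only.\<close>

lemma weakly_diff_bd_sum:
  fixes U :: "(real, 'n::finite) vec set"
  assumes "finite S" "\<And>s. s \<in> S \<Longrightarrow> weakly_diff_bd U K (f s)" "K \<ge> 0"
  shows "weakly_diff_bd U (4 ^ card S * K) (\<lambda>x. \<Sum>s\<in>S. f s x)"
  using assms(1,2)
proof (induction S rule: finite_induct)
  case empty
  have "\<exists>W::(real, 'n) vec \<Rightarrow> real. W \<in> borel_measurable borel \<and> sq_integrable W \<and> (sq_norm W) \<le> K \<and>
        (\<forall>h. test_function U h \<longrightarrow> (LINT x|lborel. 0 * partial j h x) = - (LINT x|lborel. W x * h x))" for j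
    by (intro exI[of _ "\<lambda>_. 0"]) (use assms(3) in auto)
  then show ?case using assms(3) unfolding weakly_diff_bd_def by (intro conjI exI[of _ "\<lambda>_. 0"]) auto
next
  case (insert s S)
  have "weakly_diff_bd U (2 * K + 2 * (4 ^ card S * K)) (\<lambda>x. f s x + (\<Sum>s\<in>S. f s x))"
    by (rule weakly_diff_bd_add) (use insert in auto)
  moreover have "2 * K + 2 * (4 ^ card S * K) \<le> 4 ^ card (insert s S) * K"
  proof -
    have "1 * K \<le> 4 ^ card S * K" using assms(3) by (intro mult_right_mono) auto
    then show ?thesis unfolding card_insert_disjoint[OF insert.hyps] power_Suc by linarith
  qed
  ultimately show ?case using insert by (simp add: weakly_diff_bd_mono)
qed

text \<open>\<open>L2\<close> refers to the completed measure on \<open>U\<close> and says nothing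
  about values off \<open>U\<close>. A Borel representative vanishing off \<open>U\<close> carries
  the same norm over to \<open>lborel\<close>, where the Fubini and Fourier lemmas live.\<close>

lemma L2_borel_representative:
  fixes g :: "(real, 'n::finite) vec \<Rightarrow> real"
  assumes g: "L2 U g" and U: "U \<in> sets borel"
  obtains g' where "g' \<in> borel_measurable borel" "\<And>x. x \<notin> U \<Longrightarrow> g' x = 0"
    "AE x in lborel. (if x \<in> U then g x else 0) = g' x" "sq_integrable g'"
    "(L2_norm U g)\<^sup>2 = (sq_norm g')"
proof -
  have Ul: "U \<in> sets lebesgue" using U by auto
  let ?g = "\<lambda>x. if x \<in> U then g x else 0"
  have gm: "?g \<in> borel_measurable lebesgue"
    using g Ul by (simp add: L2_def borel_measurable_if)
  obtain g0 where g0: "g0 \<in> borel_measurable lborel" "AE x in lborel. ?g x = g0 x"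
    using completion_ex_borel_measurable_real[OF gm] by blast
  let ?g' = "\<lambda>x. indicator U x * g0 x"
  have m: "?g' \<in> borel_measurable borel" using g0(1) U by measurable
  have ae: "AE x in lborel. ?g x = ?g' x" using g0(2) by eventually_elim (auto simp: indicator_def split: if_splits)
  have i0: "integrable lebesgue (\<lambda>x. (?g x)\<^sup>2)"
  proof -
    have "integrable lebesgue (\<lambda>x. indicator U x *\<^sub>R (g x)\<^sup>2)"
      using g Ul by (simp add: L2_def integrable_restrict_space)
    moreover have "(\<lambda>x. indicator U x *\<^sub>R (g x)\<^sup>2) = (\<lambda>x. (?g x)\<^sup>2)" by (auto simp: indicator_def)
    ultimately show ?thesis by simp
  qed
  have ae2: "AE x in lebesgue. (?g x)\<^sup>2 = (?g' x)\<^sup>2"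
    unfolding AE_lebesgue_iff_lborel using ae by eventually_elim simp
  have m2: "(\<lambda>x. (?g' x)\<^sup>2) \<in> borel_measurable borel" using m by measurable
  have m2l: "(\<lambda>x. (?g' x)\<^sup>2) \<in> borel_measurable lebesgue" using m2 by (simp add: measurable_completion)
  have "integrable lebesgue (\<lambda>x. (?g' x)\<^sup>2)"
    using i0 integrable_cong_AE[OF _ m2l ae2] by (metis (no_types, lifting) borel_measurable_integrable)
  then have i: "integrable lborel (\<lambda>x. (?g' x)\<^sup>2)" using integrable_lebesgue_iff_lborel[OF m2] by blast
  have "(LINT x|lebesgue_on U. (g x)\<^sup>2) = (LINT x|lebesgue. (?g x)\<^sup>2)"
  proof -
    have "(LINT x|lebesgue_on U. (g x)\<^sup>2) = (LINT x|lebesgue. indicator U x *\<^sub>R (g x)\<^sup>2)"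
      using Ul by (subst integral_restrict_space) auto
    also have "\<dots> = (LINT x|lebesgue. (?g x)\<^sup>2)"
      by (intro Bochner_Integration.integral_cong) (auto simp: indicator_def)
    finally show ?thesis .
  qed
  also have "\<dots> = (LINT x|lebesgue. (?g' x)\<^sup>2)"
    by (rule integral_cong_AE[OF borel_measurable_integrable[OF i0] m2l ae2])
  also have "\<dots> = (LINT x|lborel. (?g' x)\<^sup>2)" by (rule integral_lebesgue_eq_lborel[OF m2])
  finally have e: "(LINT x|lebesgue_on U. (g x)\<^sup>2) = (LINT x|lborel. (?g' x)\<^sup>2)" .
  have "(LINT x|lborel. (?g' x)\<^sup>2) \<ge> 0" by (rule Bochner_Integration.integral_nonneg) simp
  then have n: "(L2_norm U g)\<^sup>2 = (LINT x|lborel. (?g' x)\<^sup>2)" by (simp only: L2_norm_def e real_sqrt_pow2)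
  show thesis by (rule that[OF m _ ae i n]) simp
qed

lemma L2_of_borel:
  fixes f :: "(real, 'n::finite) vec \<Rightarrow> real"
  assumes U: "U \<in> sets borel" and f: "f' \<in> borel_measurable borel" "sq_integrable f'" "AE x in lborel. f x = f' x"
  shows "L2 U f"
proof -
  have Ul: "U \<in> sets lebesgue" using U by auto
  have ae: "AE x in lebesgue. f' x = f x" unfolding AE_lebesgue_iff_lborel using f(3) by eventually_elim simp
  have m: "f \<in> borel_measurable lebesgue"
    by (rule borel_measurable_lebesgue_AE_eq[OF _ ae]) (use f(1) in \<open>simp add: measurable_completion\<close>)
  have m2: "(\<lambda>x. (f' x)\<^sup>2) \<in> borel_measurable borel" "(\<lambda>x. (f x)\<^sup>2) \<in> borel_measurable lebesgue" using f(1) m by measurable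
  have i': "integrable lebesgue (\<lambda>x. (f' x)\<^sup>2)" using f(2) integrable_lebesgue_iff_lborel[OF m2(1)] by blast
  have "AE x in lebesgue. (f' x)\<^sup>2 = (f x)\<^sup>2" using ae by eventually_elim simp
  then have i: "integrable lebesgue (\<lambda>x. (f x)\<^sup>2)"
    using integrable_cong_AE[OF borel_measurable_integrable[OF i'] m2(2)] i' by blast
  have "integrable lebesgue (\<lambda>x. indicator U x *\<^sub>R (f x)\<^sup>2)" by (rule integrable_mult_indicator[OF Ul i])
  then have "integrable (lebesgue_on U) (\<lambda>x. (f x)\<^sup>2)" using Ul by (simp add: integrable_restrict_space)
  then show ?thesis using m by (simp add: L2_def measurable_restrict_space1)
qed

text \<open>\<open>H1_seminorm\<close> measures whichever weak derivative is chosen by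
  \<open>SOME\<close>. The fundamental lemma identifies that choice, almost everywhere on
  \<open>U\<close>, with the derivative whose norm is under control.\<close>

lemma weak_partial_bound:
  fixes U :: "(real, 'n::{finite,linorder}) vec set" and K :: real
  assumes moll: "\<And>e. e > 0 \<Longrightarrow> \<exists>f. test_function (ball (0 :: (real, 'n) vec) e) f \<and> (LINT x|lborel. f x) = 1 \<and> (LINT x|lborel. \<bar>f x\<bar>) \<le> C"
    and U: "open U" "emeasure lborel U < \<infinity>" and f: "weakly_diff_bd U K f"
  shows "H1 U f" "(H1_seminorm U f)\<^sup>2 \<le> CARD('n) * K"
proof -
  have [measurable]: "U \<in> sets borel" using U(1) by simp
  obtain f' where K: "K \<ge> 0" and f': "f' \<in> borel_measurable borel" "sq_integrable f'"
      "AE x in lborel. f x = f' x" and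
    Wf: "\<And>j. \<exists>W. weak_deriv_bd U K f' j W"
    using f unfolding weakly_diff_bd_def by blast
  have L2f: "L2 U f" by (rule L2_of_borel[OF _ f']) simp
  have on_U: "(LINT x|lebesgue_on U. u x * v x) = (LINT x|lborel. u' x * v x)"
    if u: "L2 U u" "u' \<in> borel_measurable borel" "AE x in lborel. x \<in> U \<longrightarrow> u x = u' x" and v: "v \<in> borel_measurable borel" "\<And>x. x \<notin> U \<Longrightarrow> v x = 0"
    for u u' v
  proof -
    have Ul: "U \<in> sets lebesgue" by simp
    have um: "(\<lambda>x. if x \<in> U then u x else 0) \<in> borel_measurable lebesgue" using u(1) by (simp add: L2_def borel_measurable_if)
    have vl: "v \<in> borel_measurable lebesgue" "u' \<in> borel_measurable lebesgue" using v(1) u(2) by (simp_all add: measurable_completion)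
    have "(LINT x|lebesgue_on U. u x * v x) = (LINT x|lebesgue. indicator U x *\<^sub>R (u x * v x))"
      using Ul by (subst integral_restrict_space) auto
    also have "\<dots> = (LINT x|lebesgue. (if x \<in> U then u x else 0) * v x)"
      by (intro Bochner_Integration.integral_cong) (auto simp: indicator_def)
    also have "\<dots> = (LINT x|lebesgue. u' x * v x)"
    proof (rule integral_cong_AE)
      show "AE x in lebesgue. (if x \<in> U then u x else 0) * v x = u' x * v x"
        unfolding AE_lebesgue_iff_lborel using u(3) by eventually_elim (use v(2) in auto)
    qed (use um vl in measurable)
    also have "\<dots> = (LINT x|lborel. u' x * v x)"
      using u(2) v(1) by (intro integral_lebesgue_eq_lborel) measurable
    finally show ?thesis .
  qed
  have fwp: "has_weak_partial U f j g \<longleftrightarrow> (\<forall>h. test_function U h \<longrightarrow> (LINT x|lborel. f' x * partial j h x) = - (LINT x|lborel. g' x * h x))"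
    if gU: "L2 U g" "g' \<in> borel_measurable borel" "AE x in lborel. x \<in> U \<longrightarrow> g x = g' x" for g g' j
  proof -
    have "(LINT x|lebesgue_on U. f x * partial j h x) = (LINT x|lborel. f' x * partial j h x)"
      "(LINT x|lebesgue_on U. g x * h x) = (LINT x|lborel. g' x * h x)" if h: "test_function U h" for h
    proof -
      show "(LINT x|lebesgue_on U. f x * partial j h x) = (LINT x|lborel. f' x * partial j h x)"
      proof (rule on_U[OF L2f f'(1)])
        show "AE x in lborel. x \<in> U \<longrightarrow> f x = f' x" using f'(3) by eventually_elim simp
      qed (use test_function_L2[OF h] test_function_D[OF h] in auto)
      show "(LINT x|lebesgue_on U. g x * h x) = (LINT x|lborel. g' x * h x)"
        by (rule on_U[OF gU]) (use test_function_L2[OF h] test_function_D[OF h] in auto)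
    qed
    then show ?thesis unfolding has_weak_partial_def by simp
  qed
  have ex: "\<exists>g. L2 U g \<and> has_weak_partial U f j g" for j
  proof -
    obtain W where W: "W \<in> borel_measurable borel" "sq_integrable W"
      "\<And>h. test_function U h \<Longrightarrow> (LINT x|lborel. f' x * partial j h x) = - (LINT x|lborel. W x * h x)"
      using Wf[of j] by blast
    have L: "L2 U W" by (rule L2_of_borel[OF _ W(1,2)]) auto
    then show ?thesis using fwp[OF L W(1)] W(3) by auto
  qed
  then show "H1 U f" using L2f by (auto simp: H1_def)
  have bd: "(L2_norm U (weak_partial U f j))\<^sup>2 \<le> K" for j
  proof -
    define g where "g = weak_partial U f j"
    have g: "L2 U g" "has_weak_partial U f j g"
      using someI_ex[OF ex[of j]] unfolding g_def weak_partial_def by blast+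
    obtain W where W: "W \<in> borel_measurable borel" "sq_integrable W" "(sq_norm W) \<le> K"
      "\<And>h. test_function U h \<Longrightarrow> (LINT x|lborel. f' x * partial j h x) = - (LINT x|lborel. W x * h x)"
      using Wf[of j] by blast
    obtain g' where g': "g' \<in> borel_measurable borel" "\<And>x. x \<notin> U \<Longrightarrow> g' x = 0"
      "AE x in lborel. (if x \<in> U then g x else 0) = g' x" "sq_integrable g'"
      "(L2_norm U g)\<^sup>2 = (sq_norm g')"
      by (rule L2_borel_representative[OF g(1)]) (simp, blast)
    have gae: "AE x in lborel. x \<in> U \<longrightarrow> g x = g' x" using g'(3) by eventually_elim auto
    \<comment> \<open>Both candidates are in L^2; cutting down to \<open>U\<close>, of finite
      measure, makes their difference integrable.\<close>
    let ?d = "\<lambda>x. indicator U x * (g' x - W x)"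
    note [measurable] = g'(1) W(1)
    have d2: "integrable lborel (\<lambda>x. (g' x - W x)\<^sup>2)"
      by (rule integrable_power2_add(2)[OF _ _ g'(4) W(2)]) auto
    have indU: "integrable lborel (\<lambda>x. (indicat_real U x)\<^sup>2)"
      using U(2) by (simp add: power2_eq_square indicator_inter_arith[symmetric])
    have "AE x in lborel. ?d x = 0"
    proof (rule fundamental_lemma[OF moll U(1)])
      show "integrable lborel ?d" by (rule integrable_mult_L2[OF _ _ indU d2]) auto
      fix h assume h: "test_function U h"
      note T = test_function_L2[OF h]
      have [measurable]: "h \<in> borel_measurable borel" by (rule T(1))
      have i1: "integrable lborel (\<lambda>x. g' x * h x)" by (rule integrable_mult_L2[OF _ _ g'(4) T(3)]) measurable
      have i2: "integrable lborel (\<lambda>x. W x * h x)" by (rule integrable_mult_L2[OF _ _ W(2) T(3)]) measurable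
      have "(LINT x|lborel. g' x * h x) = (LINT x|lborel. W x * h x)"
        using fwp[OF g(1) g'(1) gae, of j] g(2) W(4)[OF h] h by fastforce
      moreover have "?d x * h x = g' x * h x - W x * h x" for x
        using test_function_D(3)[OF h, of x] by (auto simp: indicator_def algebra_simps)
      ultimately show "(LINT x|lborel. ?d x * h x) = 0" using i1 i2 by simp
    qed auto
    then have "AE x in lborel. (g' x)\<^sup>2 = indicator U x * (W x)\<^sup>2"
      by eventually_elim (use g'(2) in \<open>auto simp: indicator_def split: if_splits\<close>)
    then have "(sq_norm g') = (LINT x|lborel. indicator U x * (W x)\<^sup>2)"
      by (intro integral_cong_AE) auto
    also have "\<dots> \<le> (sq_norm W)"
      by (rule integral_mono'[OF W(2)]) (auto simp: indicator_def)
    finally show ?thesis using g'(5) W(3) by (simp add: g_def)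
  qed
  have "(H1_seminorm U f)\<^sup>2 = (\<Sum>j\<in>UNIV. (L2_norm U (weak_partial U f j))\<^sup>2)"
    unfolding H1_seminorm_def by (rule real_sqrt_pow2) (simp add: sum_nonneg)
  also have "\<dots> \<le> (\<Sum>j\<in>(UNIV::'n set). K)" by (rule sum_mono) (rule bd)
  finally show "(H1_seminorm U f)\<^sup>2 \<le> CARD('n) * K" by simp
qed


section \<open>The Bogovskii kernel\<close>


lemma bogovskii_kernel_eq:
  "bogovskii_kernel l \<theta> x y = (LINT t|lborel. (t * bog_weight CARD('n) l t) * \<theta> (y + t *\<^sub>R (x - y)))"
  if [measurable]: "\<theta> \<in> borel_measurable borel" for \<theta> :: "(real, 'n::finite) vec \<Rightarrow> real"
proof -
  have "bogovskii_kernel l \<theta> x y = (LINT t|lebesgue. indicator {1..} t * ((t - 1) ^ (CARD('n) - l) * t ^ (l - 1) * \<theta> (y + t *\<^sub>R (x - y))))"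
    unfolding bogovskii_kernel_def by (subst integral_restrict_space) auto
  also have "\<dots> = (LINT t|lebesgue. (t * bog_weight CARD('n) l t) * \<theta> (y + t *\<^sub>R (x - y)))"
    by (intro Bochner_Integration.integral_cong) (auto simp: bog_weight_def indicator_def)
  also have "\<dots> = (LINT t|lborel. (t * bog_weight CARD('n) l t) * \<theta> (y + t *\<^sub>R (x - y)))"
  proof (rule integral_completion)
    note [measurable] = weight_D(1)[OF weight_bog_weight]
    show "(\<lambda>t. (t * bog_weight CARD('n) l t) * \<theta> (y + t *\<^sub>R (x - y))) \<in> borel_measurable lborel" by measurable
  qed
  finally show ?thesis .
qed

text \<open>The identity \<open>t (x - y)\<^sub>i = (y + t (x - y) - a)\<^sub>i - (y - a)\<^sub>i\<close> removes the factor \<open>(x - y)\<^sub>i\<close>,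
  trading it for a moment of \<open>\<theta>\<close> and a moment of \<open>g\<close>.\<close>
lemma kernel_piece:
  fixes \<theta> g u :: "(real, 'n::finite) vec \<Rightarrow> real" and a :: "(real, 'n) vec" and i :: 'n
  defines "\<phi> \<equiv> \<lambda>z. (z - a) $ i * \<theta> z" and "g1 \<equiv> \<lambda>y. (y - a) $ i * g y"
  assumes l: "1 \<le> l" "l \<le> CARD('n)"
    and i\<theta>: "integrable lborel \<theta>" "integrable lborel \<phi>" and ig: "integrable lborel g" "integrable lborel g1"
    and u: "u \<in> borel_measurable lebesgue" "AE y in lborel. u y = g y"
  shows "AE x in lborel. integrable lebesgue (\<lambda>y. bogovskii_kernel l \<theta> x y * ((x - y) $ i * u y)) \<and>
     (LINT y|lebesgue. bogovskii_kernel l \<theta> x y * ((x - y) $ i * u y)) = bog_op (bog_weight CARD('n) l) \<phi> g x - bog_op (bog_weight CARD('n) l) \<theta> g1 x"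
proof -
  let ?w = "bog_weight CARD('n) l"
  note [measurable] = weight_D(1)[OF weight_bog_weight]
  have m [measurable]: "\<theta> \<in> borel_measurable borel" "g \<in> borel_measurable borel" using i\<theta> ig by auto
  have 1: "AE x in lborel. integrable lborel (\<lambda>p. slice_integrand ?w \<phi> g x p)"
    by (rule AE_integrable_bog_op[OF weight_bog_weight integrable_bog_weight[OF l] i\<theta>(2) ig(1)])
  have 2: "AE x in lborel. integrable lborel (\<lambda>p. slice_integrand ?w \<theta> g1 x p)"
    by (rule AE_integrable_bog_op[OF weight_bog_weight integrable_bog_weight[OF l] i\<theta>(1) ig(2)])
  from 1 2 show ?thesis
  proof eventually_elim
    case (elim x)
    let ?K1 = "\<lambda>p. slice_integrand ?w \<phi> g x p"
    let ?K2 = "\<lambda>p. slice_integrand ?w \<theta> g1 x p"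
    let ?B = "\<lambda>y. bogovskii_kernel l \<theta> x y"
    have vm [measurable]: "(\<lambda>y. (x - y) $ i) \<in> borel_measurable borel"
      by (intro borel_measurable_continuous_onI continuous_intros)
    have Bm [measurable]: "?B \<in> borel_measurable borel" unfolding bogovskii_kernel_eq[OF m(1)] by measurable
    have id: "?B y * ((x - y) $ i * g y) = (LINT t|lborel. (t * ?w t * \<theta> (y + t *\<^sub>R (x - y))) * ((x - y) $ i * g y))" for y
      by (simp only: bogovskii_kernel_eq[OF m(1)] integral_mult_left_zero)
    \<comment> \<open>The weight of the kernel is t times \<open>bog_weight\<close>, and this t is
      what the moment identity uses. For almost every x both terms are integrable over (t, y), so
      the t-integral may be split for almost every y.\<close>
    have split: "(t * ?w t * \<theta> (y + t *\<^sub>R (x - y))) * ((x - y) $ i * g y) = ?K1 (t, y) - ?K2 (t, y)" for t y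
      by (simp add: \<phi>_def g1_def algebra_simps)
    have "AE y in lborel. integrable lborel (\<lambda>t. ?K1 (t, y))" "AE y in lborel. integrable lborel (\<lambda>t. ?K2 (t, y))"
      by (rule AE_integrable_lborel_snd[OF elim(1)], rule AE_integrable_lborel_snd[OF elim(2)])
    then have ae: "AE y in lborel. ?B y * ((x - y) $ i * g y) = (LINT t|lborel. ?K1 (t, y)) - (LINT t|lborel. ?K2 (t, y))"
      by eventually_elim (simp only: id split Bochner_Integration.integral_diff)
    have I: "integrable lborel (\<lambda>y. (LINT t|lborel. ?K1 (t, y)) - (LINT t|lborel. ?K2 (t, y)))"
      by (intro Bochner_Integration.integrable_diff integrable_lborel_snd elim)
    have m3: "(\<lambda>y. ?B y * ((x - y) $ i * g y)) \<in> borel_measurable lborel" by measurable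
    have Ig: "integrable lborel (\<lambda>y. ?B y * ((x - y) $ i * g y))"
      using integrable_cong_AE[OF m3 borel_measurable_integrable[OF I] ae] I by blast
    have "(LINT y|lborel. ?B y * ((x - y) $ i * g y)) = (LINT y|lborel. (LINT t|lborel. ?K1 (t, y)) - (LINT t|lborel. ?K2 (t, y)))"
      by (rule integral_cong_AE[OF m3 borel_measurable_integrable[OF I] ae])
    also have "\<dots> = bog_op ?w \<phi> g x - bog_op ?w \<theta> g1 x"
      unfolding bog_op_def integral_lborel_snd[OF elim(1)] integral_lborel_snd[OF elim(2)]
      by (rule Bochner_Integration.integral_diff; rule integrable_lborel_snd; rule elim)
    finally have V: "(LINT y|lborel. ?B y * ((x - y) $ i * g y)) = bog_op ?w \<phi> g x - bog_op ?w \<theta> g1 x" .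
    have ml: "(\<lambda>y. ?B y * ((x - y) $ i * u y)) \<in> borel_measurable lebesgue"
    proof -
      have "?B \<in> borel_measurable lebesgue" "(\<lambda>y. (x - y) $ i) \<in> borel_measurable lebesgue"
        by (rule measurable_completion, simp)+
      then show ?thesis using u(1) by measurable
    qed
    have ml2: "(\<lambda>y. ?B y * ((x - y) $ i * g y)) \<in> borel_measurable lebesgue" using m3 by (rule measurable_completion)
    have ael: "AE y in lebesgue. ?B y * ((x - y) $ i * u y) = ?B y * ((x - y) $ i * g y)"
      by (rule AE_completion) (use u(2) in \<open>eventually_elim, simp\<close>)
    have "integrable lebesgue (\<lambda>y. ?B y * ((x - y) $ i * g y))" using Ig integrable_completion[OF m3] by blast
    then have "integrable lebesgue (\<lambda>y. ?B y * ((x - y) $ i * u y))"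
      using integrable_cong_AE[OF ml ml2 ael] by blast
    moreover have "(LINT y|lebesgue. ?B y * ((x - y) $ i * u y)) = bog_op ?w \<phi> g x - bog_op ?w \<theta> g1 x"
      using integral_cong_AE[OF ml ml2 ael] integral_completion[OF m3] V by simp
    ultimately show ?case by blast
  qed
qed


section \<open>The cut-off function\<close>


lemma concat_replicate_single:
  assumes "distinct xs" "k \<in> set xs"
  shows "concat (map (\<lambda>i. replicate (if i = k then m else 0) i) xs) = replicate m k"
  using assms
proof (induction xs)
  case (Cons x xs)
  have "concat (map (\<lambda>i. replicate (if i = k then m else 0) i) ys) = []" if "k \<notin> set ys" for ys
    using that by (induction ys) auto
  then show ?case using Cons by auto
qed simp

lemma multi_partial_single:
  fixes k :: "'n::{finite,linorder}"
  shows "multi_partial (\<lambda>i. if i = k then m else 0) f = partials (replicate m k) f"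
    and "multi_order (\<lambda>i. if i = k then m else 0) = m"
proof -
  show "multi_partial (\<lambda>i. if i = k then m else 0) f = partials (replicate m k) f"
    unfolding multi_partial_def by (subst concat_replicate_single) auto
  show "multi_order (\<lambda>i. if i = k then m else 0) = m"
    by (simp add: multi_order_def)
qed

text \<open>A nonempty open set has positive measure. This turns the essential bounds on theta into
  pointwise ones.\<close>

lemma continuous_AE_le_imp_le:
  fixes f :: "'a::euclidean_space \<Rightarrow> real"
  assumes f: "continuous_on UNIV f" and ae: "AE x in lebesgue. f x \<le> c"
  shows "f x \<le> c"
proof (rule ccontr)
  assume "\<not> f x \<le> c"
  have o: "open {x. f x > c}" by (intro open_Collect_less continuous_intros f)
  moreover have "x \<in> {x. f x > c}" using \<open>\<not> f x \<le> c\<close> by simp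
  ultimately obtain e where e: "e > 0" "ball x e \<subseteq> {x. f x > c}" unfolding open_contains_ball by blast
  have "AE x in lborel. x \<notin> {x. f x > c}" using ae unfolding AE_lebesgue_iff_lborel by eventually_elim simp
  then have "emeasure lborel {x. f x > c} = 0"
    using o by (subst (asm) AE_iff_null_sets[symmetric]) auto
  then have "emeasure lborel (ball x e) = 0"
    using emeasure_mono[OF e(2), of lborel] o by simp
  then show False using content_ball_pos[OF e(1), of x] by (simp add: measure_def)
qed

lemma diameter_ball_eq: "r > 0 \<Longrightarrow> diameter (ball (a::'a::euclidean_space) r) = 2 * r"
  by (simp add: diameter_ball)

text \<open>\<open>M\<close> adds up the constants of order 0 and those of the pure derivatives of
  order 1 and 2. One number thus serves every axis, and it depends on \<open>c\<close>
  alone.\<close>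

lemma admissible_theta_bounds:
  fixes c :: "('n::{finite,linorder} \<Rightarrow> nat) \<Rightarrow> real" and k :: 'n
  assumes \<theta>: "admissible_theta c (ball a r) \<theta>" and r: "r > 0"
  defines "\<rho> \<equiv> 2 * r"
  defines "M \<equiv> \<bar>c (\<lambda>_. 0)\<bar> + (\<Sum>k\<in>UNIV. \<bar>c (\<lambda>i. if i = k then 1 else 0)\<bar>) + (\<Sum>k\<in>UNIV. \<bar>c (\<lambda>i. if i = k then 2 else 0)\<bar>)"
  shows "(LINT x|lborel. \<bar>\<theta> x\<bar>) \<le> M" "(LINT x|lborel. \<bar>partial k \<theta> x\<bar>) \<le> M / \<rho>"
    "(LINT x|lborel. \<bar>partial k (partial k \<theta>) x\<bar>) \<le> M / \<rho>\<^sup>2"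
    "\<bar>\<theta> x\<bar> \<le> M / \<rho> ^ CARD('n)" "\<bar>partial k \<theta> x\<bar> \<le> M / \<rho> ^ (CARD('n) + 1)"
    and "(LINT x|lborel. \<theta> x) = 1" "M \<ge> 0"
proof -
  have \<rho>: "\<rho> > 0" "diameter (ball a r) = \<rho>" using r by (simp_all add: \<rho>_def diameter_ball_eq)
  have t: "test_function (ball a r) \<theta>" using \<theta> by (simp add: admissible_theta_def)
  note sm = smooth_D[OF test_function_D(1)[OF t]]
  show M0: "M \<ge> 0" unfolding M_def by (intro add_nonneg_nonneg sum_nonneg) auto
  have cM: "c (\<lambda>_. 0) \<le> M" "c (\<lambda>i. if i = k then 1 else 0) \<le> M" "c (\<lambda>i. if i = k then 2 else 0) \<le> M"
  proof -
    have 1: "\<bar>c (\<lambda>i. if i = k then 1 else 0)\<bar> \<le> (\<Sum>k\<in>UNIV. \<bar>c (\<lambda>i. if i = k then 1 else 0)\<bar>)"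
      by (rule member_le_sum[of k UNIV "\<lambda>k. \<bar>c (\<lambda>i. if i = k then 1 else 0)\<bar>"]) auto
    have 2: "\<bar>c (\<lambda>i. if i = k then 2 else 0)\<bar> \<le> (\<Sum>k\<in>UNIV. \<bar>c (\<lambda>i. if i = k then 2 else 0)\<bar>)"
      by (rule member_le_sum[of k UNIV "\<lambda>k. \<bar>c (\<lambda>i. if i = k then 2 else 0)\<bar>"]) auto
    have 3: "0 \<le> (\<Sum>k\<in>UNIV. \<bar>c (\<lambda>i. if i = k then 1 else 0)\<bar>)" "0 \<le> (\<Sum>k\<in>UNIV. \<bar>c (\<lambda>i. if i = k then 2 else 0)\<bar>)"
      by (intro sum_nonneg; simp)+
    show "c (\<lambda>_. 0) \<le> M" "c (\<lambda>i. if i = k then 1 else 0) \<le> M" "c (\<lambda>i. if i = k then 2 else 0) \<le> M"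
      unfolding M_def using 1 2 3 by linarith+
  qed
  have m0: "multi_partial (\<lambda>_. 0) \<theta> = \<theta>" "multi_order (\<lambda>_::'n. 0) = 0"
    using multi_partial_single[of k 0] by (simp_all cong: if_cong)
  have m1: "multi_partial (\<lambda>i. if i = k then 1 else 0) \<theta> = partial k \<theta>" "multi_order (\<lambda>i. if i = k then 1 else 0) = 1"
    using multi_partial_single[of k 1] by simp_all
  have m2: "multi_partial (\<lambda>i. if i = k then 2 else 0) \<theta> = partial k (partial k \<theta>)" "multi_order (\<lambda>i. if i = k then 2 else 0) = 2"
    using multi_partial_single[of k 2] by (simp_all add: numeral_2_eq_2)
  have L1: "(LINT x|lebesgue. \<bar>multi_partial \<alpha> \<theta> x\<bar>) \<le> c \<alpha> * \<rho> powi (- int (multi_order \<alpha>))"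
    and Linf: "AE x in lebesgue. \<bar>multi_partial \<alpha> \<theta> x\<bar> \<le> c \<alpha> * \<rho> powi (- int CARD('n) - int (multi_order \<alpha>))" for \<alpha>
    using \<theta> unfolding admissible_theta_def \<rho>(2) by blast+
  have leb: "integral\<^sup>L lebesgue (\<lambda>x. \<bar>f x\<bar>) = integral\<^sup>L lborel (\<lambda>x. \<bar>f x\<bar>)" if "continuous_on UNIV f" for f :: "(real, 'n) vec \<Rightarrow> real"
  proof -
    have [measurable]: "f \<in> borel_measurable borel" using that by (rule borel_measurable_continuous_onI)
    show ?thesis by (rule integral_lebesgue_eq_lborel) measurable
  qed
  have p: "\<rho> powi (- int m) = 1 / \<rho> ^ m" for m :: nat by (simp add: power_int_minus divide_inverse)
  have mono: "c \<alpha> * (1 / \<rho> ^ m) \<le> M / \<rho> ^ m" if "c \<alpha> \<le> M" for \<alpha> m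
    using that \<rho>(1) by (simp add: divide_right_mono)
  show "(LINT x|lborel. \<bar>\<theta> x\<bar>) \<le> M"
    using L1[of "\<lambda>_. 0"] cM(1) unfolding m0 p leb[OF sm(3)] by simp
  show "(LINT x|lborel. \<bar>partial k \<theta> x\<bar>) \<le> M / \<rho>"
    using L1[of "\<lambda>i. if i = k then 1 else 0"] mono[OF cM(2), of 1] unfolding m1 p leb[OF sm(4)] by simp
  show "(LINT x|lborel. \<bar>partial k (partial k \<theta>) x\<bar>) \<le> M / \<rho>\<^sup>2"
    using L1[of "\<lambda>i. if i = k then 2 else 0"] mono[OF cM(3), of 2] unfolding m2 p leb[OF sm(5)] by simp
  have q: "\<rho> powi (- int CARD('n) - int m) = 1 / \<rho> ^ (CARD('n) + m)" for m
  proof -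
    have "- int CARD('n) - int m = - int (CARD('n) + m)" by simp
    then show ?thesis by (simp only: p)
  qed
  have "AE x in lebesgue. \<bar>\<theta> x\<bar> \<le> M / \<rho> ^ CARD('n)"
    using Linf[of "\<lambda>_. 0"] unfolding m0 q by eventually_elim (use mono[OF cM(1), of "CARD('n)"] in simp)
  then show "\<bar>\<theta> x\<bar> \<le> M / \<rho> ^ CARD('n)"
    by (rule continuous_AE_le_imp_le[rotated]) (intro continuous_intros sm)
  have "AE x in lebesgue. \<bar>partial k \<theta> x\<bar> \<le> M / \<rho> ^ (CARD('n) + 1)"
    using Linf[of "\<lambda>i. if i = k then 1 else 0"] unfolding m1 q by eventually_elim (use mono[OF cM(2), of "CARD('n) + 1"] in simp)
  then show "\<bar>partial k \<theta> x\<bar> \<le> M / \<rho> ^ (CARD('n) + 1)"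
    by (rule continuous_AE_le_imp_le[rotated]) (intro continuous_intros sm)
  have "(LINT x|lebesgue. \<theta> x) = 1" using \<theta> by (simp add: admissible_theta_def)
  then show "(LINT x|lborel. \<theta> x) = 1"
    using integral_lebesgue_eq_lborel[of \<theta>] borel_measurable_continuous_onI[OF sm(3)] by simp
qed

section \<open>Derivatives of moments of the cut-off function\<close>

lemma partial_eqI:
  assumes "(f has_derivative f') (at x)"
  shows "partial i f x = f' (axis i 1)" "f differentiable (at x)"
  using assms frechet_derivative_at[OF assms] by (auto simp: partial_def differentiable_def)

lemma
  fixes f :: "(real, 'n::finite) vec \<Rightarrow> real"
  assumes "f differentiable (at x)"
  shows partial_coord_mult: "partial k (\<lambda>z. (z - a) $ i * f z) x = (if k = i then f x else 0) + (x - a) $ i * partial k f x"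
    and differentiable_coord_mult: "(\<lambda>z. (z - a) $ i * f z) differentiable (at x)"
proof -
  have D: "(f has_derivative frechet_derivative f (at x)) (at x)" using assms frechet_derivative_works by blast
  have "((\<lambda>z. (z - a) $ i * f z) has_derivative (\<lambda>h. (x - a) $ i * frechet_derivative f (at x) h + h $ i * f x)) (at x)"
    by (rule has_derivative_eq_rhs, rule has_derivative_mult[OF _ D])
       (auto intro!: derivative_eq_intros bounded_linear.has_derivative[OF bounded_linear_vec_nth])
  note * = partial_eqI[OF this]
  show "partial k (\<lambda>z. (z - a) $ i * f z) x = (if k = i then f x else 0) + (x - a) $ i * partial k f x"
    unfolding *(1) by (simp add: axis_def partial_def)
  show "(\<lambda>z. (z - a) $ i * f z) differentiable (at x)" by (rule *(2))
qed

lemma partial_add: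
  fixes f g :: "(real, 'n::finite) vec \<Rightarrow> real"
  assumes "f differentiable (at x)" "g differentiable (at x)"
  shows "partial k (\<lambda>z. f z + g z) x = partial k f x + partial k g x"
proof -
  have "(f has_derivative frechet_derivative f (at x)) (at x)" "(g has_derivative frechet_derivative g (at x)) (at x)"
    using assms frechet_derivative_works by blast+
  from has_derivative_add[OF this] show ?thesis by (subst partial_eqI(1)) (auto simp: partial_def)
qed

lemma test_function_partial:
  fixes f :: "(real, 'n::finite) vec \<Rightarrow> real"
  assumes "test_function U f"
  shows "test_function U (partial i f)"
proof -
  have "partial i f x = 0" if "x \<notin> closure {x. f x \<noteq> 0}" for x
  proof -
    have "(f has_derivative (\<lambda>_. 0)) (at x)"
    proof (rule has_derivative_transform_within_open[OF has_derivative_const[of 0]])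
      show "open (- closure {x. f x \<noteq> 0})" by (intro open_Compl closed_closure)
      show "x \<in> - closure {x. f x \<noteq> 0}" using that by simp
      show "0 = f y" if "y \<in> - closure {x. f x \<noteq> 0}" for y
        using that closure_subset[of "{x. f x \<noteq> 0}"] by auto
    qed
    then show ?thesis by (rule partial_eqI(1)[THEN trans]) simp
  qed
  then have "{x. partial i f x \<noteq> 0} \<subseteq> closure {x. f x \<noteq> 0}" by blast
  then have cl: "closure {x. partial i f x \<noteq> 0} \<subseteq> closure {x. f x \<noteq> 0}"
    by (rule closure_minimal) simp
  have "partials is (partial i f) = partials (is @ [i]) f" for "is"
    by (induction "is") auto
  then have "smooth (partial i f)" using assms by (simp add: test_function_def smooth_def)
  moreover have "compact (closure {x. partial i f x \<noteq> 0})"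
    using compact_Int_closed[of "closure {x. f x \<noteq> 0}" "closure {x. partial i f x \<noteq> 0}"] cl assms
    unfolding test_function_def by (metis Int_absorb1 closed_closure)
  ultimately show ?thesis using cl assms unfolding test_function_def by blast
qed

lemma C2c_test_function: "test_function U f \<Longrightarrow> C2c f"
  unfolding C2c_def using smooth_D[OF test_function_D(1)] test_function_D(2) by blast

text \<open>On the ball the factor (z - a)_i is at most rho, so the moment obeys the bounds of theta
  with an additional factor rho. By the product rule the pure second derivative contains at most two
  first derivatives of theta, hence the 2.\<close>

lemma moment_facts:
  fixes \<theta> :: "(real, 'n::finite) vec \<Rightarrow> real" and i :: 'n
  assumes t: "test_function (ball a r) \<theta>" and r: "r > 0"
  defines "\<rho> \<equiv> 2 * r" and "\<phi> \<equiv> \<lambda>z. (z - a) $ i * \<theta> z"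
  shows "C2c \<phi>" "\<bar>\<phi> x\<bar> \<le> \<rho> * \<bar>\<theta> x\<bar>" "\<bar>partial k \<phi> x\<bar> \<le> \<bar>\<theta> x\<bar> + \<rho> * \<bar>partial k \<theta> x\<bar>"
    "\<bar>partial k (partial k \<phi>) x\<bar> \<le> 2 * \<bar>partial k \<theta> x\<bar> + \<rho> * \<bar>partial k (partial k \<theta>) x\<bar>"
proof -
  note sm = smooth_D[OF test_function_D(1)[OF t]]
  note t1 = test_function_partial[OF t]
  have p1: "partial k \<phi> = (\<lambda>x. (if k = i then \<theta> x else 0) + (x - a) $ i * partial k \<theta> x)" for k
    unfolding \<phi>_def by (rule ext) (rule partial_coord_mult[OF sm(1)])
  have d1: "(\<lambda>x. if k = i then \<theta> x else 0) differentiable (at x)" for k x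
    by (cases "k = i") (use sm(1) in auto)
  have d2: "(\<lambda>x. (x - a) $ i * partial k \<theta> x) differentiable (at x)" for k x
    by (rule differentiable_coord_mult[OF sm(2)])
  have pif: "partial k (\<lambda>x. if k = i then \<theta> x else 0) x = (if k = i then partial k \<theta> x else 0)" for k x
    by (cases "k = i") (auto intro: partial_eqI(1)[OF has_derivative_const, THEN trans])
  have p2: "partial k (partial k \<phi>) = (\<lambda>x. (if k = i then partial k \<theta> x else 0) + ((if k = i then partial k \<theta> x else 0) + (x - a) $ i * partial k (partial k \<theta>) x))" for k
    unfolding p1 by (rule ext) (simp only: partial_add[OF d1 d2] pif partial_coord_mult[OF sm(2)])
  obtain s where s: "\<And>x. norm x > s \<Longrightarrow> \<theta> x = 0" using test_function_D(2)[OF t] by blast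
  show "C2c \<phi>"
    unfolding C2c_def p2
  proof (intro conjI allI)
    show "\<phi> differentiable (at x)" for x unfolding \<phi>_def by (rule differentiable_coord_mult[OF sm(1)])
    show "partial k \<phi> differentiable (at x)" for k x unfolding p1 by (rule differentiable_add[OF d1 d2])
    show "continuous_on UNIV (\<lambda>x. (if k = i then partial k \<theta> x else 0) + ((if k = i then partial k \<theta> x else 0) + (x - a) $ i * partial k (partial k \<theta>) x))" for k
      by (cases "k = i") (auto intro!: continuous_intros sm)
    show "\<exists>r. \<forall>x. r < norm x \<longrightarrow> \<phi> x = 0" using s by (intro exI[of _ s]) (simp add: \<phi>_def)
  qed
  have bd: "\<bar>(x - a) $ i * f x\<bar> \<le> \<rho> * \<bar>f x\<bar>" if f: "test_function (ball a r) f" for f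
  proof (cases "x \<in> ball a r")
    case True
    have "\<bar>(x - a) $ i\<bar> \<le> norm (x - a)" by (rule component_le_norm_cart)
    also have "\<dots> \<le> \<rho>" using True r by (simp add: \<rho>_def dist_norm norm_minus_commute)
    finally show ?thesis by (simp add: abs_mult mult_right_mono)
  next
    case False
    then show ?thesis using test_function_D(3)[OF f, of x] by simp
  qed
  show "\<bar>\<phi> x\<bar> \<le> \<rho> * \<bar>\<theta> x\<bar>" unfolding \<phi>_def by (rule bd[OF t])
  show "\<bar>partial k \<phi> x\<bar> \<le> \<bar>\<theta> x\<bar> + \<rho> * \<bar>partial k \<theta> x\<bar>"
    unfolding p1 by (rule order_trans[OF abs_triangle_ineq]) (intro add_mono bd t1; simp)
  have "\<bar>(if k = i then partial k \<theta> x else 0) + (x - a) $ i * partial k (partial k \<theta>) x\<bar> \<le> \<bar>partial k \<theta> x\<bar> + \<rho> * \<bar>partial k (partial k \<theta>) x\<bar>"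
    by (rule order_trans[OF abs_triangle_ineq]) (intro add_mono bd test_function_partial t1; simp)
  then show "\<bar>partial k (partial k \<phi>) x\<bar> \<le> 2 * \<bar>partial k \<theta> x\<bar> + \<rho> * \<bar>partial k (partial k \<theta>) x\<bar>"
    unfolding p2 by (cases "k = i"; simp; linarith)
qed

lemma (in bog_op_setting) bog_op_weakly_diff_bd:
  "weakly_diff_bd \<Omega> ((A / \<rho>)\<^sup>2 * (2 * S\<^sup>2 + sing_const CARD('n)) * (sq_norm g))
     (bog_op (bog_weight CARD('n) l) \<phi> g)"
proof -
  note [measurable] = weight_D(1)[OF weight_bog_weight]
  have m: "bog_op (bog_weight CARD('n) l) \<phi> g \<in> borel_measurable borel" by measurable
  have W: "\<exists>W. W \<in> borel_measurable borel \<and> sq_integrable W \<and>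
      (sq_norm W) \<le> (A / \<rho>)\<^sup>2 * (2 * S\<^sup>2 + sing_const CARD('n)) * (sq_norm g) \<and>
      (\<forall>h. test_function \<Omega> h \<longrightarrow> (LINT x|lborel. bog_op (bog_weight CARD('n) l) \<phi> g x * partial j h x) = - (LINT x|lborel. W x * h x))" for j
  proof -
    obtain W where W: "W \<in> borel_measurable borel" "sq_integrable W"
      "(sq_norm W) \<le> (A / \<rho>)\<^sup>2 * (2 * S\<^sup>2 + sing_const CARD('n)) * (sq_norm g)"
      "\<And>\<eta> r. (\<And>x. \<eta> differentiable (at x)) \<Longrightarrow> continuous_on UNIV (partial j \<eta>) \<Longrightarrow> (\<And>x. norm x > r \<Longrightarrow> \<eta> x = 0) \<Longrightarrow>
       (\<And>x. x \<notin> \<Omega> \<Longrightarrow> \<eta> x = 0) \<Longrightarrow>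
       (LINT x|lborel. bog_op (bog_weight CARD('n) l) \<phi> g x * partial j \<eta> x) = - (LINT x|lborel. W x * \<eta> x)"
      by (rule bog_op_weak_derivative) blast
    have "(LINT x|lborel. bog_op (bog_weight CARD('n) l) \<phi> g x * partial j h x) = - (LINT x|lborel. W x * h x)" if h: "test_function \<Omega> h" for h
    proof -
      note sm = smooth_D[OF test_function_D(1)[OF h]]
      obtain r where r: "\<And>x. norm x > r \<Longrightarrow> h x = 0" using test_function_D(2)[OF h] by blast
      show ?thesis by (rule W(4)[OF sm(1) sm(4) r test_function_D(3)[OF h]])
    qed
    then show ?thesis using W(1-3) by blast
  qed
  have "0 \<le> (A / \<rho>)\<^sup>2 * (2 * S\<^sup>2 + sing_const CARD('n)) * (sq_norm g)"
    using g2_nonneg by (intro mult_nonneg_nonneg add_nonneg_nonneg) auto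
  then show ?thesis
    unfolding weakly_diff_bd_def using m bog_op_L2 W by (intro conjI exI[of _ "bog_op (bog_weight CARD('n) l) \<phi> g"]) auto
qed

text \<open>The ball lies in a cube whose side is its diameter. This converts |\<Omega>| = q |B|
  into the bound q rho^n assumed in \<open>bog_op_setting\<close>.\<close>

lemma measure_ball_le:
  fixes a :: "'a::euclidean_space"
  assumes "r > 0"
  shows "measure lborel (ball a r) \<le> (2 * r) ^ DIM('a)"
proof -
  let ?B = "cbox (a - r *\<^sub>R One) (a + r *\<^sub>R One)"
  have "ball a r \<subseteq> ?B"
  proof
    fix x assume "x \<in> ball a r"
    then have n: "norm (x - a) < r" by (simp add: dist_norm norm_minus_commute)
    have "\<bar>(x - a) \<bullet> b\<bar> \<le> r" if "b \<in> Basis" for b using Basis_le_norm[OF that, of "x - a"] n by linarith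
    then show "x \<in> ?B" by (auto simp: mem_box inner_diff_left inner_add_left abs_le_iff) (force simp: algebra_simps)+
  qed
  then have "measure lborel (ball a r) \<le> measure lborel ?B"
    by (rule measure_mono_fmeasurable) (auto intro: fmeasurable_cbox)
  also have "\<dots> = (\<Prod>b\<in>(Basis::'a set). 2 * r)"
    using assms by (subst content_cbox) (auto simp: inner_diff_left inner_add_left intro!: prod.cong)
  finally show ?thesis by simp
qed


section \<open>The main estimate\<close>


definition ratio_factor :: "nat \<Rightarrow> nat \<Rightarrow> real \<Rightarrow> real" where
  "ratio_factor n l q = (if real l < real n / 2 + 1 then 1
     else 1 + ln q powr (n / (2 * (real l - 1))) * q powr ((2 * (real l - 1) - n) / (2 * (real l - 1))))"

lemma kappa_eq_ratio_factor:
  "kappa l U B = ratio_factor CARD('n) l (measure lebesgue U / measure lebesgue (B :: (real, 'n::finite) vec set))"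
  by (simp add: kappa_def ratio_factor_def Let_def)

lemma ratio_factor_ge_1: "ratio_factor n l q \<ge> 1"
  by (simp add: ratio_factor_def)

lemma regular_integral_bound:
  assumes l: "1 \<le> l" "l \<le> n"
  shows "\<exists>C\<ge>0. \<forall>q\<ge>1. regular_mass n l q
    \<le> ennreal (C * ratio_factor n l q)"
proof (cases "real l < real n / 2 + 1")
  case True
  then show ?thesis
    using regular_integral_small[OF l True]
    by (intro exI[of _ "2 ^ n / (real n / 2 - real l + 1)"]) (simp add: ratio_factor_def)
next
  case False
  then have large: "real l \<ge> real n / 2 + 1" by simp
  obtain C where C: "C \<ge> 0" "\<And>q. q \<ge> 1 \<Longrightarrow> q powr ((real l - 1 - real n / 2) / n) * (1 + ln q) \<le>
     C * (1 + ln q powr (n / (2 * (real l - 1))) * q powr ((2 * (real l - 1) - n) / (2 * (real l - 1))))"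
    using log_power_absorb[OF l large] by blast
  have "regular_mass n l q
    \<le> ennreal ((2 ^ n * C) * ratio_factor n l q)" if q: "q \<ge> 1" for q
  proof -
    note regular_integral_large[OF l large q]
    also have "ennreal (2 ^ n * (q powr ((real l - 1 - real n / 2) / n) * (1 + ln q))) \<le> ennreal ((2 ^ n * C) * ratio_factor n l q)"
      unfolding ratio_factor_def if_not_P[OF False] mult.assoc by (intro ennreal_leI mult_left_mono C(2) q) simp
    finally show ?thesis .
  qed
  then show ?thesis using C(1) by (intro exI[of _ "2 ^ n * C"]) auto
qed

context
  fixes c :: "('n::{finite,linorder} \<Rightarrow> nat) \<Rightarrow> real" and l :: nat and Cs M :: real
    and \<Omega> :: "(real, 'n) vec set" and a :: "(real, 'n) vec" and r :: real and \<theta> :: "(real, 'n) vec \<Rightarrow> real"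
  assumes l: "1 \<le> l" "l \<le> CARD('n)"
    and M: "M = \<bar>c (\<lambda>_. 0)\<bar> + (\<Sum>k\<in>UNIV. \<bar>c (\<lambda>i. if i = k then 1 else 0)\<bar>) + (\<Sum>k\<in>UNIV. \<bar>c (\<lambda>i. if i = k then 2 else 0)\<bar>)"
    and Cs: "Cs \<ge> 0" "\<And>q. q \<ge> 1 \<Longrightarrow> regular_mass CARD('n) l q
      \<le> ennreal (Cs * ratio_factor CARD('n) l q)"
    and \<Omega>: "open \<Omega>" "bounded \<Omega>" "ball a r \<subseteq> \<Omega>" and r: "r > 0"
    and \<theta>: "admissible_theta c (ball a r) \<theta>"
begin

lemma ratio_ge_1: "measure lebesgue \<Omega> / measure lebesgue (ball a r) \<ge> 1"
proof -
  have "measure lborel (ball a r) \<le> measure lborel \<Omega>"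
    using \<Omega> by (intro measure_mono_fmeasurable) (auto intro!: fmeasurableI emeasure_bounded_finite)
  moreover have "measure lborel (ball a r) > 0" by (rule content_ball_pos[OF r])
  ultimately show ?thesis using \<Omega>(1) by simp
qed

lemma diameter_ge: "2 * r \<le> diameter \<Omega>"
  using diameter_subset[OF \<Omega>(3,2)] diameter_ball_eq[OF r, of a] by simp

lemma emeasure_Omega_le:
  "emeasure lborel \<Omega> \<le> ennreal ((measure lebesgue \<Omega> / measure lebesgue (ball a r)) * (2 * r) ^ CARD('n))"
proof -
  let ?b = "measure lborel (ball a r)"
  have b: "?b > 0" by (rule content_ball_pos[OF r])
  have "emeasure lborel \<Omega> = ennreal (measure lborel \<Omega>)"
    using emeasure_bounded_finite[OF \<Omega>(2)] by (intro emeasure_eq_ennreal_measure) simp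
  also have "measure lborel \<Omega> = measure lborel \<Omega> / ?b * ?b" using b by simp
  also have "\<dots> \<le> measure lborel \<Omega> / ?b * (2 * r) ^ CARD('n)"
    using measure_ball_le[OF r, of a] b by (intro mult_left_mono) auto
  finally show ?thesis using \<Omega>(1) by (simp add: ennreal_leI)
qed

text \<open>Here R/rho is produced. Theta against (y - a)_i g costs M/rho for the derivative and R
  for the moment; the moment of theta against g costs 3 M, which is at most 3 M R/rho because rho <=
  R. The outer 4 is the price of subtracting two functions with equal bounds.\<close>

lemma bogovskii_piece:
  fixes g u :: "(real, 'n) vec \<Rightarrow> real"
  assumes g: "g \<in> borel_measurable borel" "\<And>y. y \<notin> \<Omega> \<Longrightarrow> g y = 0" "sq_integrable g"
    and u: "u \<in> borel_measurable lebesgue" "AE y in lborel. u y = g y"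
  defines "\<kappa> \<equiv> ratio_factor CARD('n) l (measure lebesgue \<Omega> / measure lebesgue (ball a r))"
  defines "D \<equiv> 2 * Cs\<^sup>2 + sing_const CARD('n)"
  shows "AE x in lborel. integrable lebesgue (\<lambda>y. bogovskii_kernel l \<theta> x y * ((x - y) $ i * u y))"
    and "weakly_diff_bd \<Omega> (4 * ((3 * M * (diameter \<Omega> / (2 * r)) * \<kappa>)\<^sup>2 * D * (sq_norm g)))
      (\<lambda>x. LINT y|lebesgue. bogovskii_kernel l \<theta> x y * ((x - y) $ i * u y))"
proof -
  let ?n = "CARD('n)" and ?w = "bog_weight CARD('n) l"
  define q where "q = measure lebesgue \<Omega> / measure lebesgue (ball a r)"
  define \<rho> where "\<rho> = 2 * r"
  define R where "R = diameter \<Omega>"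
  define G where "G = (sq_norm g)"
  define S where "S = Cs * \<kappa>"
  define Q where "Q = 2 * S\<^sup>2 + sing_const ?n"
  define \<phi> where "\<phi> = (\<lambda>z. (z - a) $ i * \<theta> z)"
  define g1 where "g1 = (\<lambda>y. (y - a) $ i * g y)"
  have \<rho>: "\<rho> > 0" and R: "\<rho> \<le> R" and q: "q \<ge> 1"
    using r diameter_ge ratio_ge_1 by (simp_all add: \<rho>_def R_def q_def)
  have \<kappa>1: "\<kappa> \<ge> 1" unfolding \<kappa>_def by (rule ratio_factor_ge_1)
  have S0: "S \<ge> 0" unfolding S_def using Cs(1) \<kappa>1 by simp
  note B = admissible_theta_bounds[OF \<theta> r, folded M \<rho>_def]
  have M0: "M \<ge> 0" by (rule B(7))
  have t: "test_function (ball a r) \<theta>" using \<theta> by (simp add: admissible_theta_def)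
  note sm = smooth_D[OF test_function_D(1)[OF t]]
  have mf: "C2c \<phi>" "\<bar>\<phi> x\<bar> \<le> \<rho> * \<bar>\<theta> x\<bar>" "\<bar>partial k \<phi> x\<bar> \<le> \<bar>\<theta> x\<bar> + \<rho> * \<bar>partial k \<theta> x\<bar>"
    "\<bar>partial k (partial k \<phi>) x\<bar> \<le> 2 * \<bar>partial k \<theta> x\<bar> + \<rho> * \<bar>partial k (partial k \<theta>) x\<bar>" for x k
    unfolding \<phi>_def \<rho>_def by (rule moment_facts[OF t r])+
  have vm [measurable]: "(\<lambda>y. (y - a) $ i) \<in> borel_measurable borel"
    by (intro borel_measurable_continuous_onI continuous_intros)
  note [measurable] = g(1)
  have \<Omega>b: "\<Omega> \<in> sets borel" using \<Omega>(1) by simp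
  have aO: "a \<in> \<Omega>" using \<Omega>(3) r by auto
  have g1sq: "(g1 y)\<^sup>2 \<le> R\<^sup>2 * (g y)\<^sup>2" for y
  proof (cases "y \<in> \<Omega>")
    case True
    have "\<bar>(y - a) $ i\<bar> \<le> norm (y - a)" by (rule component_le_norm_cart)
    also have "\<dots> \<le> R" using diameter_bounded_bound[OF \<Omega>(2) True aO] by (simp add: R_def dist_norm)
    finally have "((y - a) $ i)\<^sup>2 \<le> R\<^sup>2" by (metis abs_ge_zero power2_abs power_mono)
    then show ?thesis by (simp add: g1_def power_mult_distrib mult_right_mono)
  next
    case False
    then show ?thesis using g(2) by (simp add: g1_def)
  qed
  have g1m: "g1 \<in> borel_measurable borel" unfolding g1_def by measurable
  have iR: "integrable lborel (\<lambda>y. R\<^sup>2 * (g y)\<^sup>2)" using g(3) by simp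
  have g12: "sq_integrable g1"
    by (rule Bochner_Integration.integrable_bound[OF iR]) (use g1m g1sq in auto)
  have G1: "(sq_norm g1) \<le> R\<^sup>2 * G"
    unfolding G_def integral_mult_right_zero[symmetric] by (rule integral_mono[OF g12 iR g1sq])
  have G0: "G \<ge> 0" unfolding G_def by (rule Bochner_Integration.integral_nonneg) simp
  have vol: "emeasure lborel \<Omega> \<le> ennreal (q * \<rho> ^ ?n)" unfolding q_def \<rho>_def by (rule emeasure_Omega_le)
  have Sge: "regular_mass ?n l q \<le> ennreal S"
    unfolding S_def \<kappa>_def q_def[symmetric] by (rule Cs(2)[OF q])
  interpret T: bog_op_setting \<theta> g1 M \<rho> q S l \<Omega>
  proof
    show "C2c \<theta>" by (rule C2c_test_function[OF t])
    show "g1 y = 0" if "y \<notin> \<Omega>" for y using g(2)[OF that] by (simp add: g1_def)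
  qed (use l \<rho> M0 q S0 B \<Omega>b vol g1m g12 Sge in auto)
  have ic: "integrable lborel f" if "test_function (ball a r) f" for f
    using integrable_continuous_bounded_support(1)[OF smooth_D(3)[OF test_function_D(1)[OF that]]] test_function_D(2)[OF that] by blast
  have i\<theta>: "integrable lborel \<theta>" "integrable lborel (partial k \<theta>)" "integrable lborel (partial k (partial k \<theta>))" for k
    by (intro ic t test_function_partial)+
  have \<rho>M: "3 * M * \<rho> / \<rho> = 3 * M" "3 * M * \<rho> / \<rho>\<^sup>2 = 3 * M / \<rho>" "3 * M * \<rho> / \<rho> ^ (?n + 1) = 3 * M / \<rho> ^ ?n"
    using \<rho> by (simp_all add: power2_eq_square)
  obtain s where s: "\<And>x. norm x > s \<Longrightarrow> \<phi> x = 0" using C2c_D(6)[OF mf(1)] by blast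
  have s1: "partial k \<phi> x = 0" if "norm x > s" for k x by (rule partial_eq_0_outside[OF s that])
  have s2: "partial k (partial k \<phi>) x = 0" if "norm x > s" for k x by (rule partial_eq_0_outside[OF s1 that])
  have i\<phi>: "integrable lborel \<phi>" "integrable lborel (partial k \<phi>)" "integrable lborel (partial k (partial k \<phi>))" for k
  proof -
    show "integrable lborel \<phi>" by (rule integrable_continuous_bounded_support(1)[OF C2c_D(4)[OF mf(1)] s])
    show "integrable lborel (partial k \<phi>)" by (rule integrable_continuous_bounded_support(1)[OF C2c_D(5)[OF mf(1)] s1])
    show "integrable lborel (partial k (partial k \<phi>))" by (rule integrable_continuous_bounded_support(1)[OF C2c_D(3)[OF mf(1)] s2])
  qed
  \<comment> \<open>The 3 is dictated by the second derivatives: 2 (M / rho) + rho (M / rho^2) = 3 M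
    / rho.\<close>
  interpret P: bog_op_setting \<phi> g "3 * M * \<rho>" \<rho> q S l \<Omega>
  proof
    show "C2c \<phi>" by (rule mf(1))
    have "(LINT x|lborel. \<bar>\<phi> x\<bar>) \<le> (LINT x|lborel. \<rho> * \<bar>\<theta> x\<bar>)"
      by (rule integral_mono) (use i\<phi> i\<theta> mf(2) in auto)
    also have "\<dots> \<le> \<rho> * M" using B(1) \<rho> by (simp add: mult_left_mono)
    also have "\<dots> \<le> 3 * M * \<rho>" using M0 \<rho> by simp
    finally show "(LINT x|lborel. \<bar>\<phi> x\<bar>) \<le> 3 * M * \<rho>" .
    show "(LINT x|lborel. \<bar>partial k \<phi> x\<bar>) \<le> 3 * M * \<rho> / \<rho>" for k
    proof -
      have "(LINT x|lborel. \<bar>partial k \<phi> x\<bar>) \<le> (LINT x|lborel. \<bar>\<theta> x\<bar> + \<rho> * \<bar>partial k \<theta> x\<bar>)"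
        by (rule integral_mono) (use i\<phi> i\<theta> mf(3) in auto)
      also have "\<dots> = (LINT x|lborel. \<bar>\<theta> x\<bar>) + \<rho> * (LINT x|lborel. \<bar>partial k \<theta> x\<bar>)" using i\<theta> by simp
      also have "\<dots> \<le> M + \<rho> * (M / \<rho>)" using B(1) B(2)[of k] \<rho> by (intro add_mono mult_left_mono) auto
      also have "\<dots> \<le> 3 * M" using M0 \<rho> by simp
      finally show ?thesis unfolding \<rho>M .
    qed
    show "(LINT x|lborel. \<bar>partial k (partial k \<phi>) x\<bar>) \<le> 3 * M * \<rho> / \<rho>\<^sup>2" for k
    proof -
      have "(LINT x|lborel. \<bar>partial k (partial k \<phi>) x\<bar>) \<le> (LINT x|lborel. 2 * \<bar>partial k \<theta> x\<bar> + \<rho> * \<bar>partial k (partial k \<theta>) x\<bar>)"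
        by (rule integral_mono) (use i\<phi> i\<theta> mf(4) in auto)
      also have "\<dots> = 2 * (LINT x|lborel. \<bar>partial k \<theta> x\<bar>) + \<rho> * (LINT x|lborel. \<bar>partial k (partial k \<theta>) x\<bar>)" using i\<theta> by simp
      also have "\<dots> \<le> 2 * (M / \<rho>) + \<rho> * (M / \<rho>\<^sup>2)" using B(2)[of k] B(3)[of k] \<rho> by (intro add_mono mult_left_mono) auto
      also have "\<dots> = 3 * M / \<rho>" using \<rho> by (simp add: power2_eq_square)
      finally show ?thesis unfolding \<rho>M .
    qed
    show "\<bar>partial k \<phi> x\<bar> \<le> 3 * M * \<rho> / \<rho> ^ (?n + 1)" for k x
    proof -
      have "\<bar>partial k \<phi> x\<bar> \<le> M / \<rho> ^ ?n + \<rho> * (M / \<rho> ^ (?n + 1))"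
        using mf(3)[of k x] B(4)[of x] mult_left_mono[OF B(5)[of k x], of \<rho>] \<rho> by linarith
      also have "\<dots> = 2 * M / \<rho> ^ ?n" using \<rho> by simp
      also have "\<dots> \<le> 3 * M / \<rho> ^ ?n" using M0 \<rho> by (intro divide_right_mono) auto
      finally show ?thesis unfolding \<rho>M .
    qed
  qed (use l \<rho> M0 q S0 \<Omega>b vol g Sge in auto)
  define K where "K = (3 * M * (R / \<rho>))\<^sup>2 * Q * G"
  have Q0: "Q \<ge> 0" unfolding Q_def by simp
  have wT: "weakly_diff_bd \<Omega> K (bog_op ?w \<theta> g1)"
  proof (rule weakly_diff_bd_mono[OF T.bog_op_weakly_diff_bd])
    have "(M / \<rho>)\<^sup>2 * Q * (sq_norm g1) \<le> (M / \<rho>)\<^sup>2 * Q * (R\<^sup>2 * G)"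
      using G1 Q0 by (intro mult_left_mono) auto
    also have "\<dots> = (M * (R / \<rho>))\<^sup>2 * Q * G" by (simp add: power_mult_distrib power_divide)
    also have "\<dots> \<le> K" unfolding K_def using M0 R \<rho> Q0 G0 by (intro mult_right_mono power_mono) auto
    finally show "(M / \<rho>)\<^sup>2 * (2 * S\<^sup>2 + sing_const ?n) * (sq_norm g1) \<le> K"
      unfolding Q_def .
  qed
  have wP: "weakly_diff_bd \<Omega> K (bog_op ?w \<phi> g)"
  proof (rule weakly_diff_bd_mono[OF P.bog_op_weakly_diff_bd])
    have "3 * M * 1 \<le> 3 * M * (R / \<rho>)" using M0 R \<rho> by (intro mult_left_mono) auto
    then have "(3 * M)\<^sup>2 * Q * G \<le> K" unfolding K_def using M0 Q0 G0 by (intro mult_right_mono power_mono) auto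
    then show "(3 * M * \<rho> / \<rho>)\<^sup>2 * (2 * S\<^sup>2 + sing_const ?n) * (sq_norm g) \<le> K"
      unfolding \<rho>M Q_def G_def .
  qed
  have piece: "AE x in lborel. integrable lebesgue (\<lambda>y. bogovskii_kernel l \<theta> x y * ((x - y) $ i * u y)) \<and>
     (LINT y|lebesgue. bogovskii_kernel l \<theta> x y * ((x - y) $ i * u y)) = bog_op ?w \<phi> g x - bog_op ?w \<theta> g1 x"
    using kernel_piece[OF l i\<theta>(1) i\<phi>(1)[unfolded \<phi>_def] P.g1 T.g1[unfolded g1_def] u] unfolding \<phi>_def g1_def .
  then show "AE x in lborel. integrable lebesgue (\<lambda>y. bogovskii_kernel l \<theta> x y * ((x - y) $ i * u y))"
    by eventually_elim blast
  have "weakly_diff_bd \<Omega> (2 * K + 2 * ((- 1)\<^sup>2 * K)) (\<lambda>x. bog_op ?w \<phi> g x + (- 1) * bog_op ?w \<theta> g1 x)"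
    by (rule weakly_diff_bd_add[OF wP weakly_diff_bd_cmult[OF wT]])
  then have "weakly_diff_bd \<Omega> (4 * K) (\<lambda>x. bog_op ?w \<phi> g x - bog_op ?w \<theta> g1 x)" by simp
  moreover have "K \<le> (3 * M * (diameter \<Omega> / (2 * r)) * \<kappa>)\<^sup>2 * D * G"
  proof -
    \<comment> \<open>Only the regular part carries \<open>\<kappa>\<close>; as
      \<open>\<kappa> \<ge> 1\<close>, the singular constant may be multiplied by its square
      too.\<close>
    have "Q \<le> D * \<kappa>\<^sup>2"
    proof -
      have "2 * 2 ^ ?n * (pi * (1 + real ?n) / 2)\<^sup>2 * 1 \<le> 2 * 2 ^ ?n * (pi * (1 + real ?n) / 2)\<^sup>2 * \<kappa>\<^sup>2"
        using \<kappa>1 by (intro mult_left_mono one_le_power) auto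
      then show ?thesis unfolding Q_def D_def S_def by (simp add: power_mult_distrib distrib_right)
    qed
    then have "(3 * M * (R / \<rho>))\<^sup>2 * Q * G \<le> (3 * M * (R / \<rho>))\<^sup>2 * (D * \<kappa>\<^sup>2) * G"
      using G0 by (intro mult_right_mono mult_left_mono) auto
    then show ?thesis unfolding K_def R_def \<rho>_def by (simp only: power_mult_distrib mult_ac)
  qed
  ultimately have "weakly_diff_bd \<Omega> (4 * ((3 * M * (diameter \<Omega> / (2 * r)) * \<kappa>)\<^sup>2 * D * G)) (\<lambda>x. bog_op ?w \<phi> g x - bog_op ?w \<theta> g1 x)"
    by (elim weakly_diff_bd_mono) simp
  then show "weakly_diff_bd \<Omega> (4 * ((3 * M * (diameter \<Omega> / (2 * r)) * \<kappa>)\<^sup>2 * D * (sq_norm g)))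
      (\<lambda>x. LINT y|lebesgue. bogovskii_kernel l \<theta> x y * ((x - y) $ i * u y))"
    unfolding G_def[symmetric] by (rule weakly_diff_bd_AE) (use piece in \<open>eventually_elim, blast\<close>)
qed

end

theorem corollary4p8:
  fixes c :: "('n::{finite,linorder} \<Rightarrow> nat) \<Rightarrow> real" and l :: nat
  assumes c_large: "\<And>(a :: (real, 'n) vec) r. r > 0 \<Longrightarrow> \<exists>\<theta>. admissible_theta c (ball a r) \<theta>"
    and l: "l \<in> {1..CARD('n)}"
  shows "\<exists>C :: real. \<forall>(\<Omega> :: (real, 'n) vec set) (a :: (real, 'n) vec) (r :: real) \<theta> u.
     open \<Omega> \<and> connected \<Omega> \<and> bounded \<Omega> \<and> r > 0 \<and> star_shaped_wrt \<Omega> (ball a r) \<and>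
     admissible_theta c (ball a r) \<theta> \<and> L2_form l \<Omega> u \<longrightarrow>
       H1_form (l - 1) \<Omega> (bogovskii l \<theta> \<Omega> u) \<and>
       H1_form_seminorm (l - 1) \<Omega> (bogovskii l \<theta> \<Omega> u)
         \<le> C * (diameter \<Omega> / diameter (ball a r)) * kappa l \<Omega> (ball a r) * L2_form_norm l \<Omega> u"
proof -
  have l': "1 \<le> l" "l \<le> CARD('n)" using l by auto
  \<comment> \<open>All constants from here to \<open>C\<close> are fixed before \<Omega>, the ball,
    theta and u are chosen: they are built from n, l and the family \<open>c\<close>.\<close>
  define M where "M = \<bar>c (\<lambda>_. 0)\<bar> + (\<Sum>k\<in>UNIV. \<bar>c (\<lambda>i. if i = k then 1 else 0)\<bar>) + (\<Sum>k\<in>UNIV. \<bar>c (\<lambda>i. if i = k then 2 else 0)\<bar>)"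
  obtain Cs where Cs: "Cs \<ge> 0" "\<And>q. q \<ge> 1 \<Longrightarrow> regular_mass CARD('n) l q
      \<le> ennreal (Cs * ratio_factor CARD('n) l q)"
    using regular_integral_bound[OF l'] by blast
  define D where "D = 2 * Cs\<^sup>2 + sing_const CARD('n)"
  let ?IC = "inc_tuples l :: 'n list set" and ?JC = "inc_tuples (l - 1) :: 'n list set"
  define e where "e K J I m = form_coeff (dx J) K * ((-1) ^ m * form_coeff (dx (drop_nth m I)) J)" for K J I :: "'n list" and m
  \<comment> \<open>A sum of squares over the finite index set bounds every single coefficient
    square.\<close>
  define \<Gamma> where "\<Gamma> = (\<Sum>(K, J, I, m)\<in>?JC \<times> ?JC \<times> ?IC \<times> {..<l}. (e K J I m)\<^sup>2)"
  have e\<Gamma>: "(e K J I m)\<^sup>2 \<le> \<Gamma>" if "K \<in> ?JC" "J \<in> ?JC" "I \<in> ?IC" "m < l" for K J I m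
    unfolding \<Gamma>_def
    using member_le_sum[of "(K, J, I, m)" "?JC \<times> ?JC \<times> ?IC \<times> {..<l}" "\<lambda>(K, J, I, m). (e K J I m)\<^sup>2"] that
    by (auto simp: finite_inc_tuples)
  \<comment> \<open>One factor for each of the three nested sums over J, I and m, then
    \<open>\<Gamma>\<close> for the coefficients; the last 4 comes from the bound
    \<open>4 * X\<close> on a single piece.\<close>
  define E where "E = 4 ^ card ?JC * (4 ^ card ?IC * (4 ^ l * (\<Gamma> * 4)))"
  have \<Gamma>0: "\<Gamma> \<ge> 0" unfolding \<Gamma>_def by (rule sum_nonneg) auto
  define C where "C = sqrt (real (card ?JC) * (CARD('n) * (E * ((3 * M)\<^sup>2 * D))))"
  \<comment> \<open>The assumption that \<open>c\<close> admits a cut-off on every ball provides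
    mollifiers at all scales, with L^1 norms bounded by the same \<open>M\<close>.\<close>
  have moll: "\<exists>f. test_function (ball (0 :: (real, 'n) vec) d) f \<and> (LINT x|lborel. f x) = 1 \<and> (LINT x|lborel. \<bar>f x\<bar>) \<le> M" if "d > 0" for d
  proof -
    obtain f where f: "admissible_theta c (ball (0 :: (real, 'n) vec) d) f" using c_large[OF \<open>d > 0\<close>] by blast
    have "test_function (ball 0 d) f" using f by (simp add: admissible_theta_def)
    then show ?thesis using admissible_theta_bounds(1,6)[OF f \<open>d > 0\<close>, folded M_def] by blast
  qed
  show ?thesis
  proof (rule exI[of _ C], intro allI impI, elim conjE)
    fix \<Omega> :: "(real, 'n) vec set" and a r \<theta> u
    assume \<Omega>: "open \<Omega>" "bounded \<Omega>" and r: "r > 0" and star: "star_shaped_wrt \<Omega> (ball a r)"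
      and \<theta>: "admissible_theta c (ball a r) \<theta>" and u: "L2_form l \<Omega> u"
    have B: "ball a r \<subseteq> \<Omega>" using star by (simp add: star_shaped_wrt_def)
    define \<kappa> where "\<kappa> = kappa l \<Omega> (ball a r)"
    have \<kappa>: "\<kappa> = ratio_factor CARD('n) l (measure lebesgue \<Omega> / measure lebesgue (ball a r))"
      unfolding \<kappa>_def by (rule kappa_eq_ratio_factor)
    have \<kappa>1: "\<kappa> \<ge> 1" unfolding \<kappa> by (rule ratio_factor_ge_1)
    define t where "t = diameter \<Omega> / (2 * r)"
    have t0: "t \<ge> 0" unfolding t_def using r diameter_ge_0[OF \<Omega>(2)] by simp
    define N where "N = L2_form_norm l \<Omega> u"
    have N2: "N\<^sup>2 = (\<Sum>I\<in>?IC. (L2_norm \<Omega> (\<lambda>x. form_coeff (u x) I))\<^sup>2)"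
      unfolding N_def L2_form_norm_def by (rule real_sqrt_pow2) (simp add: sum_nonneg)
    have N0: "N \<ge> 0" unfolding N_def L2_form_norm_def by (simp add: sum_nonneg)
    define X where "X = (3 * M * t * \<kappa>)\<^sup>2 * D * N\<^sup>2"
    have D0: "D \<ge> 0" unfolding D_def by simp
    have X0: "X \<ge> 0" unfolding X_def using D0 by simp
    define uu where "uu I y = (if y \<in> \<Omega> then form_coeff (u y) I else 0)" for I y
    define p where "p I i x = (LINT y|lebesgue. bogovskii_kernel l \<theta> x y * ((x - y) $ i * uu I y))" for I i x
    have \<Omega>l: "\<Omega> \<in> sets lebesgue" "\<Omega> \<in> sets borel" using \<Omega>(1) by auto
    have pieces: "AE x in lborel. integrable lebesgue (\<lambda>y. bogovskii_kernel l \<theta> x y * ((x - y) $ i * uu I y))"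
      "weakly_diff_bd \<Omega> (4 * X) (p I i)" if I: "I \<in> ?IC" for I i
    proof -
      have L: "L2 \<Omega> (\<lambda>x. form_coeff (u x) I)" using u I by (simp add: L2_form_def)
      have um: "uu I \<in> borel_measurable lebesgue"
        unfolding uu_def using L \<Omega>l by (simp add: L2_def borel_measurable_if)
      obtain g where g: "g \<in> borel_measurable borel" "\<And>x. x \<notin> \<Omega> \<Longrightarrow> g x = 0"
        "AE x in lborel. (if x \<in> \<Omega> then form_coeff (u x) I else 0) = g x" "sq_integrable g"
        "(L2_norm \<Omega> (\<lambda>x. form_coeff (u x) I))\<^sup>2 = (sq_norm g)"
        by (rule L2_borel_representative[OF L \<Omega>l(2)]) blast
      have ae: "AE y in lborel. uu I y = g y" using g(3) by (simp add: uu_def)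
      note bp = bogovskii_piece[OF l' M_def Cs \<Omega> B r \<theta> g(1,2,4) um ae, of i, folded \<kappa> D_def t_def]
      show "AE x in lborel. integrable lebesgue (\<lambda>y. bogovskii_kernel l \<theta> x y * ((x - y) $ i * uu I y))" by (rule bp(1))
      have "(sq_norm g) \<le> N\<^sup>2"
        unfolding N2 g(5)[symmetric] by (rule member_le_sum[OF I]) (auto simp: finite_inc_tuples)
      then have "4 * ((3 * M * t * \<kappa>)\<^sup>2 * D * (sq_norm g)) \<le> 4 * X"
        unfolding X_def using D0 by (intro mult_left_mono) auto
      with bp(2) show "weakly_diff_bd \<Omega> (4 * X) (p I i)"
        unfolding p_def[abs_def] by (rule weakly_diff_bd_mono)
    qed
    let ?b = "\<lambda>K x. form_coeff (bogovskii l \<theta> \<Omega> u x) K"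
    \<comment> \<open>The coefficient is defined as the integral of a sum. Splitting it requires
      every summand to be integrable, which holds simultaneously for the finitely many pieces at
      almost every x.\<close>
    have "AE x in lborel. \<forall>I\<in>?IC. \<forall>i\<in>UNIV. integrable lebesgue (\<lambda>y. bogovskii_kernel l \<theta> x y * ((x - y) $ i * uu I y))"
      by (intro AE_finite_allI finite_inc_tuples finite pieces(1))
    then have coeff: "AE x in lborel. ?b K x = (\<Sum>J\<in>?JC. \<Sum>I\<in>?IC. \<Sum>m<l. e K J I m * p I (I ! m) x)" for K
    proof eventually_elim
      case (elim x)
      have "?b K x = (\<Sum>J\<in>?JC. form_coeff (dx J) K *
         (LINT y|lebesgue. (\<Sum>I\<in>?IC. \<Sum>m<l. ((-1) ^ m * form_coeff (dx (drop_nth m I)) J) * (bogovskii_kernel l \<theta> x y * ((x - y) $ (I ! m) * uu I y)))))"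
        unfolding uu_def by (rule form_coeff_bogovskii)
      also have "\<dots> = (\<Sum>J\<in>?JC. form_coeff (dx J) K *
         (\<Sum>I\<in>?IC. \<Sum>m<l. ((-1) ^ m * form_coeff (dx (drop_nth m I)) J) * p I (I ! m) x))"
      proof (intro sum.cong refl arg_cong2[where f = "(*)"])
        fix J
        have int: "integrable lebesgue (\<lambda>y. ((-1) ^ m * form_coeff (dx (drop_nth m I)) J) * (bogovskii_kernel l \<theta> x y * ((x - y) $ (I ! m) * uu I y)))"
          if "I \<in> ?IC" for I m
          using elim that by (intro integrable_mult_right) blast
        have "(LINT y|lebesgue. (\<Sum>I\<in>?IC. \<Sum>m<l. ((-1) ^ m * form_coeff (dx (drop_nth m I)) J) * (bogovskii_kernel l \<theta> x y * ((x - y) $ (I ! m) * uu I y)))) =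
          (\<Sum>I\<in>?IC. LINT y|lebesgue. (\<Sum>m<l. ((-1) ^ m * form_coeff (dx (drop_nth m I)) J) * (bogovskii_kernel l \<theta> x y * ((x - y) $ (I ! m) * uu I y))))"
          by (rule Bochner_Integration.integral_sum) (intro Bochner_Integration.integrable_sum int)
        also have "\<dots> = (\<Sum>I\<in>?IC. \<Sum>m<l. LINT y|lebesgue. ((-1) ^ m * form_coeff (dx (drop_nth m I)) J) * (bogovskii_kernel l \<theta> x y * ((x - y) $ (I ! m) * uu I y)))"
          by (intro sum.cong refl Bochner_Integration.integral_sum int)
        finally show "(LINT y|lebesgue. (\<Sum>I\<in>?IC. \<Sum>m<l. ((-1) ^ m * form_coeff (dx (drop_nth m I)) J) * (bogovskii_kernel l \<theta> x y * ((x - y) $ (I ! m) * uu I y)))) =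
          (\<Sum>I\<in>?IC. \<Sum>m<l. ((-1) ^ m * form_coeff (dx (drop_nth m I)) J) * p I (I ! m) x)"
          unfolding p_def by (simp only: integral_mult_right_zero)
      qed
      also have "\<dots> = (\<Sum>J\<in>?JC. \<Sum>I\<in>?IC. \<Sum>m<l. e K J I m * p I (I ! m) x)"
        unfolding e_def by (simp only: sum_distrib_left mult.assoc)
      finally show ?case .
    qed
    have wd: "weakly_diff_bd \<Omega> (E * X) (?b K)" if K: "K \<in> ?JC" for K
    proof -
      have "weakly_diff_bd \<Omega> (\<Gamma> * (4 * X)) (\<lambda>x. e K J I m * p I (I ! m) x)" if "J \<in> ?JC" "I \<in> ?IC" "m < l" for J I m
        by (rule weakly_diff_bd_mono[OF weakly_diff_bd_cmult[OF pieces(2)]])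
           (use that e\<Gamma>[OF K that] X0 in \<open>auto intro!: mult_right_mono\<close>)
      then have "weakly_diff_bd \<Omega> (4 ^ card {..<l} * (\<Gamma> * (4 * X))) (\<lambda>x. \<Sum>m<l. e K J I m * p I (I ! m) x)" if "J \<in> ?JC" "I \<in> ?IC" for J I
        using that \<Gamma>0 X0 by - (rule weakly_diff_bd_sum, auto)
      then have "weakly_diff_bd \<Omega> (4 ^ card ?IC * (4 ^ card {..<l} * (\<Gamma> * (4 * X)))) (\<lambda>x. \<Sum>I\<in>?IC. \<Sum>m<l. e K J I m * p I (I ! m) x)" if "J \<in> ?JC" for J
        using that \<Gamma>0 X0 by - (rule weakly_diff_bd_sum, auto simp: finite_inc_tuples)
      then have "weakly_diff_bd \<Omega> (4 ^ card ?JC * (4 ^ card ?IC * (4 ^ card {..<l} * (\<Gamma> * (4 * X))))) (\<lambda>x. \<Sum>J\<in>?JC. \<Sum>I\<in>?IC. \<Sum>m<l. e K J I m * p I (I ! m) x)"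
        using \<Gamma>0 X0 by - (rule weakly_diff_bd_sum, auto simp: finite_inc_tuples)
      then have "weakly_diff_bd \<Omega> (E * X) (\<lambda>x. \<Sum>J\<in>?JC. \<Sum>I\<in>?IC. \<Sum>m<l. e K J I m * p I (I ! m) x)"
        by (simp only: E_def card_lessThan mult.assoc)
      then show ?thesis by (rule weakly_diff_bd_AE) (rule coeff)
    qed
    have fin: "emeasure lborel \<Omega> < \<infinity>" by (rule emeasure_bounded_finite[OF \<Omega>(2)])
    note wpb = weak_partial_bound[OF moll \<Omega>(1) fin wd]
    have alt: "alt_form (l - 1) (bogovskii l \<theta> \<Omega> u x)" for x
      unfolding bogovskii_def by (rule alt_form_sum_dx)
    have "H1_form (l - 1) \<Omega> (bogovskii l \<theta> \<Omega> u)"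
      unfolding H1_form_def using alt wpb(1) by blast
    moreover have "H1_form_seminorm (l - 1) \<Omega> (bogovskii l \<theta> \<Omega> u) \<le> C * t * \<kappa> * N"
    proof -
      have "(\<Sum>K\<in>?JC. (H1_seminorm \<Omega> (?b K))\<^sup>2) \<le> (\<Sum>K\<in>?JC. CARD('n) * (E * X))"
        by (rule sum_mono) (rule wpb(2))
      also have "\<dots> = (real (card ?JC) * (CARD('n) * (E * ((3 * M)\<^sup>2 * D)))) * (t * \<kappa> * N)\<^sup>2"
        by (simp add: X_def power_mult_distrib)
      finally have "H1_form_seminorm (l - 1) \<Omega> (bogovskii l \<theta> \<Omega> u) \<le> sqrt ((real (card ?JC) * (CARD('n) * (E * ((3 * M)\<^sup>2 * D)))) * (t * \<kappa> * N)\<^sup>2)"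
        unfolding H1_form_seminorm_def by (rule real_sqrt_le_mono)
      also have "\<dots> = C * (t * \<kappa> * N)"
        unfolding C_def using t0 \<kappa>1 N0 by (simp add: real_sqrt_mult)
      finally show ?thesis by (simp only: mult.assoc)
    qed
    ultimately show "H1_form (l - 1) \<Omega> (bogovskii l \<theta> \<Omega> u) \<and>
       H1_form_seminorm (l - 1) \<Omega> (bogovskii l \<theta> \<Omega> u)
         \<le> C * (diameter \<Omega> / diameter (ball a r)) * kappa l \<Omega> (ball a r) * L2_form_norm l \<Omega> u"
      unfolding diameter_ball_eq[OF r] t_def[symmetric] \<kappa>_def[symmetric] N_def[symmetric] by blast
  qed
qed

end
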